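(* Let $\mathcal J:\mathbb R^{d\times T}\to\mathbb R$ be a function that is definable in some o-minimal structure over $(\mathbb R,+,\cdot)$, that is bounded below away from $0$ (i.e. $\inf\mathcal J>0$), and that is differentiable with $\varrho$-Lipschitz continuous gradient. Let $\alpha_1,\alpha_2>0$ and $C>\varrho$. Let $\{(W^t,U^t)\}_{t\ge 0}$ be the sequence generated by Algorithm TFCL (described in the context) from an arbitrary finite, feasible initialization $W^0\in\mathbb R^{d\times T}$, $U^0\in\Gamma$, and write $L^t=L(W^t)$. Suppose that there is a real number $\alpha_3$ with $$0<\alpha_3<2C\inf_{t\ge 0}\breve\delta(L^t).$$ Let $$\widetilde{\mathcal F}(W,U)=\mathcal J(W)+\alpha_1\langle L(W),U\rangle+\frac{\alpha_2}{2}\|W\|_F^2+\iota_\Gamma(U),$$ which is the objective of the problem $(P)$: minimize $\widetilde{\mathcal F}$ over $(W,U)\in\mathbb R^{d\times T}\times\mathbb S_N$. Then: (1) the sequence $\{(W^t,U^t)\}_t$ converges to a critical point $(W^*,U^* )$ of $\widetilde{\mathcal F}$; (2) $\widetilde{\mathcal F}(W^t,U^t)$ converges to $\widetilde{\mathcal F}(W^*,U^* )$; (3) for every integer $t\ge 1$ there is a subgradient $g_t\in\partial\widetilde{\mathcal F}(W^t,U^t)$ such that $\frac1M\sum_{t=1}^M\|g_t\|^2\to 0$ as $M\to\infty$, with rate $O(1/M)$.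
   Context: $d,T\ge1$ are integers, $N=d+T$, $1\le k\le N$ is a fixed integer, and $\mathbb S_N$ is the space of real symmetric $N\times N$ matrices. $\Gamma=\{U\in\mathbb S_N: 0\preceq U\preceq I,\ \mathrm{tr}(U)=k\}$, and $\iota_\Gamma$ is its indicator function ($0$ on $\Gamma$, $+\infty$ elsewhere). For $W\in\mathbb R^{d\times T}$, with $|W|$ the entrywise absolute value, put $A(W)=\begin{bmatrix}0&|W|\\|W|^\top&0\end{bmatrix}\in\mathbb S_N$ and $L(W)=\mathrm{diag}(A(W)\mathbf 1)-A(W)$ (graph Laplacian of the weighted bipartite graph on $d$ features and $T$ tasks). $\langle\cdot,\cdot\rangle$ is the trace inner product. For $L\in\mathbb S_N$ with eigenvalues $\lambda_1\le\dots\le\lambda_N$, set $\lambda_0=-\infty$, $\lambda_{N+1}=+\infty$, $p=\max\{i:0\le i<k,\ \lambda_i<\lambda_{i+1}\}$, $q=\min\{i\ge k:\lambda_i<\lambda_{i+1}\}$ and $\breve\delta(L)=\min\{\lambda_{p+1}-\lambda_p,\ \lambda_{q+1}-\lambda_q\}$. If $v_1,\dots,v_N$ are corresponding orthonormal eigenvectors, put $\mathcal U(L)=\sum_{i=1}^p v_iv_i^\top+\frac{k-p}{q-p}\sum_{i=p+1}^q v_iv_i^\top\in\Gamma$ (independent of the choice of eigenvectors). Algorithm TFCL: given $W^{0}$ and $U^0\in\Gamma$, for $t=1,2,\dots$: (i) $U^t=\mathcal U(L(W^{t-1}))$; (ii) $D^t_{ij}=U^t_{ii}+U^t_{d+j,d+j}-2U^t_{i,d+j}$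 for $1\le i\le d$, $1\le j\le T$; (iii) $\widetilde W^t=W^{t-1}-\frac1C\nabla\mathcal J(W^{t-1})$; (iv) entrywise, $W^t=\mathrm{sgn}(\widetilde W^t)\Big(\frac{|\widetilde W^t|}{1+\alpha_2/C}-\frac{\alpha_1}{C+\alpha_2}D^t\Big)_+$, where $(x)_+=\max(x,0)$. The algorithm is considered as an infinite iteration (no stopping rule), and does not depend on $\alpha_3$. $\partial f$ denotes the general (limiting) subdifferential: $v$ is a regular subgradient of $f$ at $\bar x$ (with $f(\bar x)$ finite) if $f(x)\ge f(\bar x)+\langle v,x-\bar x\rangle+o(|x-\bar x|)$; $v\in\partial f(\bar x)$ if there are $x^\nu\to\bar x$ with $f(x^\nu)\to f(\bar x)$ and regular subgradients $v^\nu$ of $f$ at $x^\nu$ with $v^\nu\to v$. A critical point of $f$ is a point $\bar x$ with $0\in\partial f(\bar x)$. *)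

theory Defs
  imports "HOL-Analysis.Analysis" "HOL-Library.Landau_Symbols" "HOL-Library.Multiset"
begin

section \<open>O-minimal structures over the real field\<close>

text \<open>
  Points of \<open>\<real>\<^sup>n\<close>, for varying \<open>n\<close>, are lists of length \<open>n\<close>; \<open>S n\<close> is the collection of
  definable subsets of \<open>\<real>\<^sup>n\<close>. The last condition says that the definable subsets of the line
  are exactly the finite unions of points and intervals (a point is a degenerate interval), so
  every real number is definable and definability is with parameters.
\<close>

definition o_minimal :: "(nat \<Rightarrow> real list set set) \<Rightarrow> bool" where
  "o_minimal S \<longleftrightarrow>
     (\<forall>n. \<forall>A\<in>S n. A \<subseteq> {x. length x = n}) \<and>
     (\<forall>n. {} \<in> S n) \<and>
     (\<forall>n. \<forall>A\<in>S n. {x. length x = n} - A \<in> S n) \<and>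
     (\<forall>n. \<forall>A\<in>S n. \<forall>B\<in>S n. A \<union> B \<in> S n) \<and>
     (\<forall>n. \<forall>A\<in>S n. {x @ [a] | x a. x \<in> A} \<in> S (Suc n) \<and> {a # x | x a. x \<in> A} \<in> S (Suc n)) \<and>
     (\<forall>n. \<forall>A\<in>S (Suc n). butlast ` A \<in> S n) \<and>
     (\<forall>n i j. i < n \<longrightarrow> j < n \<longrightarrow> {x. length x = n \<and> x ! i = x ! j} \<in> S n) \<and>
     {[a, b, a + b] | a b. True} \<in> S 3 \<and>
     {[a, b, a * b] | a b. True} \<in> S 3 \<and>
     S 1 = {(\<lambda>a. [a]) ` \<Union>\<I> | \<I>. finite \<I> \<and> (\<forall>I\<in>\<I>. is_interval I)}"

text \<open>
  A real function is definable if its graph is. The coordinates are listed in some order, which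
  is immaterial because the definable sets are closed under permutation of coordinates.
\<close>

definition definable_fun :: "(nat \<Rightarrow> real list set set) \<Rightarrow> ('a::euclidean_space \<Rightarrow> real) \<Rightarrow> bool" where
  "definable_fun S f \<longleftrightarrow>
     (\<exists>bs. distinct bs \<and> set bs = Basis \<and>
           {map (\<lambda>b. x \<bullet> b) bs @ [f x] | x. True} \<in> S (Suc (length bs)))"


section \<open>The limiting subdifferential\<close>

text \<open>
  The functions live on a linear subspace \<open>X\<close> of the ambient Euclidean space (below, the product
  of a matrix space with the symmetric matrices), so points and subgradients are taken in \<open>X\<close>.
\<close>

definition regular_subgradient ::
    "'a::euclidean_space set \<Rightarrow> ('a \<Rightarrow> ereal) \<Rightarrow> 'a \<Rightarrow> 'a \<Rightarrow> bool" where
  "regular_subgradient X f xbar v \<longleftrightarrow>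
     xbar \<in> X \<and> v \<in> X \<and> \<bar>f xbar\<bar> \<noteq> \<infinity> \<and>
     (\<forall>\<epsilon>>0. \<forall>\<^sub>F x in at xbar within X.
        f x \<ge> f xbar + ereal (v \<bullet> (x - xbar) - \<epsilon> * norm (x - xbar)))"

definition limiting_subdiff ::
    "'a::euclidean_space set \<Rightarrow> ('a \<Rightarrow> ereal) \<Rightarrow> 'a \<Rightarrow> 'a set" where
  "limiting_subdiff X f xbar =
     {v. xbar \<in> X \<and> \<bar>f xbar\<bar> \<noteq> \<infinity> \<and>
         (\<exists>xs vs. (\<forall>n. regular_subgradient X f (xs n) (vs n)) \<and>
            xs \<longlonglongrightarrow> xbar \<and> (\<lambda>n. f (xs n)) \<longlonglongrightarrow> f xbar \<and> vs \<longlonglongrightarrow> v)}"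

definition critical_point :: "'a::euclidean_space set \<Rightarrow> ('a \<Rightarrow> ereal) \<Rightarrow> 'a \<Rightarrow> bool" where
  "critical_point X f xbar \<longleftrightarrow> 0 \<in> limiting_subdiff X f xbar"


section \<open>Spectral data of a symmetric matrix\<close>

text \<open>
  Eigenvalues with multiplicity in ascending order. Multiplicities are geometric, which for
  symmetric matrices agree with the algebraic ones and add up to the size of the matrix.
\<close>

definition eigval_list :: "real^'n^'n \<Rightarrow> real list" where
  "eigval_list L =
     sorted_list_of_multiset
       (\<Sum>x\<in>{x. \<exists>v. v \<noteq> 0 \<and> L *v v = x *\<^sub>R v}. replicate_mset (dim {v. L *v v = x *\<^sub>R v}) x)"

definition eigval :: "real^'n^'n \<Rightarrow> nat \<Rightarrow> real" where
  "eigval L i = eigval_list L ! (i - 1)"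

definition ext_eigval :: "real^'n^'n \<Rightarrow> nat \<Rightarrow> ereal" where
  "ext_eigval L i = (if i = 0 then -\<infinity> else if i > CARD('n) then \<infinity> else ereal (eigval L i))"

definition lower_index :: "nat \<Rightarrow> real^'n^'n \<Rightarrow> nat" where
  "lower_index k L = Max {i. i < k \<and> ext_eigval L i < ext_eigval L (i + 1)}"

definition upper_index :: "nat \<Rightarrow> real^'n^'n \<Rightarrow> nat" where
  "upper_index k L = (LEAST i. k \<le> i \<and> ext_eigval L i < ext_eigval L (i + 1))"

definition spectral_gap :: "nat \<Rightarrow> real^'n^'n \<Rightarrow> ereal" where
  "spectral_gap k L =
     (let p = lower_index k L; q = upper_index k L
      in min (ext_eigval L (p + 1) - ext_eigval L p) (ext_eigval L (q + 1) - ext_eigval L q))"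

definition orthonormal_eigenvectors :: "real^'n^'n \<Rightarrow> (nat \<Rightarrow> real^'n) \<Rightarrow> bool" where
  "orthonormal_eigenvectors L v \<longleftrightarrow>
     (\<forall>i\<in>{1..CARD('n)}. L *v v i = eigval L i *\<^sub>R v i) \<and>
     (\<forall>i\<in>{1..CARD('n)}. \<forall>j\<in>{1..CARD('n)}. v i \<bullet> v j = (if i = j then 1 else 0))"

definition outer :: "real^'n \<Rightarrow> real^'n^'n" where
  "outer v = (\<chi> a b. v $ a * v $ b)"

text \<open>
  For symmetric \<open>L\<close> and \<open>1 \<le> k \<le> CARD('n)\<close> the description is proper: eigenvectors as required
  exist, and the sums are (combinations of) projections onto sums of full eigenspaces.
\<close>

definition spectral_U :: "nat \<Rightarrow> real^'n^'n \<Rightarrow> real^'n^'n" where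
  "spectral_U k L =
     (let p = lower_index k L; q = upper_index k L
      in THE U. \<exists>v. orthonormal_eigenvectors L v \<and>
           U = (\<Sum>i=1..p. outer (v i)) +
               ((real k - real p) / (real q - real p)) *\<^sub>R (\<Sum>i=p+1..q. outer (v i)))"


section \<open>The optimisation problem\<close>

text \<open>
  The \<open>d + T\<close> vertices of the bipartite graph are the elements of the sum type \<open>'d + 't\<close>
  (features and tasks). On matrix types \<open>\<bullet>\<close> and \<open>norm\<close> are the trace inner product and
  the Frobenius norm.
\<close>

definition sym_matrices :: "(real^'n^'n) set" where
  "sym_matrices = {U. transpose U = U}"

definition psd :: "real^'n^'n \<Rightarrow> bool" where
  "psd U \<longleftrightarrow> U \<in> sym_matrices \<and> (\<forall>x. 0 \<le> x \<bullet> (U *v x))"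

definition Gam :: "nat \<Rightarrow> (real^'n^'n) set" where
  "Gam k = {U \<in> sym_matrices. psd U \<and> psd (mat 1 - U) \<and> trace U = real k}"

definition indicator_infty :: "'a set \<Rightarrow> 'a \<Rightarrow> ereal" where
  "indicator_infty S x = (if x \<in> S then 0 else \<infinity>)"

definition adjacency :: "real^'t^'d \<Rightarrow> real^('d + 't)^('d::finite + 't::finite)" where
  "adjacency W =
     (\<chi> a b. case (a, b) of
        (Inl i, Inr j) \<Rightarrow> \<bar>W $ i $ j\<bar>
      | (Inr j, Inl i) \<Rightarrow> \<bar>W $ i $ j\<bar>
      | _ \<Rightarrow> 0)"

definition laplacian :: "real^'t^'d \<Rightarrow> real^('d + 't)^('d::finite + 't::finite)" where
  "laplacian W = (\<chi> a b. if a = b then (adjacency W *v 1) $ a else 0) - adjacency W"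

definition objective ::
    "(real^'t^'d \<Rightarrow> real) \<Rightarrow> real \<Rightarrow> real \<Rightarrow> nat \<Rightarrow>
     (real^'t^'d) \<times> (real^('d + 't)^('d::finite + 't::finite)) \<Rightarrow> ereal" where
  "objective J \<alpha>1 \<alpha>2 k =
     (\<lambda>(W, U). ereal (J W + \<alpha>1 * (laplacian W \<bullet> U) + \<alpha>2 / 2 * (norm W)\<^sup>2)
               + indicator_infty (Gam k) U)"


section \<open>The algorithm\<close>

definition pair_dist :: "real^('d + 't)^('d::finite + 't::finite) \<Rightarrow> real^'t^'d" where
  "pair_dist U = (\<chi> i j. U $ Inl i $ Inl i + U $ Inr j $ Inr j - 2 * U $ Inl i $ Inr j)"

definition grad_step :: "(real^'t^'d \<Rightarrow> real^'t^'d) \<Rightarrow> real \<Rightarrow> real^'t^'d \<Rightarrow> real^'t^'d" where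
  "grad_step gradJ C W = W - (1 / C) *\<^sub>R gradJ W"

definition threshold ::
    "real \<Rightarrow> real \<Rightarrow> real \<Rightarrow> real^'t^'d \<Rightarrow> real^'t^'d \<Rightarrow> real^'t^'d" where
  "threshold \<alpha>1 \<alpha>2 C D V =
     (\<chi> i j. sgn (V $ i $ j) *
        max (\<bar>V $ i $ j\<bar> / (1 + \<alpha>2 / C) - \<alpha>1 / (C + \<alpha>2) * D $ i $ j) 0)"

definition tfcl_sequence ::
    "nat \<Rightarrow> (real^'t^'d \<Rightarrow> real^'t^'d) \<Rightarrow> real \<Rightarrow> real \<Rightarrow> real \<Rightarrow>
     (nat \<Rightarrow> real^'t^'d) \<Rightarrow> (nat \<Rightarrow> real^('d + 't)^('d::finite + 't::finite)) \<Rightarrow> bool" where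
  "tfcl_sequence k gradJ \<alpha>1 \<alpha>2 C W U \<longleftrightarrow>
     U 0 \<in> Gam k \<and>
     (\<forall>t\<ge>1. U t = spectral_U k (laplacian (W (t - 1))) \<and>
             W t = threshold \<alpha>1 \<alpha>2 C (pair_dist (U t)) (grad_step gradJ C (W (t - 1))))"

end

theory Submission
  imports Defs
begin

text \<open>
  Put \<open>\<beta> = \<alpha>3 / (2 C)\<close>. Since \<open>\<beta>\<close> is at most every spectral gap, \<open>U\<^sup>t\<close> minimises
  \<open>\<langle>L(W\<^sup>t\<^sup>-\<^sup>1), U\<rangle> + \<gamma>/2 \<parallel>U\<parallel>\<^sup>2\<close> over \<open>\<Gamma>\<close> for every \<open>\<gamma> \<in> [0, \<beta>]\<close>. With \<open>\<gamma> = \<beta>\<close> the algorithm becomes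
  an alternating minimisation with sufficient decrease in both blocks; with \<open>\<gamma> = 0\<close> the same
  optimality conditions give subgradients of the original objective, bounded by the step length. As
  all functions involved are weakly convex, these subgradient inequalities hold with a uniform
  quadratic error.

  Convergence of the iterates follows from o-minimality without differentiating anything. In each
  level set \<open>f = r\<close> choose definably a point \<open>x(r)\<close> of least slope. By the monotonicity theorem the
  coordinates of \<open>x\<close> are monotone just above the limit value, so the distances \<open>\<ell>\<^sub>t\<close> between
  \<open>x(f(z\<^sub>t))\<close> and \<open>x(f(z\<^sub>t\<^sub>+\<^sub>1))\<close> are summable. Comparing the decrease of \<open>f\<close> along the iterates with
  its decrease between these points gives \<open>a u\<^sub>t\<^sub>+\<^sub>1\<^sup>2 \<le> b u\<^sub>t \<ell>\<^sub>t + c \<ell>\<^sub>t\<^sup>2\<close> for the step lengths \<open>u\<^sub>t\<close>, and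
  hence \<open>u\<^sub>t\<^sub>+\<^sub>1 \<le> u\<^sub>t / 2 + M \<ell>\<^sub>t\<close>, which is summable.
\<close>

section \<open>O-minimal structures\<close>

text \<open>With \<gamma> = 0 the subproblem for \<open>U\<close> is linear, so its minimisation
  yields no decrease proportional to the squared step in \<open>U\<close>; this is why a positive
  \<beta> below every gap is wanted. The subgradient built from one step does not contain \<gamma>,
  so the vector that serves the regularised function also certifies criticality for the original
  one. Slope at \<open>x\<close> means a number \<open>s\<close> with \<open>f y \<ge> f x - s *
  norm (y - x) - c * (norm (y - x))\<^sup>2\<close> for all \<open>y\<close> in a compact definable
  set that contains the iterates. This is a first-order formula in \<open>f\<close>, so pairs of a
  slope and a point form a definable family. Minimising coordinates one after the other, the slope
  first, selects one pair per value; compact fibres guarantee that the minima exist. A slope at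
  \<open>z (Suc t)\<close> is controlled by the step that led there, while the decrease after it
  controls the next step. This shift of the index is what turns the comparison into a
  contraction.\<close>

locale o_minimal_structure =
  fixes S :: "nat \<Rightarrow> real list set set"
  assumes o_minimal: "o_minimal S"
begin

lemma
  shows S_length: "A \<in> S n \<Longrightarrow> x \<in> A \<Longrightarrow> length x = n"
    and S_empty: "{} \<in> S n"
    and S_Compl: "A \<in> S n \<Longrightarrow> {x. length x = n} - A \<in> S n"
    and S_Un: "A \<in> S n \<Longrightarrow> B \<in> S n \<Longrightarrow> A \<union> B \<in> S n"
    and S_Cons: "A \<in> S n \<Longrightarrow> {a # x | x a. x \<in> A} \<in> S (Suc n)"
    and S_butlast: "A \<in> S (Suc n) \<Longrightarrow> butlast ` A \<in> S n"
    and S_diag: "i < n \<Longrightarrow> j < n \<Longrightarrow> {x. length x = n \<and> x ! i = x ! j} \<in> S n"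
    and S_plus: "{[a, b, a + b] | a b. True} \<in> S 3"
    and S_times: "{[a, b, a * b] | a b. True} \<in> S 3"
    and S_1: "S 1 = {(\<lambda>a. [a]) ` \<Union>\<I> | \<I>. finite \<I> \<and> (\<forall>I\<in>\<I>. is_interval I)}"
proof -
  note ax = o_minimal[unfolded o_minimal_def]
  note c2 = conjunct2[OF ax] note c3 = conjunct2[OF c2] note c4 = conjunct2[OF c3]
  note c5 = conjunct2[OF c4] note c6 = conjunct2[OF c5] note c7 = conjunct2[OF c6]
  note c8 = conjunct2[OF c7] note c9 = conjunct2[OF c8]
  show "A \<in> S n \<Longrightarrow> x \<in> A \<Longrightarrow> length x = n" using conjunct1[OF ax] by blast
  show "{} \<in> S n" using conjunct1[OF c2] by blast
  show "A \<in> S n \<Longrightarrow> {x. length x = n} - A \<in> S n" using conjunct1[OF c3] by blast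
  show "A \<in> S n \<Longrightarrow> B \<in> S n \<Longrightarrow> A \<union> B \<in> S n" using conjunct1[OF c4] by blast
  show "A \<in> S n \<Longrightarrow> {a # x | x a. x \<in> A} \<in> S (Suc n)" using conjunct1[OF c5] by blast
  show "A \<in> S (Suc n) \<Longrightarrow> butlast ` A \<in> S n" using conjunct1[OF c6] by blast
  show "i < n \<Longrightarrow> j < n \<Longrightarrow> {x. length x = n \<and> x ! i = x ! j} \<in> S n" using conjunct1[OF c7] by blast
  show "{[a, b, a + b] | a b. True} \<in> S 3" using conjunct1[OF c8] .
  show "{[a, b, a * b] | a b. True} \<in> S 3" using conjunct1[OF c9] .
  show "S 1 = {(\<lambda>a. [a]) ` \<Union>\<I> | \<I>. finite \<I> \<and> (\<forall>I\<in>\<I>. is_interval I)}"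
    using conjunct2[OF c9] .
qed

lemma S_UNIV: "{x. length x = n} \<in> S n"
  using S_Compl[OF S_empty, of n] by simp

lemma S_Int:
  assumes "A \<in> S n" "B \<in> S n"
  shows "A \<inter> B \<in> S n"
proof -
  have "A \<inter> B = {x. length x = n} - (({x. length x = n} - A) \<union> ({x. length x = n} - B))"
    using assms S_length by blast
  then show ?thesis
    using assms by (metis S_Compl S_Un)
qed

lemma S_prepend:
  assumes "A \<in> S n"
  shows "{y @ x | x y. length y = m \<and> x \<in> A} \<in> S (m + n)"
proof (induction m)
  case 0
  then show ?case using assms by simp
next
  case (Suc m)
  have "{y @ x | x y. length y = Suc m \<and> x \<in> A}
      = {a # z | z a. z \<in> {y @ x | x y. length y = m \<and> x \<in> A}}"
    by (auto simp: length_Suc_conv) (metis append_Cons)+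
  then show ?case using S_Cons[OF Suc] by simp
qed

lemma S_take:
  assumes "A \<in> S (n + m)"
  shows "take n ` A \<in> S n"
  using assms
proof (induction m arbitrary: A)
  case 0
  have "take n ` A = A"
    using S_length[OF 0] by force
  then show ?case using 0 by simp
next
  case (Suc m)
  have "butlast ` A \<in> S (n + m)"
    using S_butlast Suc.prems by simp
  from Suc.IH[OF this] have "take n ` butlast ` A \<in> S n" .
  moreover have "take n ` butlast ` A = take n ` A"
    using S_length[OF Suc.prems] by (force simp: image_image take_butlast intro!: image_cong)
  ultimately show ?case by simp
qed

lemma S_finite_INT:
  assumes "finite I" "\<And>i. i \<in> I \<Longrightarrow> A i \<in> S n"
  shows "{x. length x = n \<and> (\<forall>i\<in>I. x \<in> A i)} \<in> S n"
  using assms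
proof (induction I)
  case empty
  then show ?case using S_UNIV by simp
next
  case (insert i I)
  have "{x. length x = n \<and> (\<forall>j\<in>insert i I. x \<in> A j)}
     = A i \<inter> {x. length x = n \<and> (\<forall>j\<in>I. x \<in> A j)}"
    using S_length insert.prems by blast
  then show ?case using insert S_Int by simp
qed

lemma S_reindex:
  assumes A: "A \<in> S (length js)" and js: "\<And>j. j \<in> set js \<Longrightarrow> j < n"
  shows "{x. length x = n \<and> map ((!) x) js \<in> A} \<in> S n"
proof -
  \<comment> \<open>The graph of the reindexing map is cut out of a product by diagonals; the result is its projection.\<close>
  let ?m = "length js"
  let ?B = "{y @ x | x y. length y = n \<and> x \<in> A}"
  let ?D = "{z. length z = n + ?m \<and>
      (\<forall>i\<in>{..<?m}. z \<in> {z. length z = n + ?m \<and> z ! (js ! i) = z ! (n + i)})}"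
  have "?B \<in> S (n + ?m)" using S_prepend[OF A] .
  moreover have "?D \<in> S (n + ?m)"
    by (rule S_finite_INT) (auto intro!: S_diag simp: js trans_less_add1)
  ultimately have "take n ` (?B \<inter> ?D) \<in> S n"
    by (intro S_take S_Int)
  moreover have "take n ` (?B \<inter> ?D) = {x. length x = n \<and> map ((!) x) js \<in> A}"
  proof (intro set_eqI iffI)
    fix x assume "x \<in> take n ` (?B \<inter> ?D)"
    then obtain y where y: "length x = n" "y \<in> A" "x @ y \<in> ?D" by auto
    have "map ((!) x) js = y"
      using y js S_length[OF A y(2)] by (intro nth_equalityI) (auto simp: nth_append)
    then show "x \<in> {x. length x = n \<and> map ((!) x) js \<in> A}" using y by simp
  next
    fix x assume x: "x \<in> {x. length x = n \<and> map ((!) x) js \<in> A}"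
    then have "x @ map ((!) x) js \<in> ?B \<inter> ?D"
      using js by (auto simp: nth_append)
    then show "x \<in> take n ` (?B \<inter> ?D)" using x by force
  qed
  ultimately show ?thesis by simp
qed

end

section \<open>Coordinate lists and definable sets in Euclidean spaces\<close>

definition basis_list :: "'a::euclidean_space list \<Rightarrow> bool" where
  "basis_list bs \<longleftrightarrow> distinct bs \<and> set bs = Basis"

definition coords :: "'a::euclidean_space list \<Rightarrow> 'a \<Rightarrow> real list" where
  "coords bs x = map (\<lambda>b. x \<bullet> b) bs"

lemma length_coords [simp]: "length (coords bs x) = length bs"
  by (simp add: coords_def)

lemma basis_list_exists: "\<exists>bs. basis_list (bs :: 'a::euclidean_space list)"
  unfolding basis_list_def using finite_distinct_list[OF finite_Basis] by blast

lemma inj_coords: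
  assumes "basis_list bs"
  shows "inj (coords bs)"
  using assms unfolding basis_list_def coords_def
  by (intro injI) (metis euclidean_eqI map_eq_conv)

lemma coords_surj:
  assumes "basis_list bs" "length l = length bs"
  shows "\<exists>x. coords bs x = l"
proof -
  define f where "f = (\<lambda>b. l ! (THE i. i < length bs \<and> bs ! i = b))"
  have *: "f (bs ! i) = l ! i" if "i < length bs" for i
  proof -
    have "(THE j. j < length bs \<and> bs ! j = bs ! i) = i"
      using that assms(1) by (intro the_equality) (auto simp: basis_list_def nth_eq_iff_index_eq)
    then show ?thesis by (simp add: f_def)
  qed
  have "coords bs (\<Sum>b\<in>Basis. f b *\<^sub>R b) = l"
  proof (rule nth_equalityI)
    fix i assume "i < length (coords bs (\<Sum>b\<in>Basis. f b *\<^sub>R b))"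
    then have i: "i < length bs" by simp
    have "bs ! i \<in> Basis" using assms(1) nth_mem[OF i] unfolding basis_list_def by blast
    then show "coords bs (\<Sum>b\<in>Basis. f b *\<^sub>R b) ! i = l ! i"
      using i *[OF i] by (simp add: coords_def)
  qed (use assms in simp)
  then show ?thesis by blast
qed

lemma range_coords:
  "basis_list bs \<Longrightarrow> range (coords bs) = {x. length x = length bs}"
  using coords_surj by fastforce

lemma basis_list_prod:
  assumes "basis_list as" "basis_list bs"
  shows "basis_list (map (\<lambda>a. (a, 0)) as @ map (\<lambda>b. (0, b)) bs)"
  using assms by (auto simp: basis_list_def Basis_prod_def distinct_map inj_on_def)

lemma coords_prod:
  "coords (map (\<lambda>a. (a, 0)) as @ map (\<lambda>b. (0, b)) bs) p = coords as (fst p) @ coords bs (snd p)"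
  by (cases p) (simp add: coords_def)

context o_minimal_structure begin

text \<open>One ordering of the basis is enough: \<open>definable_coords\<close> passes to any other
  by permuting coordinates.\<close>

definition definable :: "'a::euclidean_space set \<Rightarrow> bool" where
  "definable A \<longleftrightarrow> (\<exists>bs. basis_list bs \<and> coords bs ` A \<in> S (length bs))"

lemma definableI: "basis_list bs \<Longrightarrow> coords bs ` A \<in> S (length bs) \<Longrightarrow> definable A"
  unfolding definable_def by blast

text \<open>Each coordinate of \<open>h x\<close> is a coordinate of \<open>x\<close>, so on
  coordinate lists \<open>h\<close> only reindexes and \<open>S_reindex\<close> applies. With the
  identity for \<open>h\<close> and two orderings of one basis this gives independence of the
  ordering.\<close>

lemma definable_coordinate_vimage_aux:
  assumes as: "basis_list as" and bs: "basis_list bs" and A: "coords bs ` A \<in> S (length bs)"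
    and h: "\<And>x b. b \<in> Basis \<Longrightarrow> h x \<bullet> b = x \<bullet> \<tau> b" and \<tau>: "\<And>b. b \<in> Basis \<Longrightarrow> \<tau> b \<in> Basis"
  shows "coords as ` {x. h x \<in> A} \<in> S (length as)"
proof -
  have "\<forall>b\<in>Basis. \<exists>i < length as. as ! i = \<tau> b"
    using as \<tau> by (metis basis_list_def in_set_conv_nth)
  then obtain i where i: "\<And>b. b \<in> Basis \<Longrightarrow> i b < length as \<and> as ! i b = \<tau> b"
    by metis
  have *: "map ((!) (coords as x)) (map i bs) = coords bs (h x)" for x
    using bs h i by (auto simp: coords_def basis_list_def)
  have "{x. length x = length as \<and> map ((!) x) (map i bs) \<in> coords bs ` A} \<in> S (length as)"
    using A i bs by (intro S_reindex) (auto simp: basis_list_def)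
  also have "{x. length x = length as \<and> map ((!) x) (map i bs) \<in> coords bs ` A}
      = coords as ` {x. h x \<in> A}" (is "?L = ?R")
  proof (intro set_eqI iffI)
    fix l assume l: "l \<in> ?L"
    then obtain x where x: "l = coords as x" using coords_surj[OF as] by auto
    with l have "coords bs (h x) \<in> coords bs ` A" using *[of x] by simp
    then have "h x \<in> A" using inj_coords[OF bs] by (simp add: inj_image_mem_iff)
    then show "l \<in> ?R" using x by simp
  next
    fix l assume "l \<in> ?R"
    then obtain x where x: "l = coords as x" "h x \<in> A" by auto
    then show "l \<in> ?L" using *[of x] by auto
  qed
  finally show ?thesis .
qed

lemma definable_coords:
  assumes "definable A" "basis_list bs"
  shows "coords bs ` A \<in> S (length bs)"
proof -
  obtain cs where cs: "basis_list cs" "coords cs ` A \<in> S (length cs)"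
    using assms(1) by (auto simp: definable_def)
  show ?thesis
    using definable_coordinate_vimage_aux[OF assms(2) cs, of "\<lambda>x. x" "\<lambda>b. b"] by simp
qed

lemma definable_coordinate_vimage:
  fixes h :: "'a::euclidean_space \<Rightarrow> 'b::euclidean_space"
  assumes "definable A" "\<And>x b. b \<in> Basis \<Longrightarrow> h x \<bullet> b = x \<bullet> \<tau> b" "\<And>b. b \<in> Basis \<Longrightarrow> \<tau> b \<in> Basis"
  shows "definable {x. h x \<in> A}"
proof -
  obtain as :: "'a list" where "basis_list as" using basis_list_exists by blast
  moreover obtain bs where "basis_list bs" "coords bs ` A \<in> S (length bs)"
    using assms(1) by (auto simp: definable_def)
  ultimately show ?thesis
    using definable_coordinate_vimage_aux[of as bs A h \<tau>] assms(2,3) by (blast intro: definableI)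
qed

lemma definable_UNIV: "definable UNIV"
proof -
  obtain bs :: "'a list" where "basis_list bs" using basis_list_exists by blast
  then show ?thesis using S_UNIV[of "length bs"] by (intro definableI[of bs]) (simp_all add: range_coords)
qed

lemma definable_not:
  fixes P :: "'a::euclidean_space \<Rightarrow> bool"
  assumes "definable {x. P x}"
  shows "definable {x. \<not> P x}"
proof -
  obtain bs :: "'a list" where bs: "basis_list bs" using basis_list_exists by blast
  have "coords bs ` {x. \<not> P x} = {x. length x = length bs} - coords bs ` {x. P x}"
    using inj_coords[OF bs] unfolding range_coords[OF bs, symmetric] by (auto simp: inj_def)
  then show ?thesis
    using S_Compl[OF definable_coords[OF assms bs]] bs by (intro definableI[of bs]) simp_all
qed

lemma definable_disj:
  fixes P Q :: "'a::euclidean_space \<Rightarrow> bool"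
  assumes "definable {x. P x}" "definable {x. Q x}"
  shows "definable {x. P x \<or> Q x}"
proof -
  obtain bs :: "'a list" where bs: "basis_list bs" using basis_list_exists by blast
  have "coords bs ` {x. P x \<or> Q x} = coords bs ` {x. P x} \<union> coords bs ` {x. Q x}"
    by auto
  then show ?thesis
    using S_Un[OF assms[THEN definable_coords[OF _ bs]]] bs by (intro definableI[of bs]) simp_all
qed

lemma definable_conj:
  assumes "definable {x. P x}" "definable {x. Q x}"
  shows "definable {x. P x \<and> Q x}"
  using definable_not[OF definable_disj[OF assms[THEN definable_not]]] by simp

lemma definable_imp:
  assumes "definable {x. P x}" "definable {x. Q x}"
  shows "definable {x. P x \<longrightarrow> Q x}"
  unfolding imp_conv_disj by (intro definable_disj definable_not assms)

lemma definable_finite_ball: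
  assumes "finite I" "\<And>i. i \<in> I \<Longrightarrow> definable {x. P i x}"
  shows "definable {x. \<forall>i\<in>I. P i x}"
  using assms
proof (induction I)
  case empty
  then show ?case using definable_UNIV by simp
next
  case (insert i I)
  then have "definable {x. P i x \<and> (\<forall>j\<in>I. P j x)}"
    by (intro definable_conj) simp_all
  then show ?case by simp
qed

text \<open>In the coordinate list of a pair the second component comes last, so the quantifier is a
  projection that cuts off the tail of the list.\<close>

lemma definable_ex:
  fixes P :: "'a::euclidean_space \<Rightarrow> 'b::euclidean_space \<Rightarrow> bool"
  assumes "definable {p. P (fst p) (snd p)}"
  shows "definable {x. \<exists>y. P x y}"
proof -
  obtain as :: "'a list" where as: "basis_list as" using basis_list_exists by blast
  obtain bs :: "'b list" where bs: "basis_list bs" using basis_list_exists by blast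
  let ?cs = "map (\<lambda>a. (a, 0)) as @ map (\<lambda>b. (0, b)) bs"
  have "coords ?cs ` {p. P (fst p) (snd p)} \<in> S (length as + length bs)"
    using definable_coords[OF assms basis_list_prod[OF as bs]] by simp
  from S_take[OF this] have "take (length as) ` coords ?cs ` {p. P (fst p) (snd p)} \<in> S (length as)" .
  also have "take (length as) ` coords ?cs ` {p. P (fst p) (snd p)} = coords as ` {x. \<exists>y. P x y}"
  proof (intro set_eqI iffI)
    fix l assume "l \<in> coords as ` {x. \<exists>y. P x y}"
    then obtain x y where "l = coords as x" "P x y" by blast
    then show "l \<in> take (length as) ` coords ?cs ` {p. P (fst p) (snd p)}"
      by (intro image_eqI[of _ _ "coords ?cs (x, y)"] image_eqI[of _ _ "(x, y)"])
         (simp_all add: coords_prod)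
  qed (auto simp: coords_prod intro!: imageI)
  finally show ?thesis using as by (intro definableI[of as])
qed

lemma definable_all:
  assumes "definable {p. P (fst p) (snd p)}"
  shows "definable {x. \<forall>y. P x y}"
  using definable_not[OF definable_ex[where P="\<lambda>x y. \<not> P x y", OF definable_not[OF assms]]] by simp

text \<open>Only real-valued maps are covered; a vector-valued map \<open>h\<close> is handled
  through its coordinates \<open>\<lambda>x. h x \<bullet> b\<close>.\<close>

definition definable_map :: "('a::euclidean_space \<Rightarrow> real) \<Rightarrow> bool" where
  "definable_map f \<longleftrightarrow> definable {p. snd p = f (fst p)}"

lemma definable_map_fst:
  assumes "definable_map f"
  shows "definable_map (\<lambda>p. f (fst p))"
proof -
  have "definable {p. (fst (fst p), snd p) \<in> {p. snd p = f (fst p)}}"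
    by (rule definable_coordinate_vimage[OF assms[unfolded definable_map_def],
          where \<tau>="\<lambda>b. ((fst b, 0), snd b)"])
       (auto simp: Basis_prod_def inner_prod_def zero_prod_def)
  then show ?thesis by (simp add: definable_map_def)
qed

lemma definable_map_snd:
  assumes "definable_map f"
  shows "definable_map (\<lambda>p. f (snd p))"
proof -
  have "definable {p. (snd (fst p), snd p) \<in> {p. snd p = f (fst p)}}"
    by (rule definable_coordinate_vimage[OF assms[unfolded definable_map_def],
          where \<tau>="\<lambda>b. ((0, fst b), snd b)"])
       (auto simp: Basis_prod_def inner_prod_def zero_prod_def)
  then show ?thesis by (simp add: definable_map_def)
qed

text \<open>This carries the axiom on \<open>S 1\<close>, the tameness of the structure, over to
  sets of reals; all finiteness arguments below rest on it.\<close>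

lemma definable_real_iff:
  "definable A \<longleftrightarrow> (\<exists>\<I>. finite \<I> \<and> (\<forall>I\<in>\<I>. is_interval I) \<and> A = \<Union>\<I>)" for A :: "real set"
proof -
  have 1: "basis_list [1::real]" by (simp add: basis_list_def)
  have "definable A \<longleftrightarrow> coords [1] ` A \<in> S 1"
    using definable_coords[OF _ 1] 1 unfolding definable_def by force
  also have "coords [1] = (\<lambda>a::real. [a])" by (simp add: coords_def fun_eq_iff)
  also have "(\<lambda>a. [a]) ` A \<in> S 1 \<longleftrightarrow> (\<exists>\<I>. finite \<I> \<and> (\<forall>I\<in>\<I>. is_interval I) \<and> A = \<Union>\<I>)"
    unfolding S_1 mem_Collect_eq by (subst inj_image_eq_iff) (auto simp: inj_def)
  finally show ?thesis .
qed

lemma definable_interval: "is_interval I \<Longrightarrow> definable I" for I :: "real set"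
  unfolding definable_real_iff by (intro exI[of _ "{I}"]) simp

lemma definable_eq: "definable {p :: real \<times> real. snd p = fst p}"
proof -
  have bs: "basis_list [(1::real, 0::real), (0, 1)]"
    by (auto simp: basis_list_def Basis_prod_def)
  have "{x. length x = 2 \<and> x ! 0 = x ! 1} \<in> S 2" by (rule S_diag) auto
  also have "{x. length x = 2 \<and> x ! 0 = x ! 1} = coords [(1::real, 0::real), (0, 1)] ` {p. snd p = fst p}"
    by (force simp: coords_def length_Suc_conv numeral_2_eq_2 image_iff)
  finally show ?thesis using bs by (intro definableI[OF bs]) (simp add: numeral_2_eq_2)
qed

lemma definable_ternary:
  assumes "{[a, b, f a b] | a b. True} \<in> S 3"
  shows "definable {p :: (real \<times> real) \<times> real. snd p = f (fst (fst p)) (snd (fst p))}"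
proof -
  let ?bs = "[((1::real, 0::real), 0::real), ((0, 1), 0), ((0, 0), 1)]"
  have bs: "basis_list ?bs"
    by (auto simp: basis_list_def Basis_prod_def zero_prod_def)
  have "coords ?bs ` {p. snd p = f (fst (fst p)) (snd (fst p))} = {[a, b, f a b] | a b. True}"
    by (force simp: coords_def image_iff)
  then show ?thesis using assms by (intro definableI[OF bs]) (simp add: numeral_3_eq_3)
qed

lemma definable_map_Basis:
  assumes "b \<in> Basis"
  shows "definable_map (\<lambda>x. x \<bullet> b)"
proof -
  have "definable {p. (fst p \<bullet> b, snd p) \<in> {p. snd p = fst p}}"
    by (rule definable_coordinate_vimage[OF definable_eq,
          where \<tau>="\<lambda>c. (fst c *\<^sub>R b, snd c)"])
       (use assms in \<open>auto simp: Basis_prod_def inner_prod_def zero_prod_def\<close>)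
  then show ?thesis by (simp add: definable_map_def)
qed

text \<open>The condition says that some \<open>y\<close> in \<open>A\<close> has the coordinates of
  \<open>h x\<close>. The coordinate graphs are definable, and \<open>y\<close> is removed by
  projection.\<close>

lemma definable_vimage:
  fixes h :: "'a::euclidean_space \<Rightarrow> 'b::euclidean_space"
  assumes A: "definable A" and h: "\<And>b. b \<in> Basis \<Longrightarrow> definable_map (\<lambda>x. h x \<bullet> b)"
  shows "definable {x. h x \<in> A}"
proof -
  have "definable {p :: 'a \<times> 'b. (fst p, snd p \<bullet> b) \<in> {p. snd p = h (fst p) \<bullet> b}}"
    if b: "b \<in> Basis" for b
    by (rule definable_coordinate_vimage[OF h[OF b, unfolded definable_map_def],
          where \<tau>="\<lambda>c. (fst c, snd c *\<^sub>R b)"])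
       (use b in \<open>auto simp: Basis_prod_def inner_prod_def zero_prod_def\<close>)
  then have 1: "definable {p :: 'a \<times> 'b. snd p \<bullet> b = h (fst p) \<bullet> b}" if "b \<in> Basis" for b
    using that by simp
  have 2: "definable {p :: 'a \<times> 'b. snd p \<in> A}"
    using definable_coordinate_vimage[OF A, of snd "\<lambda>c. (0, c)"] 
    by (auto simp: Basis_prod_def inner_prod_def)
  have "definable {x. \<exists>y. y \<in> A \<and> (\<forall>b\<in>Basis. y \<bullet> b = h x \<bullet> b)}"
    by (intro definable_ex definable_conj definable_finite_ball 1 2) simp_all
  also have "{x. \<exists>y. y \<in> A \<and> (\<forall>b\<in>Basis. y \<bullet> b = h x \<bullet> b)} = {x. h x \<in> A}"
    by (auto simp: euclidean_eq_iff[symmetric])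
  finally show ?thesis .
qed

lemma definable_map_Pair:
  assumes "\<And>b. b \<in> Basis \<Longrightarrow> definable_map (\<lambda>x. f x \<bullet> b)"
    "\<And>b. b \<in> Basis \<Longrightarrow> definable_map (\<lambda>x. g x \<bullet> b)" "b \<in> Basis"
  shows "definable_map (\<lambda>x. (f x, g x) \<bullet> b)"
  using assms by (auto simp: Basis_prod_def inner_prod_def)

lemma definable_map_compose:
  assumes g: "definable_map g" and h: "\<And>b. b \<in> Basis \<Longrightarrow> definable_map (\<lambda>x. h x \<bullet> b)"
  shows "definable_map (\<lambda>x. g (h x))"
proof -
  have "definable {p. (h (fst p), snd p) \<in> {q. snd q = g (fst q)}}"
    using definable_map_fst[OF h] definable_map_snd[OF definable_map_Basis]
    by (intro definable_vimage definable_map_Pair g[unfolded definable_map_def])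
  then show ?thesis by (simp add: definable_map_def)
qed

lemma definable_map_real: "definable_map f \<Longrightarrow> b \<in> Basis \<Longrightarrow> definable_map (\<lambda>x. f x \<bullet> b)"
  for f :: "'a::euclidean_space \<Rightarrow> real"
  by simp

lemma definable_map_const: "definable_map (\<lambda>x::'a::euclidean_space. c)"
proof -
  have "definable {p :: 'a \<times> real. snd p \<in> {c}}"
    using definable_coordinate_vimage[OF definable_interval[of "{c}"], of snd "\<lambda>c. (0, c)"]
    by (auto simp: Basis_prod_def inner_prod_def is_interval_def)
  then show ?thesis by (simp add: definable_map_def)
qed

lemma definable_map_add:
  assumes "definable_map f" "definable_map g"
  shows "definable_map (\<lambda>x. f x + g x)"
proof -
  have *: "definable_map (\<lambda>p. fst p + snd p)"
    using definable_ternary[OF S_plus] by (simp add: definable_map_def)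
  have "definable_map (\<lambda>x. fst (f x, g x) + snd (f x, g x))"
    by (rule definable_map_compose[OF *], rule definable_map_Pair) (use assms in simp_all)
  then show ?thesis by simp
qed

lemma definable_map_mult:
  assumes "definable_map f" "definable_map g"
  shows "definable_map (\<lambda>x. f x * g x)"
proof -
  have *: "definable_map (\<lambda>p. fst p * snd p)"
    using definable_ternary[OF S_times] by (simp add: definable_map_def)
  have "definable_map (\<lambda>x. fst (f x, g x) * snd (f x, g x))"
    by (rule definable_map_compose[OF *], rule definable_map_Pair) (use assms in simp_all)
  then show ?thesis by simp
qed

lemma definable_map_minus: "definable_map f \<Longrightarrow> definable_map (\<lambda>x. - f x)"
  using definable_map_mult[OF definable_map_const, of f "-1"] by simp

lemma definable_map_diff:
  "definable_map f \<Longrightarrow> definable_map g \<Longrightarrow> definable_map (\<lambda>x. f x - g x)"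
  using definable_map_add[OF _ definable_map_minus, of f g] by simp

lemma definable_map_sum:
  assumes "\<And>i. i \<in> I \<Longrightarrow> definable_map (f i)"
  shows "definable_map (\<lambda>x. \<Sum>i\<in>I. f i x)"
  using assms
  by (induction I rule: infinite_finite_induct) (simp_all add: definable_map_const definable_map_add)

lemma definable_le:
  assumes "definable_map f" "definable_map g"
  shows "definable {x. f x \<le> g x}"
proof -
  have "definable {x. g x - f x \<in> {0..}}"
    using assms by (intro definable_vimage definable_interval) (simp_all add: definable_map_diff is_interval_ci)
  then show ?thesis by simp
qed

lemma definable_less:
  "definable_map f \<Longrightarrow> definable_map g \<Longrightarrow> definable {x. f x < g x}"
  using definable_not[OF definable_le, of g f] by (simp add: not_le)

lemma definable_equal:
  "definable_map f \<Longrightarrow> definable_map g \<Longrightarrow> definable {x. f x = g x}"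
  using definable_conj[OF definable_le definable_le, of f g g f] by (simp add: order_eq_iff)

lemma definable_map_abs:
  assumes "definable_map f"
  shows "definable_map (\<lambda>x. \<bar>f x\<bar>)"
proof -
  have f: "definable_map (\<lambda>p. f (fst p))" "definable_map (\<lambda>p::_ \<times> real. snd p)"
    using definable_map_fst[OF assms] definable_map_snd[OF definable_map_Basis, of "1::real"] by simp_all
  have "definable {p. (0 \<le> f (fst p) \<and> snd p = f (fst p)) \<or> (\<not> 0 \<le> f (fst p) \<and> snd p = - f (fst p))}"
    by (intro definable_disj definable_conj definable_not definable_le definable_equal
        definable_map_const definable_map_minus f)
  also have "{p. (0 \<le> f (fst p) \<and> snd p = f (fst p)) \<or> (\<not> 0 \<le> f (fst p) \<and> snd p = - f (fst p))}
      = {p. snd p = \<bar>f (fst p)\<bar>}" by auto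
  finally show ?thesis unfolding definable_map_def .
qed

lemma definable_fun_imp_definable_map:
  assumes "definable_fun S f"
  shows "definable_map f"
proof -
  obtain bs where bs: "basis_list bs" "{map (\<lambda>b. x \<bullet> b) bs @ [f x] | x. True} \<in> S (Suc (length bs))"
    using assms unfolding definable_fun_def basis_list_def by blast
  define cs :: "('a \<times> real) list" where "cs = map (\<lambda>a. (a, 0)) bs @ map (\<lambda>b. (0, b)) [1]"
  have coords_cs: "coords cs p = map (\<lambda>b. fst p \<bullet> b) bs @ [snd p]" for p
    unfolding cs_def coords_prod by (simp add: coords_def)
  have "coords cs ` {p. snd p = f (fst p)} = {map (\<lambda>b. x \<bullet> b) bs @ [f x] | x. True}"
    unfolding coords_cs by (auto simp: image_iff)
  moreover have "length cs = Suc (length bs)"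
    by (simp add: cs_def)
  ultimately have "coords cs ` {p. snd p = f (fst p)} \<in> S (length cs)"
    using bs(2) by metis
  moreover have "basis_list cs"
    unfolding cs_def by (rule basis_list_prod[OF bs(1)]) (simp add: basis_list_def)
  ultimately show ?thesis
    unfolding definable_map_def by (rule definableI[rotated])
qed

end

section \<open>One-sided germs and monotonicity of definable functions\<close>

context o_minimal_structure begin

text \<open>An interval either contains a right neighbourhood of \<open>a\<close> or misses one. For
  a finite union of intervals, either one of them contains such a neighbourhood or the finitely many
  missed ones have a common part.\<close>

lemma definable_germ_right:
  fixes a :: real
  assumes "definable {x. P x}"
  shows "(\<forall>\<^sub>F x in at_right a. P x) \<or> (\<forall>\<^sub>F x in at_right a. \<not> P x)"
proof -
  have *: "(\<forall>\<^sub>F x in at_right a. x \<in> I) \<or> (\<forall>\<^sub>F x in at_right a. x \<notin> I)" if I: "is_interval I" for I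
  proof (cases "\<forall>b>a. \<exists>x\<in>I. a < x \<and> x < b")
    case True
    then obtain c where c: "c \<in> I" "a < c" by (meson gt_ex)
    have "x \<in> I" if x: "a < x" "x < c" for x
    proof -
      obtain y where "y \<in> I" "a < y" "y < x" using True x by blast
      then show ?thesis using I c x unfolding is_interval_1 by (metis less_imp_le)
    qed
    then show ?thesis using c unfolding eventually_at_right_field by blast
  next
    case False
    then obtain b where "b > a" "\<And>x. a < x \<Longrightarrow> x < b \<Longrightarrow> x \<notin> I" by blast
    then show ?thesis unfolding eventually_at_right_field by blast
  qed
  obtain \<I> where \<I>: "finite \<I>" "\<And>I. I \<in> \<I> \<Longrightarrow> is_interval I" "{x. P x} = \<Union>\<I>"
    using assms unfolding definable_real_iff by blast
  have P: "P x \<longleftrightarrow> (\<exists>I\<in>\<I>. x \<in> I)" for x using \<I>(3) by blast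
  show ?thesis
  proof (cases "\<exists>I\<in>\<I>. \<forall>\<^sub>F x in at_right a. x \<in> I")
    case True
    then show ?thesis unfolding P by (auto elim: eventually_mono)
  next
    case False
    then have "\<forall>I\<in>\<I>. \<forall>\<^sub>F x in at_right a. x \<notin> I" using * \<I>(2) by blast
    then have "\<forall>\<^sub>F x in at_right a. \<forall>I\<in>\<I>. x \<notin> I"
      using \<I>(1) by (simp add: eventually_ball_finite)
    then show ?thesis unfolding P by (auto elim: eventually_mono)
  qed
qed

lemma definable_germ_left:
  fixes a :: real
  assumes "definable {x. P x}"
  shows "(\<forall>\<^sub>F x in at_left a. P x) \<or> (\<forall>\<^sub>F x in at_left a. \<not> P x)"
proof -
  have "definable {x::real. - x \<in> {x. P x}}"
    using definable_map_minus[OF definable_map_Basis[of "1::real"]]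
    by (intro definable_vimage assms) simp
  then show ?thesis
    using definable_germ_right[of "\<lambda>x. P (- x)" "- a"]
    by (simp add: at_left_minus[of a] eventually_filtermap)
qed

lemma definable_trichotomy_right:
  fixes f :: "real \<Rightarrow> real"
  assumes "definable_map f"
  shows "(\<forall>\<^sub>F y in at_right x. f x < f y) \<or> (\<forall>\<^sub>F y in at_right x. f y < f x) \<or>
    (\<forall>\<^sub>F y in at_right x. f y = f x)"
proof -
  have "definable {y. f x < f y}" "definable {y. f y < f x}"
    by (intro definable_less assms definable_map_const)+
  from this[THEN definable_germ_right, of x] show ?thesis
    using eventually_elim2[of "\<lambda>y. \<not> f x < f y" "at_right x" "\<lambda>y. \<not> f y < f x" "\<lambda>y. f y = f x"]
    by fastforce
qed

lemma definable_trichotomy_left: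
  fixes f :: "real \<Rightarrow> real"
  assumes "definable_map f"
  shows "(\<forall>\<^sub>F y in at_left x. f x < f y) \<or> (\<forall>\<^sub>F y in at_left x. f y < f x) \<or>
    (\<forall>\<^sub>F y in at_left x. f y = f x)"
proof -
  have "definable {y. f x < f y}" "definable {y. f y < f x}"
    by (intro definable_less assms definable_map_const)+
  from this[THEN definable_germ_left, of x] show ?thesis
    using eventually_elim2[of "\<lambda>y. \<not> f x < f y" "at_left x" "\<lambda>y. \<not> f y < f x" "\<lambda>y. f y = f x"]
    by fastforce
qed

text \<open>The filter unfolds to quantifiers over reals: some \<open>b > x\<close> such that
  \<open>P x y\<close> holds for all \<open>y\<close> strictly between. Hence the type of germ of a
  definable function is a definable property of the base point.\<close>

lemma definable_eventually_right:
  fixes P :: "real \<Rightarrow> real \<Rightarrow> bool"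
  assumes "definable {p. P (fst p) (snd p)}"
  shows "definable {x. \<forall>\<^sub>F y in at_right x. P x y}"
proof -
  have 1: "definable_map (\<lambda>x::real. x)"
    using definable_map_Basis[of "1::real"] by simp
  note 2 = definable_map_fst[OF 1] definable_map_snd[OF 1]
  note 3 = definable_map_fst[OF 2(1)] definable_map_fst[OF 2(2)] definable_map_snd[OF 1]
  have "definable {p::(real \<times> real) \<times> real. (fst (fst p), snd p) \<in> {p. P (fst p) (snd p)}}"
    by (intro definable_vimage[OF assms] definable_map_Pair definable_map_real 3)
  then have "definable {p::(real \<times> real) \<times> real. P (fst (fst p)) (snd p)}" by simp
  then have "definable {x. \<exists>b. x < b \<and> (\<forall>y. x < y \<and> y < b \<longrightarrow> P x y)}"
    by (intro definable_ex definable_conj definable_all definable_imp definable_less 2 3)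
  then show ?thesis unfolding eventually_at_right_field by (simp add: imp_conjL)
qed

lemma definable_eventually_left:
  fixes P :: "real \<Rightarrow> real \<Rightarrow> bool"
  assumes "definable {p. P (fst p) (snd p)}"
  shows "definable {x. \<forall>\<^sub>F y in at_left x. P x y}"
proof -
  have 1: "definable_map (\<lambda>x::real. x)"
    using definable_map_Basis[of "1::real"] by simp
  note 2 = definable_map_fst[OF 1] definable_map_snd[OF 1]
  note 3 = definable_map_fst[OF 2(1)] definable_map_fst[OF 2(2)] definable_map_snd[OF 1]
  have "definable {p::(real \<times> real) \<times> real. (fst (fst p), snd p) \<in> {p. P (fst p) (snd p)}}"
    by (intro definable_vimage[OF assms] definable_map_Pair definable_map_real 3)
  then have "definable {p::(real \<times> real) \<times> real. P (fst (fst p)) (snd p)}" by simp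
  then have "definable {x. \<exists>b. b < x \<and> (\<forall>y. b < y \<and> y < x \<longrightarrow> P x y)}"
    by (intro definable_ex definable_conj definable_all definable_imp definable_less 2 3)
  then show ?thesis unfolding eventually_at_left_field by (simp add: imp_conjL)
qed

end

lemma countable_strict_local_minima:
  fixes f :: "real \<Rightarrow> 'a::linorder"
  shows "countable {x. (\<forall>\<^sub>F y in at x. f x < f y)}"
proof -
  let ?M = "{x. \<forall>\<^sub>F y in at x. f x < f y}"
  \<comment> \<open>A strict local minimum is determined by a rational interval on which it is the strict minimum.\<close>
  have "\<exists>r. r \<in> \<rat> \<times> \<rat> \<and> fst r < x \<and> x < snd r \<and>
      (\<forall>y. fst r < y \<and> y < snd r \<and> y \<noteq> x \<longrightarrow> f x < f y)" if x: "x \<in> ?M" for x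
  proof -
    obtain d where d: "d > 0" "\<And>y. y \<noteq> x \<Longrightarrow> dist y x < d \<Longrightarrow> f x < f y"
      using x unfolding mem_Collect_eq eventually_at by (metis UNIV_I)
    obtain p where p: "p \<in> \<rat>" "x - d < p" "p < x" using Rats_dense_in_real[of "x - d" x] d by auto
    obtain q where q: "q \<in> \<rat>" "x < q" "q < x + d" using Rats_dense_in_real[of x "x + d"] d by auto
    have "f x < f y" if "p < y" "y < q" "y \<noteq> x" for y
      using that p q d(2)[of y] by (simp add: dist_real_def abs_less_iff)
    then show ?thesis using p q by (intro exI[of _ "(p, q)"]) auto
  qed
  then have "\<forall>x\<in>?M. \<exists>r. r \<in> \<rat> \<times> \<rat> \<and> fst r < x \<and> x < snd r \<and>
      (\<forall>y. fst r < y \<and> y < snd r \<and> y \<noteq> x \<longrightarrow> f x < f y)" by blast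
  from bchoice[OF this] obtain r where r: "\<forall>x\<in>?M. r x \<in> \<rat> \<times> \<rat> \<and> fst (r x) < x \<and> x < snd (r x) \<and>
      (\<forall>y. fst (r x) < y \<and> y < snd (r x) \<and> y \<noteq> x \<longrightarrow> f x < f y)" ..
  have "inj_on r ?M"
  proof (rule inj_onI, rule ccontr)
    fix x y assume xy: "x \<in> ?M" "y \<in> ?M" "r x = r y" "x \<noteq> y"
    have "f x < f y" using bspec[OF r xy(1)] bspec[OF r xy(2)] xy(3,4) by metis
    moreover have "f y < f x" using bspec[OF r xy(1)] bspec[OF r xy(2)] xy(3,4) by metis
    ultimately show False by simp
  qed
  moreover have "countable (r ` ?M)"
    by (rule countable_subset[of _ "\<rat> \<times> \<rat>"]) (use r in \<open>auto simp: countable_rat\<close>)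
  ultimately show ?thesis
    by (rule countable_image_inj_on[rotated])
qed

text \<open>Supremum argument for functions that may jump. Let \<open>s\<close> be the supremum of
  the points up to which \<open>f\<close> stays above \<open>f x\<close>: the left germ at
  \<open>s\<close> carries the bound to \<open>s\<close> itself, and the right germ carries it
  beyond \<open>s\<close> unless \<open>s = y\<close>.\<close>

lemma locally_increasing_imp_le:
  fixes f :: "real \<Rightarrow> 'a::linorder"
  assumes right: "\<And>x. x \<in> {a<..<b} \<Longrightarrow> \<forall>\<^sub>F y in at_right x. f x \<le> f y"
    and left: "\<And>x. x \<in> {a<..<b} \<Longrightarrow> \<forall>\<^sub>F y in at_left x. f y \<le> f x"
    and xy: "a < x" "x \<le> y" "y < b"
  shows "f x \<le> f y"
proof -
  define Z where "Z = {z. x \<le> z \<and> z \<le> y \<and> (\<forall>w. x \<le> w \<and> w \<le> z \<longrightarrow> f x \<le> f w)}"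
  have "f x \<le> f w" if "x \<le> w \<and> w \<le> x" for w
    using that by (metis order.eq_iff)
  then have Z: "x \<in> Z" using xy unfolding Z_def by blast
  have bdd: "bdd_above Z" by (rule bdd_aboveI[of _ y]) (simp add: Z_def)
  define s where "s = Sup Z"
  have s: "x \<le> s" "s \<le> y"
    using Z cSup_upper[OF Z bdd] cSup_least[of Z y] unfolding s_def Z_def by blast+
  have below: "f x \<le> f w" if w: "x \<le> w" "w < s" for w
  proof -
    obtain z where "z \<in> Z" "w < z" using w Z less_cSup_iff[OF _ bdd, of w] unfolding s_def by blast
    then show ?thesis using w unfolding Z_def by (metis (mono_tags, lifting) less_imp_le mem_Collect_eq)
  qed
  have fs: "f x \<le> f s"
  proof (cases "s = x")
    case False
    obtain c where c: "c < s" "\<And>y. c < y \<Longrightarrow> y < s \<Longrightarrow> f y \<le> f s"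
      using left[of s] s xy False unfolding eventually_at_left_field by fastforce
    obtain w where w: "max c x < w" "w < s" using dense[of "max c x" s] c s False by auto
    then show ?thesis using c(2)[of w] below[of w] by auto
  qed simp
  have "s = y"
  proof (rule ccontr)
    assume "s \<noteq> y"
    obtain c where c: "c > s" "\<And>y. s < y \<Longrightarrow> y < c \<Longrightarrow> f s \<le> f y"
      using right[of s] s xy \<open>s \<noteq> y\<close> unfolding eventually_at_right_field by fastforce
    obtain w where w: "s < w" "w < min c y" using dense[of s "min c y"] c s \<open>s \<noteq> y\<close> by auto
    have "f x \<le> f v" if "x \<le> v" "v \<le> w" for v
      using that below[of v] fs c(2)[of v] w by (cases v s rule: linorder_cases) auto
    then have "w \<in> Z" using w s unfolding Z_def by simp
    then have "w \<le> s" using bdd cSup_upper unfolding s_def by blast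
    then show False using w by simp
  qed
  then show ?thesis using fs by simp
qed

context o_minimal_structure begin

lemma definable_germ_right_cases:
  fixes a :: real
  assumes "definable {x. P x}" "definable {x. Q x}" "definable {x. R x}"
    and cases: "\<And>x. P x \<or> Q x \<or> R x"
  shows "eventually P (at_right a) \<or> eventually Q (at_right a) \<or> eventually R (at_right a)"
proof (rule ccontr)
  assume *: "\<not> ?thesis"
  then have "\<forall>\<^sub>F x in at_right a. \<not> P x" "\<forall>\<^sub>F x in at_right a. \<not> Q x" "\<forall>\<^sub>F x in at_right a. \<not> R x"
    using assms(1-3)[THEN definable_germ_right, of a] by simp_all
  then have "\<forall>\<^sub>F x in at_right a. False"
    by eventually_elim (use cases in blast)
  then show False by simp
qed

text \<open>Near \<open>a\<close> the germ of \<open>f\<close> has one fixed type on each side of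
  every point, which leaves nine combinations. Two of them make every point a strict local extremum;
  the other seven are weakly increasing or weakly decreasing on both sides, and local monotonicity
  becomes monotonicity on an interval.\<close>

theorem definable_eventually_mono_or_antimono:
  fixes f :: "real \<Rightarrow> real"
  assumes f: "definable_map f"
  shows "\<exists>b>a. mono_on {a<..<b} f \<or> antimono_on {a<..<b} f"
proof -
  let ?Rg = "\<lambda>x. \<forall>\<^sub>F y in at_right x. f x < f y" and ?Rl = "\<lambda>x. \<forall>\<^sub>F y in at_right x. f y < f x"
    and ?Re = "\<lambda>x. \<forall>\<^sub>F y in at_right x. f y = f x"
  let ?Lg = "\<lambda>x. \<forall>\<^sub>F y in at_left x. f x < f y" and ?Ll = "\<lambda>x. \<forall>\<^sub>F y in at_left x. f y < f x"
    and ?Le = "\<lambda>x. \<forall>\<^sub>F y in at_left x. f y = f x"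
  let ?EV = "\<lambda>P. \<forall>\<^sub>F x in at_right a. P x"
  have f2: "definable_map (\<lambda>p::real \<times> real. f (fst p))" "definable_map (\<lambda>p::real \<times> real. f (snd p))"
    using f definable_map_fst definable_map_snd by blast+
  have "definable {x. ?Rg x}" "definable {x. ?Rl x}" "definable {x. ?Re x}"
    "definable {x. ?Lg x}" "definable {x. ?Ll x}" "definable {x. ?Le x}"
    by (intro definable_eventually_right definable_eventually_left definable_less definable_equal f2)+
  note def = this
  have R: "?EV ?Rg \<or> ?EV ?Rl \<or> ?EV ?Re"
    by (rule definable_germ_right_cases[OF def(1-3)]) (rule definable_trichotomy_right[OF f])
  have L: "?EV ?Lg \<or> ?EV ?Ll \<or> ?EV ?Le"
    by (rule definable_germ_right_cases[OF def(4-6)]) (rule definable_trichotomy_left[OF f])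
  \<comment> \<open>Uncountability of the interval excludes the two types of germ that a monotone function cannot have.\<close>
  have strict: "\<not> ?EV (\<lambda>x. \<forall>\<^sub>F y in at x. g x < g y)" for g :: "real \<Rightarrow> real"
  proof
    assume "?EV (\<lambda>x. \<forall>\<^sub>F y in at x. g x < g y)"
    then obtain b where b: "b > a" "\<forall>x>a. x < b \<longrightarrow> (\<forall>\<^sub>F y in at x. g x < g y)"
      unfolding eventually_at_right_field by blast
    then have "{a<..<b} \<subseteq> {x. \<forall>\<^sub>F y in at x. g x < g y}" by auto
    then have "countable {a<..<b}"
      using countable_strict_local_minima by (rule countable_subset)
    then show False using uncountable_open_interval[of a b] b(1) by blast
  qed
  have "\<not> (?EV ?Rg \<and> ?EV ?Lg)"
    using strict[of f] by (auto simp: eventually_at_split eventually_conj_iff)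
  moreover have "\<not> (?EV ?Rl \<and> ?EV ?Ll)"
    using strict[of "\<lambda>x. - f x"] by (auto simp: eventually_at_split eventually_conj_iff)
  moreover have "?EV (\<lambda>x. \<forall>\<^sub>F y in at_right x. f x \<le> f y)" if "?EV ?Rg \<or> ?EV ?Re"
    using that by (auto elim!: eventually_mono)
  moreover have "?EV (\<lambda>x. \<forall>\<^sub>F y in at_right x. f y \<le> f x)" if "?EV ?Rl \<or> ?EV ?Re"
    using that by (auto elim!: eventually_mono)
  moreover have "?EV (\<lambda>x. \<forall>\<^sub>F y in at_left x. f x \<le> f y)" if "?EV ?Lg \<or> ?EV ?Le"
    using that by (auto elim!: eventually_mono)
  moreover have "?EV (\<lambda>x. \<forall>\<^sub>F y in at_left x. f y \<le> f x)" if "?EV ?Ll \<or> ?EV ?Le"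
    using that by (auto elim!: eventually_mono)
  ultimately consider
      "?EV (\<lambda>x. \<forall>\<^sub>F y in at_right x. f x \<le> f y)" "?EV (\<lambda>x. \<forall>\<^sub>F y in at_left x. f y \<le> f x)"
    | "?EV (\<lambda>x. \<forall>\<^sub>F y in at_right x. f y \<le> f x)" "?EV (\<lambda>x. \<forall>\<^sub>F y in at_left x. f x \<le> f y)"
    using R L by argo
  then show ?thesis
  proof cases
    case 1
    from eventually_conj[OF this] obtain b where b: "b > a" "\<And>x. x \<in> {a<..<b} \<Longrightarrow>
        (\<forall>\<^sub>F y in at_right x. f x \<le> f y) \<and> (\<forall>\<^sub>F y in at_left x. f y \<le> f x)"
      unfolding eventually_at_right_field[of _ a] greaterThanLessThan_iff by blast
    then have "mono_on {a<..<b} f"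
      by (intro mono_onI locally_increasing_imp_le[of a b f]) auto
    then show ?thesis using b by blast
  next
    case 2
    from eventually_conj[OF this] obtain b where b: "b > a" "\<And>x. x \<in> {a<..<b} \<Longrightarrow>
        (\<forall>\<^sub>F y in at_right x. f y \<le> f x) \<and> (\<forall>\<^sub>F y in at_left x. f x \<le> f y)"
      unfolding eventually_at_right_field[of _ a] greaterThanLessThan_iff by blast
    have "- f x \<le> - f y" if "a < x" "x \<le> y" "y < b" for x y
      by (rule locally_increasing_imp_le[of a b "\<lambda>x. - f x"]) (use b that in auto)
    then have "antimono_on {a<..<b} f"
      by (intro monotone_onI) auto
    then show ?thesis using b by blast
  qed
qed

end

section \<open>Definable choice and summable variation\<close>

context o_minimal_structure begin

lemma definable_map_norm:
  fixes h :: "'a::euclidean_space \<Rightarrow> 'b::euclidean_space"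
  assumes "\<And>b. b \<in> Basis \<Longrightarrow> definable_map (\<lambda>x. h x \<bullet> b)"
  shows "definable_map (\<lambda>x. norm (h x))"
proof -
  have r: "definable_map (\<lambda>p::'a \<times> real. snd p)"
    using definable_map_snd[OF definable_map_Basis, of "1::real"] by simp
  have "definable {p. 0 \<le> snd p \<and> snd p * snd p = (\<Sum>b\<in>Basis. (h (fst p) \<bullet> b) * (h (fst p) \<bullet> b))}"
    by (intro definable_conj definable_le definable_equal definable_map_const definable_map_mult
        definable_map_sum r definable_map_fst[OF assms])
  also have "{p. 0 \<le> snd p \<and> snd p * snd p = (\<Sum>b\<in>Basis. (h (fst p) \<bullet> b) * (h (fst p) \<bullet> b))}
      = {p. snd p = norm (h (fst p))}"
  proof (intro Collect_cong)
    fix p :: "'a \<times> real"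
    have "(\<Sum>b\<in>Basis. (h (fst p) \<bullet> b) * (h (fst p) \<bullet> b)) = (norm (h (fst p)))\<^sup>2"
      by (simp only: euclidean_inner[symmetric] power2_norm_eq_inner)
    then show "0 \<le> snd p \<and> snd p * snd p = (\<Sum>b\<in>Basis. (h (fst p) \<bullet> b) * (h (fst p) \<bullet> b))
        \<longleftrightarrow> snd p = norm (h (fst p))"
      unfolding power2_eq_square[symmetric] by (auto simp: power2_eq_iff_nonneg)
  qed
  finally show ?thesis unfolding definable_map_def .
qed

text \<open>Lexicographic minimisation with the keys \<open>bs\<close>, described by its properties
  instead of by recursion. Agreement on every key makes the fibres of \<open>Q\<close> at most
  single points once the keys exhaust a basis; minimality is recorded for the first key, the one
  that is to carry the slope.\<close>

definition lex_refinement ::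
    "'b::euclidean_space list \<Rightarrow> (real \<Rightarrow> 'b \<Rightarrow> bool) \<Rightarrow> (real \<Rightarrow> 'b \<Rightarrow> bool) \<Rightarrow> bool" where
  "lex_refinement bs P Q \<longleftrightarrow> definable {p. Q (fst p) (snd p)} \<and>
    (\<forall>r y. Q r y \<longrightarrow> P r y) \<and> (\<forall>r y. P r y \<longrightarrow> (\<exists>z. Q r z)) \<and>
    (\<forall>b\<in>set bs. \<forall>r y z. Q r y \<longrightarrow> Q r z \<longrightarrow> y \<bullet> b = z \<bullet> b) \<and>
    (bs \<noteq> [] \<longrightarrow> (\<forall>r y z. Q r y \<longrightarrow> P r z \<longrightarrow> y \<bullet> hd bs \<le> z \<bullet> hd bs))"

text \<open>One key at a time: the minimisers of a coordinate over a nonempty compact fibre exist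
  and form a compact set again, so the induction continues with them. Minimality is a quantified
  inequality, hence definable.\<close>

lemma definable_lex_refinement:
  fixes P :: "real \<Rightarrow> 'b::euclidean_space \<Rightarrow> bool"
  assumes "definable {p. P (fst p) (snd p)}" "\<And>r. compact {y. P r y}" "set bs \<subseteq> Basis"
  shows "\<exists>Q. lex_refinement bs P Q"
  using assms
proof (induction bs arbitrary: P)
  case Nil
  then show ?case by (intro exI[of _ P]) (auto simp: lex_refinement_def)
next
  case (Cons b bs)
  have b: "b \<in> Basis" using Cons.prems(3) by simp
  define P' where "P' = (\<lambda>r y. P r y \<and> (\<forall>z. P r z \<longrightarrow> y \<bullet> b \<le> z \<bullet> b))"
  have P: "definable {p::(real \<times> 'b) \<times> 'b. P (fst (fst p)) (snd p)}"
  proof -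
    have "definable {p::(real \<times> 'b) \<times> 'b. (fst (fst p), snd p) \<in> {p. P (fst p) (snd p)}}"
      by (intro definable_vimage[OF Cons.prems(1)] definable_map_Pair
          definable_map_fst[OF definable_map_fst[OF definable_map_Basis]]
          definable_map_snd[OF definable_map_Basis])
    then show ?thesis by simp
  qed
  have 1: "definable {p. P' (fst p) (snd p)}"
    unfolding P'_def
    by (intro definable_conj Cons.prems(1) definable_all definable_imp P definable_le
        definable_map_fst[OF definable_map_snd[OF definable_map_Basis]]
        definable_map_snd[OF definable_map_Basis] b)
  have 2: "compact {y. P' r y}" for r
  proof -
    have "{y. P' r y} = {y. P r y} \<inter> (\<Inter>z\<in>{z. P r z}. {y. y \<bullet> b \<le> z \<bullet> b})"
      by (auto simp: P'_def)
    moreover have "closed (\<Inter>z\<in>{z. P r z}. {y. y \<bullet> b \<le> z \<bullet> b})"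
      by (intro closed_INT ballI closed_Collect_le continuous_intros)
    ultimately show ?thesis using Cons.prems(2) by (metis compact_Int_closed)
  qed
  have ne: "\<exists>z. P' r z" if "P r y" for r y
  proof -
    have "continuous_on {y. P r y} (\<lambda>y. y \<bullet> b)" by (intro continuous_intros)
    then show ?thesis
      using continuous_attains_inf[of "{y. P r y}" "\<lambda>y. y \<bullet> b"] Cons.prems(2) that
      unfolding P'_def by blast
  qed
  obtain Q where "lex_refinement bs P' Q"
    using Cons.IH[of P', OF 1 2] Cons.prems(3) by auto
  then have Q: "definable {p. Q (fst p) (snd p)}"
    "\<And>r y. Q r y \<Longrightarrow> P' r y" "\<And>r y. P' r y \<Longrightarrow> \<exists>z. Q r z"
    "\<And>c r y z. c \<in> set bs \<Longrightarrow> Q r y \<Longrightarrow> Q r z \<Longrightarrow> y \<bullet> c = z \<bullet> c"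
    unfolding lex_refinement_def by blast+
  have b_eq: "y \<bullet> b = z \<bullet> b" if "Q r y" "Q r z" for r y z
    using that Q(2) unfolding P'_def by (meson order_antisym)
  have "lex_refinement (b # bs) P Q"
    unfolding lex_refinement_def
  proof (intro conjI allI impI ballI)
    show "Q r y \<Longrightarrow> P r y" for r y using Q(2) unfolding P'_def by blast
    show "P r y \<Longrightarrow> \<exists>z. Q r z" for r y using Q(3) ne by blast
    show "c \<in> set (b # bs) \<Longrightarrow> Q r y \<Longrightarrow> Q r z \<Longrightarrow> y \<bullet> c = z \<bullet> c" for c r y z
      using b_eq[of r y z] Q(4)[of c r y z] by auto
    show "Q r y \<Longrightarrow> P r z \<Longrightarrow> y \<bullet> hd (b # bs) \<le> z \<bullet> hd (b # bs)" for r y z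
      using Q(2) unfolding P'_def by simp
  qed (rule Q(1))
  then show ?case by (rule exI[of _ Q])
qed

lemma definable_selection:
  fixes P :: "real \<Rightarrow> 'b::euclidean_space \<Rightarrow> bool"
  assumes P: "definable {p. P (fst p) (snd p)}" "\<And>r. compact {y. P r y}" and b0: "b0 \<in> Basis"
  obtains h where "\<And>b. b \<in> Basis \<Longrightarrow> definable_map (\<lambda>r. h r \<bullet> b)"
    "\<And>r y. P r y \<Longrightarrow> P r (h r) \<and> h r \<bullet> b0 \<le> y \<bullet> b0"
proof -
  obtain bs where bs: "basis_list (bs :: 'b list)" using basis_list_exists by blast
  \<comment> \<open>\<open>b0\<close> occurs a second time inside \<open>bs\<close>. The repetition
    is harmless and makes \<open>b0\<close> the first key.\<close>
  have "set (b0 # bs) \<subseteq> Basis" using bs b0 unfolding basis_list_def by simp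
  then obtain Q where lex: "lex_refinement (b0 # bs) P Q"
    using definable_lex_refinement[OF P] by blast
  note c1 = lex[unfolded lex_refinement_def]
  note c2 = conjunct2[OF c1] note c3 = conjunct2[OF c2] note c4 = conjunct2[OF c3]
  note Q = conjunct1[OF c1] conjunct1[OF c2, rule_format] conjunct1[OF c3, rule_format]
    conjunct1[OF c4, rule_format] conjunct2[OF c4, rule_format]
  have uniq: "y = z" if "Q r y" "Q r z" for r y z
    by (rule euclidean_eqI, rule Q(4)[OF _ that]) (use bs in \<open>simp add: basis_list_def\<close>)
  \<comment> \<open>The value 0 over an empty fibre keeps \<open>h\<close> total, and its graph is
    still a definable disjunction.\<close>
  define h where "h r = (if \<exists>y. Q r y then THE y. Q r y else 0)" for r
  have h: "h r = y" if "Q r y" for r y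
  proof -
    have "(THE y. Q r y) = y" using that uniq by (intro the_equality) blast+
    then show ?thesis using that unfolding h_def by auto
  qed
  have h0: "h r = 0" if "\<not> (\<exists>y. Q r y)" for r
    unfolding h_def by (rule if_not_P[OF that])
  have Q1: "definable {p::(real \<times> real) \<times> 'b. Q (fst (fst p)) (snd p)}"
  proof -
    have "definable {p::(real \<times> real) \<times> 'b. (fst (fst p), snd p) \<in> {p. Q (fst p) (snd p)}}"
      by (intro definable_vimage[OF Q(1)] definable_map_Pair
          definable_map_fst[OF definable_map_fst[OF definable_map_Basis]]
          definable_map_snd[OF definable_map_Basis])
    then show ?thesis by simp
  qed
  have "definable_map (\<lambda>r. h r \<bullet> b)" if b: "b \<in> Basis" for b
  proof -
    have r: "definable_map (\<lambda>p::real \<times> real. snd p)"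
      using definable_map_snd[OF definable_map_Basis, of "1::real"] by simp
    have "definable {p. (\<exists>y. Q (fst p) y \<and> snd p = y \<bullet> b) \<or> (\<not> (\<exists>y. Q (fst p) y) \<and> snd p = 0)}"
      by (intro definable_disj definable_ex definable_conj definable_not Q1 definable_equal
          definable_map_fst[OF r] definable_map_snd[OF definable_map_Basis] r definable_map_const b)
    also have "{p. (\<exists>y. Q (fst p) y \<and> snd p = y \<bullet> b) \<or> (\<not> (\<exists>y. Q (fst p) y) \<and> snd p = 0)}
        = {p. snd p = h (fst p) \<bullet> b}"
      using h h0 by (intro Collect_cong) (metis inner_zero_left)
    finally show ?thesis unfolding definable_map_def .
  qed
  moreover have "P r (h r) \<and> h r \<bullet> b0 \<le> y \<bullet> b0" if y: "P r y" for r y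
  proof -
    obtain z where z: "Q r z" using Q(3)[OF y] by blast
    then show ?thesis using Q(2)[OF z] Q(5)[OF _ z y] h[OF z] by simp
  qed
  ultimately show thesis using that by blast
qed

text \<open>The numbers \<open>r t\<close> eventually enter an interval to the right of
  \<open>l\<close> on which \<open>g\<close> is monotone; strictness in \<open>l < r t\<close> keeps
  them inside. Then \<open>g (r t)\<close> is eventually monotone and bounded, and its increments
  telescope with a constant sign.\<close>

lemma definable_bounded_variation:
  fixes g :: "real \<Rightarrow> real"
  assumes g: "definable_map g" and bd: "\<And>t. \<bar>g (r t)\<bar> \<le> B"
    and r: "decseq r" "r \<longlonglongrightarrow> l" "\<And>t. l < r t"
  shows "summable (\<lambda>t. \<bar>g (r (Suc t)) - g (r t)\<bar>)"
proof -
  obtain c where c: "c > l" "mono_on {l<..<c} g \<or> antimono_on {l<..<c} g"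
    using definable_eventually_mono_or_antimono[OF g] by blast
  obtain T where T: "\<And>t. t \<ge> T \<Longrightarrow> r t < c"
    using order_tendstoD(2)[OF r(2) c(1)] unfolding eventually_sequentially by blast
  define x where "x t = g (r (t + T))" for t
  have rt: "r (Suc t + T) \<le> r (t + T)" "r (t + T) \<in> {l<..<c}" for t
    using r T by (auto simp: decseq_def)
  have mono: "(\<forall>t. x t \<le> x (Suc t)) \<or> (\<forall>t. x (Suc t) \<le> x t)"
    using c(2)
  proof
    assume "mono_on {l<..<c} g"
    then have "x (Suc t) \<le> x t" for t
      unfolding x_def by (rule mono_onD) (rule rt)+
    then show ?thesis by blast
  next
    assume "antimono_on {l<..<c} g"
    then have "x t \<le> x (Suc t)" for t
      unfolding x_def by (rule monotone_onD) (rule rt)+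
    then show ?thesis by blast
  qed
  have "Bseq x" unfolding x_def using bd by (intro BseqI'[of _ B]) simp
  moreover have "monoseq x" using mono unfolding monoseq_Suc by blast
  ultimately obtain L where L: "x \<longlonglongrightarrow> L"
    using Bseq_monoseq_convergent convergent_def by blast
  have "summable (\<lambda>t. \<bar>x (Suc t) - x t\<bar>)"
    using mono
  proof
    assume "\<forall>t. x t \<le> x (Suc t)"
    then show ?thesis using telescope_summable[OF L] by simp
  next
    assume *: "\<forall>t. x (Suc t) \<le> x t"
    then have "\<bar>x (Suc t) - x t\<bar> = - (x (Suc t) - x t)" for t by (simp add: abs_of_nonpos)
    then show ?thesis using summable_minus[OF telescope_summable[OF L]] by simp
  qed
  then show ?thesis
    unfolding x_def using summable_iff_shift[of "\<lambda>t. \<bar>g (r (Suc t)) - g (r t)\<bar>" T] by simp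
qed

end

text \<open>Summing the recursion puts half of the partial sum of \<open>u\<close> on the right,
  where it is absorbed: the partial sums stay below \<open>2 * (u 0 + suminf l)\<close>.\<close>

lemma summable_contraction:
  fixes u l :: "nat \<Rightarrow> real"
  assumes "\<And>t. 0 \<le> u t" "\<And>t. 0 \<le> l t" "\<And>t. u (Suc t) \<le> u t / 2 + l t" "summable l"
  shows "summable u"
proof -
  have "(\<Sum>t<Suc n. u t) \<le> u 0 + (\<Sum>t<n. u t) / 2 + (\<Sum>t<n. l t)" for n
  proof -
    have "(\<Sum>t<n. u (Suc t)) \<le> (\<Sum>t<n. u t / 2 + l t)"
      by (intro sum_mono assms(3))
    then show ?thesis
      by (simp only: sum.lessThan_Suc_shift sum.distrib sum_divide_distrib)
  qed
  note 1 = this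
  have 2: "(\<Sum>t<n. l t) \<le> suminf l" for n
    using assms by (intro sum_le_suminf) auto
  have "(\<Sum>t<n. u t) \<le> 2 * (u 0 + suminf l)" for n
  proof -
    have "(\<Sum>t<n. u t) \<le> (\<Sum>t<Suc n. u t)" using assms(1)[of n] by simp
    also have "\<dots> \<le> u 0 + (\<Sum>t<n. u t) / 2 + suminf l"
      using 1[of n] 2[of n] by linarith
    finally show ?thesis by (simp add: field_simps)
  qed
  then show ?thesis
    using assms(1) by (intro bounded_imp_summable[of _ "2 * (u 0 + suminf l)"])
      (simp_all only: lessThan_Suc_atMost[symmetric])
qed

section \<open>Finite length of definable descent sequences\<close>

context o_minimal_structure begin

text \<open>The hypothesis \<open>slope\<close> is a subgradient inequality in which only a bound on
  the norm of the subgradient is kept. It thus speaks about \<open>f\<close> and \<open>K\<close>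
  alone, and the family of all points with a given slope inherits their definability.\<close>

theorem definable_descent_finite_length:
  fixes f :: "'a::euclidean_space \<Rightarrow> real" and z :: "nat \<Rightarrow> 'a"
  assumes K: "compact K" "definable K" and f: "continuous_on K f" "definable_map f"
    and z: "\<And>t. z t \<in> K" and abc: "0 < a" "0 \<le> b" "0 \<le> c"
    and descent: "\<And>t. f (z (Suc t)) \<le> f (z t) - a * (norm (z (Suc t) - z t))\<^sup>2"
    and slope: "\<And>t y. y \<in> K \<Longrightarrow> f (z (Suc t)) - b * norm (z (Suc t) - z t) * norm (y - z (Suc t))
        - c * (norm (y - z (Suc t)))\<^sup>2 \<le> f y"
  shows "summable (\<lambda>t. norm (z (Suc t) - z t))"
proof -
  define u where "u t = norm (z (Suc t) - z t)" for t
  define r where "r t = f (z (Suc t))" for t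
  have u: "0 \<le> u t" for t by (simp add: u_def)
  have r_step: "a * (u (Suc t))\<^sup>2 \<le> r t - r (Suc t)" for t
    using descent[of "Suc t"] by (simp add: u_def r_def)
  have "r (Suc t) \<le> r t" for t
    using r_step[of t] abc(1) by (smt (verit) mult_nonneg_nonneg zero_le_power2)
  then have "decseq r" by (rule decseq_SucI)
  have "compact (f ` K)" using K f by (intro compact_continuous_image)
  then have "bdd_below (f ` K)" by (intro bounded_imp_bdd_below compact_imp_bounded)
  then obtain m where "\<And>x. x \<in> K \<Longrightarrow> m \<le> f x" unfolding bdd_below_def by auto
  then have "m \<le> r t" for t by (simp add: r_def z)
  with \<open>decseq r\<close> obtain l where l: "r \<longlonglongrightarrow> l" "\<And>t. l \<le> r t"
    using decseq_convergent by blast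
  have "summable u"
  \<comment> \<open>Monotonicity is available only strictly above \<open>l\<close>. If the limit
    value is attained, sufficient decrease forces all later steps to vanish.\<close>
  proof (cases "\<exists>T. r T = l")
    case True
    then obtain T where T: "r T = l" ..
    have "u t = 0" if tT: "t > T" for t
    proof -
      obtain n where t: "t = Suc n" using tT gr0_conv_Suc[of t] by auto
      have "r n \<le> r T" using \<open>decseq r\<close> tT t unfolding decseq_def by simp
      then have "a * (u t)\<^sup>2 \<le> 0" using r_step[of n] l(2)[of t] T t by simp
      then show ?thesis using abc(1) by (simp add: mult_le_0_iff)
    qed
    then show ?thesis by (intro summable_finite[of "{..T}"]) auto
  next
    case False
    with l(2) have r_gt: "l < r t" for t by (metis order.not_eq_order_implies_strict)
    \<comment> \<open>Slopes are capped to make the fibres compact. The cap admits the slopes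
      \<open>b * u t\<close> of the iterates, since a step inside \<open>K\<close> is no longer than
      its diameter.\<close>
    define B where "B = b * diameter K"
    define P where "P \<rho> p \<longleftrightarrow> 0 \<le> fst p \<and> fst p \<le> B \<and> snd p \<in> K \<and> f (snd p) = \<rho> \<and>
      (\<forall>y. y \<in> K \<longrightarrow> f (snd p) - fst p * norm (y - snd p) - c * norm (y - snd p) * norm (y - snd p) \<le> f y)"
      for \<rho> :: real and p :: "real \<times> 'a"
    have P_z: "P (r t) (b * u t, z (Suc t))" for t
    proof -
      have "u t \<le> diameter K"
        using diameter_bounded_bound[OF compact_imp_bounded[OF K(1)] z z, of "Suc t" t]
        by (simp add: u_def dist_norm)
      then show ?thesis
        unfolding P_def B_def using slope[of _ t] z u[of t] abc
        by (auto simp: r_def u_def power2_eq_square mult.assoc intro!: mult_left_mono)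
    qed
    have comp: "compact {p. P \<rho> p}" for \<rho>
    proof -
      let ?T = "{0..B} \<times> K"
      have T: "compact ?T" using K by (intro compact_Times) auto
      then have clT: "closed ?T" by (rule compact_imp_closed)
      have cf: "continuous_on ?T (\<lambda>p. f (snd p))"
        by (intro continuous_on_compose2[OF f(1)] continuous_intros) auto
      have "{p. P \<rho> p} = ?T \<inter> ({p \<in> ?T. f (snd p) \<le> \<rho>} \<inter> {p \<in> ?T. \<rho> \<le> f (snd p)} \<inter>
          (\<Inter>y\<in>K. {p \<in> ?T. f (snd p) - fst p * norm (y - snd p) - c * norm (y - snd p) * norm (y - snd p) \<le> f y}))"
        using z by (auto simp: P_def)
      moreover have "closed ({p \<in> ?T. f (snd p) \<le> \<rho>} \<inter> {p \<in> ?T. \<rho> \<le> f (snd p)} \<inter>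
          (\<Inter>y\<in>K. {p \<in> ?T. f (snd p) - fst p * norm (y - snd p) - c * norm (y - snd p) * norm (y - snd p) \<le> f y}))"
        by (intro closed_Int closed_INT ballI continuous_on_closed_Collect_le[OF _ _ clT] 
            continuous_intros cf)
      ultimately show ?thesis using compact_Int_closed[OF T] by simp
    qed
    have def: "definable {q. P (fst q) (snd q)}"
    proof -
      have id: "definable_map (\<lambda>x::real. x)" using definable_map_Basis[of "1::real"] by simp
      note 1 = definable_map_fst[OF id] definable_map_snd[OF definable_map_fst[OF id]]
      note 2 = definable_map_snd[OF definable_map_snd[OF definable_map_Basis]]
      note 3 = definable_map_fst[OF 1(2)] definable_map_snd[OF definable_map_Basis]
        definable_map_fst[OF 2]
      have norm: "definable_map (\<lambda>p::(real \<times> real \<times> 'a) \<times> 'a. norm (snd p - snd (snd (fst p))))"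
        by (intro definable_map_norm) (simp add: inner_diff_left definable_map_diff 3)
      show ?thesis
        unfolding P_def
        by (intro definable_conj definable_le definable_equal definable_all definable_imp
            definable_map_diff definable_map_mult definable_map_const
            definable_map_compose[OF f(2)] definable_vimage[OF K(2)] norm 1 2 3)
    qed
    have b0: "(1::real, 0::'a) \<in> Basis" by (simp add: Basis_prod_def)
    \<comment> \<open>\<open>h \<rho>\<close> is a point of the level set of \<open>\<rho>\<close> where the slope is least, preceded by that slope.\<close>
    obtain h where h: "\<And>b. b \<in> Basis \<Longrightarrow> definable_map (\<lambda>\<rho>. h \<rho> \<bullet> b)"
      "\<And>\<rho> p. P \<rho> p \<Longrightarrow> P \<rho> (h \<rho>) \<and> h \<rho> \<bullet> (1, 0) \<le> p \<bullet> (1, 0)"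
      using definable_selection[OF def comp b0] by blast
    define x where "x t = snd (h (r t))" for t
    have x: "x t \<in> K" "f (x t) = r t" for t
      using h(2)[OF P_z[of t]] by (simp_all add: P_def x_def)
    \<comment> \<open>The iterate \<open>z (Suc t)\<close> lies in the same level set with slope
      \<open>b * u t\<close>, so the least slope in that level set is no larger.\<close>
    have x_slope: "r t - b * u t * norm (y - x t) - c * (norm (y - x t))\<^sup>2 \<le> f y" if "y \<in> K" for t y
    proof -
      have "fst (h (r t)) \<le> b * u t"
        using h(2)[OF P_z[of t]] by (simp add: inner_prod_def)
      then have "fst (h (r t)) * norm (y - x t) \<le> b * u t * norm (y - x t)"
        by (intro mult_right_mono) auto
      moreover have "f (x t) - fst (h (r t)) * norm (y - x t) - c * norm (y - x t) * norm (y - x t) \<le> f y"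
        using h(2)[OF P_z[of t]] that unfolding P_def x_def by blast
      ultimately show ?thesis using x(2)[of t] by (simp add: power2_eq_square)
    qed
    define v where "v t = norm (x (Suc t) - x t)" for t
    have "summable (\<lambda>t. \<bar>(x (Suc t) - x t) \<bullet> e\<bar>)" if e: "e \<in> Basis" for e
    proof -
      obtain M where M: "\<And>y. y \<in> K \<Longrightarrow> norm y \<le> M"
        using compact_imp_bounded[OF K(1)] unfolding bounded_iff by blast
      have "\<bar>h (r t) \<bullet> (0, e)\<bar> \<le> M" for t
        using order_trans[OF Basis_le_norm[OF e] M[OF x(1)]] by (simp add: inner_prod_def x_def)
      moreover have "(0, e) \<in> Basis" using e by (simp add: Basis_prod_def)
      ultimately have "summable (\<lambda>t. \<bar>h (r (Suc t)) \<bullet> (0, e) - h (r t) \<bullet> (0, e)\<bar>)"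
        using l r_gt \<open>decseq r\<close> by (intro definable_bounded_variation[OF h(1)])
      then show ?thesis by (simp add: inner_prod_def x_def inner_diff_left)
    qed
    then have "summable (\<lambda>t. \<Sum>e\<in>Basis. \<bar>(x (Suc t) - x t) \<bullet> e\<bar>)"
      by (rule summable_sum)
    then have "summable v"
      by (rule summable_comparison_test'[where N=0]) (simp add: v_def norm_le_l1)
    \<comment> \<open>Chosen with \<open>b / a \<le> M\<close> and
      \<open>c / a \<le> M\<^sup>2\<close>, the latter because \<open>c / a \<le> M\<close> and
      \<open>1 \<le> M\<close>. The bound on \<open>(u (Suc t))\<^sup>2\<close> then lies below the
      square of \<open>u t / 2 + M * v t\<close>, whose mixed term is exactly
      \<open>M * (u t * v t)\<close>.\<close>
    define M where "M = b / a + c / a + 1"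
    have "u (Suc t) \<le> u t / 2 + M * v t" for t
    proof -
      have v: "0 \<le> v t" by (simp add: v_def)
      \<comment> \<open>The slope inequality at \<open>x t\<close> is tested at
        \<open>x (Suc t)\<close>, where \<open>f\<close> has the value \<open>r (Suc t)\<close>;
        this bounds from above the decrease that dominates the next step.\<close>
      have "a * (u (Suc t))\<^sup>2 \<le> b * u t * v t + c * (v t)\<^sup>2"
        using r_step[of t] x_slope[OF x(1)[of "Suc t"], of t] x(2) by (simp add: v_def)
      then have "(u (Suc t))\<^sup>2 \<le> (b / a) * (u t * v t) + (c / a) * (v t)\<^sup>2"
        using abc(1) by (simp add: field_simps)
      also have "\<dots> \<le> M * (u t * v t) + M\<^sup>2 * (v t)\<^sup>2"
      proof (intro add_mono mult_right_mono)
        have "b / a \<ge> 0" "c / a \<ge> 0" using abc by simp_all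
        then show "b / a \<le> M" by (simp add: M_def)
        have "c / a \<le> M" "1 \<le> M" using \<open>b / a \<ge> 0\<close> \<open>c / a \<ge> 0\<close> by (simp_all add: M_def)
        then show "c / a \<le> M\<^sup>2" using mult_mono[of "c/a" M 1 M] by (simp add: power2_eq_square)
      qed (use u v in simp_all)
      also have "\<dots> \<le> (u t / 2 + M * v t)\<^sup>2"
        by (simp add: power2_eq_square field_simps)
      finally have "(u (Suc t))\<^sup>2 \<le> (u t / 2 + M * v t)\<^sup>2" .
      moreover have "0 \<le> u t / 2 + M * v t" using u[of t] v abc by (simp add: M_def)
      ultimately show ?thesis by (rule power2_le_imp_le)
    qed
    moreover have "summable (\<lambda>t. M * v t)" using \<open>summable v\<close> by (rule summable_mult)
    moreover have "0 \<le> M * v t" for t using abc by (simp add: M_def v_def)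
    ultimately show ?thesis using u by (intro summable_contraction[of u "\<lambda>t. M * v t"])
  qed
  then show ?thesis unfolding u_def[abs_def] .
qed

end

section \<open>The spectral step\<close>

abbreviation eigenspace :: "real^'n^'n \<Rightarrow> real \<Rightarrow> (real^'n) set" where
  "eigenspace L x \<equiv> {v. L *v v = x *\<^sub>R v}"

lemma subspace_eigenspace: "subspace (eigenspace L x)"
  by (auto simp: subspace_def matrix_vector_right_distrib matrix_vector_mult_scaleR scaleR_right_distrib)

lemma symmetric_inner:
  assumes "L \<in> sym_matrices"
  shows "(L *v x) \<bullet> y = x \<bullet> (L *v y)"
proof -
  have "L *v x = x v* L"
    using assms transpose_matrix_vector[of L x] by (simp add: sym_matrices_def)
  then show ?thesis by (simp add: dot_lmul_matrix)
qed

lemma symmetric_eigenvector_exists: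
  assumes L: "L \<in> sym_matrices" and V: "subspace V" "\<And>v. v \<in> V \<Longrightarrow> L *v v \<in> V" and "v0 \<in> V" "v0 \<noteq> 0"
  obtains x v where "v \<in> V" "norm v = 1" "L *v v = x *\<^sub>R v"
proof -
  \<comment> \<open>A maximiser of the quadratic form on the unit sphere of \<open>V\<close> is an eigenvector: moving it along
    the residual \<open>w\<close> would increase the form.\<close>
  let ?S = "sphere 0 1 \<inter> V"
  have "compact ?S" by (intro compact_Int_closed compact_sphere closed_subspace V)
  moreover have "v0 /\<^sub>R norm v0 \<in> ?S" using assms by (simp add: subspace_scale)
  moreover have "continuous_on ?S (\<lambda>v. v \<bullet> (L *v v))"
    by (intro continuous_intros linear_continuous_on matrix_vector_mul_bounded_linear)
  ultimately obtain v where v: "v \<in> ?S" and max: "\<And>w. w \<in> ?S \<Longrightarrow> w \<bullet> (L *v w) \<le> v \<bullet> (L *v v)"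
    using continuous_attains_sup[of ?S "\<lambda>v. v \<bullet> (L *v v)"] by blast
  define x where "x = v \<bullet> (L *v v)"
  have vv: "v \<bullet> v = 1" using v by (simp add: norm_eq_1)
  have quad: "y \<bullet> (L *v y) \<le> x * (y \<bullet> y)" if "y \<in> V" for y
  proof (cases "y = 0")
    case False
    have "(y /\<^sub>R norm y) \<bullet> (L *v (y /\<^sub>R norm y)) \<le> x"
      unfolding x_def using that False V by (intro max) (simp add: subspace_scale)
    then have "(y \<bullet> (L *v y)) / (norm y)\<^sup>2 \<le> x"
      by (simp add: matrix_vector_mult_scaleR power2_eq_square divide_inverse mult_ac)
    then show ?thesis using False by (simp add: divide_le_eq power2_norm_eq_inner)
  qed simp
  define w where "w = L *v v - x *\<^sub>R v"
  have w: "w \<in> V" using v V unfolding w_def by (intro subspace_diff subspace_scale) auto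
  have wv: "w \<bullet> v = 0" using vv inner_commute[of v "L *v v"] by (simp add: w_def inner_diff_left x_def)
  have Lw: "v \<bullet> (L *v w) = w \<bullet> w"
  proof -
    have "v \<bullet> (L *v w) = (w + x *\<^sub>R v) \<bullet> w"
      unfolding symmetric_inner[OF L, symmetric] by (simp add: w_def)
    then show ?thesis using wv inner_commute[of v w] by (simp only: inner_add_left inner_scaleR_left mult_zero_right add_0_right)
  qed
  have "w \<bullet> w \<le> 0"
  proof (rule ccontr)
    assume ww: "\<not> w \<bullet> w \<le> 0"
    \<comment> \<open>\<open>M\<close> exceeds the coefficient of the second-order term. With
      \<open>t = (w \<bullet> w) / M\<close> that term is at most \<open>w \<bullet> w\<close> after
      division by \<open>t\<close>, only half of the first-order term
      \<open>2 * (w \<bullet> w)\<close>.\<close>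
    define M where "M = \<bar>x * (w \<bullet> w) - w \<bullet> (L *v w)\<bar> + 1"
    define t where "t = (w \<bullet> w) / M"
    have M: "M > 0" "x * (w \<bullet> w) - w \<bullet> (L *v w) < M" by (auto simp: M_def)
    have t: "t > 0" using ww M unfolding t_def not_le by (intro divide_pos_pos)
    have "v + t *\<^sub>R w \<in> V" using v w V by (simp add: subspace_add subspace_scale)
    from quad[OF this] have "x + 2 * t * (w \<bullet> w) + t * t * (w \<bullet> (L *v w)) \<le> x * (1 + t * t * (w \<bullet> w))"
      using vv wv Lw symmetric_inner[OF L, of w v]
      by (simp add: inner_add_left inner_add_right matrix_vector_right_distrib matrix_vector_mult_scaleR
          x_def inner_commute algebra_simps)
    then have "t * (2 * (w \<bullet> w)) \<le> t * (t * (x * (w \<bullet> w) - w \<bullet> (L *v w)))"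
      by (simp add: algebra_simps)
    then have "2 * (w \<bullet> w) \<le> t * (x * (w \<bullet> w) - w \<bullet> (L *v w))"
      using t by (simp only: mult_le_cancel_left_pos)
    also have "\<dots> \<le> t * M" using t M by (intro mult_left_mono) auto
    also have "\<dots> = w \<bullet> w" using M by (simp add: t_def)
    finally show False using ww by simp
  qed
  then have "w = 0" using inner_gt_zero_iff[of w] by linarith
  then show thesis using that[of v x] v by (simp add: w_def)
qed

lemma eigenspaces_orthogonal:
  assumes "L \<in> sym_matrices" "v \<in> eigenspace L x" "w \<in> eigenspace L y" "x \<noteq> y"
  shows "v \<bullet> w = 0"
  using symmetric_inner[OF assms(1), of v w] assms by simp

lemma orthonormal_imp_independent:
  assumes "pairwise orthogonal B" "\<And>b. b \<in> B \<Longrightarrow> norm b = 1"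
  shows "independent B"
  using assms by (intro pairwise_orthogonal_independent) force+

text \<open>Orthonormal bases of all eigenspaces are united. If they did not span, symmetry would
  make their orthogonal complement invariant and nonzero, so it would contain an eigenvector
  orthogonal to its own eigenspace. The last conclusion is what identifies geometric multiplicities
  with counts in \<open>B\<close>.\<close>

lemma eigenbasis_exists:
  fixes L :: "real^'n^'n"
  assumes L: "L \<in> sym_matrices"
  obtains B where "pairwise orthogonal B" "\<And>b. b \<in> B \<Longrightarrow> norm b = 1" "finite B" "card B = CARD('n)"
    "\<And>b. b \<in> B \<Longrightarrow> \<exists>x. b \<in> eigenspace L x"
    "\<And>x. card (B \<inter> eigenspace L x) = dim (eigenspace L x)"
proof -
  have "\<exists>B. B \<subseteq> eigenspace L x \<and> pairwise orthogonal B \<and> (\<forall>b\<in>B. norm b = 1) \<and>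
      card B = dim (eigenspace L x) \<and> span B = eigenspace L x" for x
    by (rule orthonormal_basis_subspace[OF subspace_eigenspace[of L x]]) blast
  then obtain E where E: "\<And>x. E x \<subseteq> eigenspace L x" "\<And>x. pairwise orthogonal (E x)"
    "\<And>x b. b \<in> E x \<Longrightarrow> norm b = 1" "\<And>x. card (E x) = dim (eigenspace L x)"
    "\<And>x. span (E x) = eigenspace L x"
    by metis
  define B where "B = (\<Union>x. E x)"
  have ortho: "pairwise orthogonal B"
    unfolding pairwise_def orthogonal_def
  proof (intro ballI impI)
    fix v w assume "v \<in> B" "w \<in> B" "v \<noteq> w"
    then obtain x y where xy: "v \<in> E x" "w \<in> E y" by (auto simp: B_def)
    show "v \<bullet> w = 0"
    proof (cases "x = y")
      case True
      then show ?thesis using E(2)[of x] xy \<open>v \<noteq> w\<close> by (auto simp: pairwise_def orthogonal_def)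
    next
      case False
      then show ?thesis using eigenspaces_orthogonal[OF L] E(1) xy by blast
    qed
  qed
  have norm: "norm b = 1" if "b \<in> B" for b using that E(3) by (auto simp: B_def)
  have indep: "independent B" using orthonormal_imp_independent[OF ortho norm] .
  have ev: "\<exists>x. b \<in> eigenspace L x" if "b \<in> B" for b using that E(1) by (auto simp: B_def)
  have "span B = UNIV"
  proof (rule ccontr)
    assume "span B \<noteq> UNIV"
    then have "span B \<subset> span UNIV" by auto
    then obtain u where u: "u \<noteq> 0" "\<And>y. y \<in> span B \<Longrightarrow> orthogonal u y"
      using orthogonal_to_subspace_exists_gen by metis
    define V where "V = {y. \<forall>b\<in>B. b \<bullet> y = 0}"
    have V: "subspace V" by (auto simp: V_def subspace_def inner_right_distrib)
    have LV: "L *v y \<in> V" if "y \<in> V" for y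
      unfolding V_def
    proof (intro CollectI ballI)
      fix b assume b: "b \<in> B"
      then obtain x where "L *v b = x *\<^sub>R b" using ev by blast
      then show "b \<bullet> (L *v y) = 0" using symmetric_inner[OF L, of b y] that b by (simp add: V_def)
    qed
    have uV: "u \<in> V" using u(2) by (auto simp: V_def orthogonal_def inner_commute span_base)
    obtain x v where v: "v \<in> V" "norm v = 1" "L *v v = x *\<^sub>R v"
      by (rule symmetric_eigenvector_exists[OF L V LV uV u(1)])
    then have "v \<in> span (E x)" using E(5) by simp
    moreover have "E x \<subseteq> {y. v \<bullet> y = 0}" using v(1) by (auto simp: V_def B_def inner_commute)
    moreover have "subspace {y. v \<bullet> y = 0}" by (rule subspace_hyperplane)
    ultimately have "v \<bullet> v = 0" using span_minimal[of "E x" "{y. v \<bullet> y = 0}"] by blast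
    then show False using v(2) by simp
  qed
  then have card: "card B = CARD('n)"
    using dim_eq_card_independent[OF indep] dim_span[of B] by (simp add: dim_UNIV)
  have fin: "finite B" using indep independent_imp_finite by blast
  have "B \<inter> eigenspace L x = E x" for x
  proof
    show "E x \<subseteq> B \<inter> eigenspace L x" using E(1) by (auto simp: B_def)
    show "B \<inter> eigenspace L x \<subseteq> E x"
    proof
      fix b assume b: "b \<in> B \<inter> eigenspace L x"
      then obtain y where y: "b \<in> E y" by (auto simp: B_def)
      have "b \<noteq> 0" using norm b by force
      then have "x = y"
        using b E(1)[of y] y by auto
      then show "b \<in> E x" using y by simp
    qed
  qed
  then show thesis using that[OF ortho norm fin card ev] E(4) by simp
qed

text \<open>Counting an eigenbasis by eigenvalue reproduces the multiset in
  \<open>eigval_list\<close>, so sorting the basis by eigenvalue aligns its vectors with that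
  list.\<close>

lemma orthonormal_eigenvectors_exist:
  fixes L :: "real^'n^'n"
  assumes L: "L \<in> sym_matrices"
  shows "length (eigval_list L) = CARD('n)" "\<exists>v. orthonormal_eigenvectors L v"
proof -
  obtain B where B: "pairwise orthogonal B" "\<And>b. b \<in> B \<Longrightarrow> norm b = 1" "finite B" "card B = CARD('n)"
    "\<And>b. b \<in> B \<Longrightarrow> \<exists>x. b \<in> eigenspace L x"
    "\<And>x. card (B \<inter> eigenspace L x) = dim (eigenspace L x)"
    by (rule eigenbasis_exists[OF L]) (rule that)
  define ev where "ev b = (SOME x. L *v b = x *\<^sub>R b)" for b
  have ev: "L *v b = ev b *\<^sub>R b" if "b \<in> B" for b
    unfolding ev_def by (rule someI_ex) (use B(5)[OF that] in simp)
  have ev_iff: "L *v b = x *\<^sub>R b \<longleftrightarrow> ev b = x" if "b \<in> B" for b x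
    using ev[OF that] B(2)[OF that] by auto
  have evals: "{x. \<exists>v. v \<noteq> 0 \<and> L *v v = x *\<^sub>R v} = ev ` B" (is "?X = _")
  proof (intro set_eqI iffI)
    fix x assume "x \<in> ?X"
    then have "dim (eigenspace L x) \<noteq> 0" by (auto simp: dim_eq_0)
    then have "B \<inter> eigenspace L x \<noteq> {}" using B(6)[of x] by (metis card.empty)
    then show "x \<in> ev ` B" using ev_iff by auto
  next
    fix x assume "x \<in> ev ` B"
    then obtain b where b: "b \<in> B" "x = ev b" by blast
    then have "b \<noteq> 0" using B(2) by force
    then show "x \<in> ?X" using ev b by blast
  qed
  let ?M = "\<Sum>x\<in>ev ` B. replicate_mset (dim (eigenspace L x)) x"
  have M: "?M = image_mset ev (mset_set B)"
  proof (rule multiset_eqI)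
    fix x
    have "count ?M x = (\<Sum>y\<in>ev ` B. if y = x then dim (eigenspace L y) else 0)"
      unfolding count_sum by (intro sum.cong) auto
    also have "\<dots> = (if x \<in> ev ` B then dim (eigenspace L x) else 0)" using B(3) by (simp add: sum.delta')
    also have "\<dots> = card {b \<in> B. ev b = x}"
    proof -
      have "B \<inter> eigenspace L x = {b \<in> B. ev b = x}" using ev_iff by auto
      moreover have "{b \<in> B. ev b = x} = {}" if "x \<notin> ev ` B" using that by auto
      ultimately show ?thesis using B(6)[of x] by (metis card.empty)
    qed
    also have "\<dots> = count (image_mset ev (mset_set B)) x"
    proof -
      have "ev -` {x} \<inter> B = {b \<in> B. ev b = x}" by auto
      then show ?thesis using B(3) by (simp add: count_image_mset)
    qed
    finally show "count ?M x = count (image_mset ev (mset_set B)) x" .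
  qed
  obtain bs0 where bs0: "distinct bs0" "set bs0 = B" using finite_distinct_list[OF B(3)] by blast
  define bs where "bs = sort_key ev bs0"
  have bs: "distinct bs" "set bs = B" "length bs = CARD('n)"
    using bs0 B(4) by (auto simp: bs_def distinct_card[symmetric])
  have list: "eigval_list L = map ev bs"
  proof -
    have "eigval_list L = sorted_list_of_multiset (mset (map ev bs))"
      unfolding eigval_list_def evals M using bs by (simp add: mset_set_set[symmetric])
    also have "\<dots> = sort (map ev bs)" by (rule sorted_list_of_multiset_mset)
    also have "\<dots> = map ev bs" by (rule sorted_sort_id) (simp add: bs_def)
    finally show ?thesis .
  qed
  show "length (eigval_list L) = CARD('n)" using list bs by simp
  \<comment> \<open>Eigenvalues are numbered from 1, list positions from 0.\<close>
  have "orthonormal_eigenvectors L (\<lambda>i. bs ! (i - 1))"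
    unfolding orthonormal_eigenvectors_def
  proof (intro conjI ballI)
    fix i assume i: "i \<in> {1..CARD('n)}"
    then have lt: "i - 1 < length bs" using bs by auto
    then have mem: "bs ! (i - 1) \<in> B" using bs nth_mem by blast
    then show "L *v bs ! (i - 1) = eigval L i *\<^sub>R bs ! (i - 1)"
      using lt ev by (simp add: eigval_def list)
    fix j assume j: "j \<in> {1..CARD('n)}"
    then have ltj: "j - 1 < length bs" using bs by auto
    then have memj: "bs ! (j - 1) \<in> B" using bs nth_mem by blast
    show "bs ! (i - 1) \<bullet> bs ! (j - 1) = (if i = j then 1 else 0)"
    proof (cases "i = j")
      case True
      then show ?thesis using B(2)[OF mem] by (simp add: norm_eq_1)
    next
      case False
      then have "bs ! (i - 1) \<noteq> bs ! (j - 1)" using i j bs(1) lt ltj by (auto simp: nth_eq_iff_index_eq)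
      then show ?thesis using False B(1) mem memj by (auto simp: pairwise_def orthogonal_def)
    qed
  qed
  then show "\<exists>v. orthonormal_eigenvectors L v" by blast
qed

lemma outer_vector_mult: "outer v *v x = (v \<bullet> x) *\<^sub>R v"
  by (simp add: outer_def matrix_vector_mult_def vec_eq_iff inner_vec_def sum_distrib_right
      sum_distrib_left mult_ac)

lemma outer_inner: "outer v \<bullet> U = v \<bullet> (U *v v)"
  by (simp add: outer_def matrix_vector_mult_def inner_vec_def sum_distrib_left mult_ac)

lemma mat_1_inner: "mat 1 \<bullet> U = trace U"
  by (simp add: inner_vec_def mat_def trace_def if_distrib[of "\<lambda>x. x * _"] cong: if_cong)

lemma sum_matrix_vector_mult:
  "(\<Sum>i\<in>I. f i) *v x = (\<Sum>i\<in>I. f i *v x)"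
  by (induction I rule: infinite_finite_induct) (simp_all add: matrix_vector_mult_add_rdistrib)

lemma scaleR_matrix_vector_mult: "(c *\<^sub>R A) *v x = c *\<^sub>R (A *v x)" for A :: "real^'n^'m"
  by (simp add: matrix_vector_mult_def vec_eq_iff sum_distrib_left mult_ac)

context
  fixes L :: "real^'n^'n" and v :: "nat \<Rightarrow> real^'n"
  assumes v: "orthonormal_eigenvectors L v"
begin

lemma orthonormal_eigenvectors_inner:
  "i \<in> {1..CARD('n)} \<Longrightarrow> j \<in> {1..CARD('n)} \<Longrightarrow> v i \<bullet> v j = (if i = j then 1 else 0)"
  using v unfolding orthonormal_eigenvectors_def by blast

lemma orthonormal_eigenvectors_expansion: "x = (\<Sum>i=1..CARD('n). (v i \<bullet> x) *\<^sub>R v i)"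
proof -
  let ?B = "v ` {1..CARD('n)}"
  have inj: "inj_on v {1..CARD('n)}"
    using orthonormal_eigenvectors_inner by (intro inj_onI) (metis zero_neq_one)
  have "pairwise orthogonal ?B"
    using orthonormal_eigenvectors_inner by (auto simp: pairwise_def orthogonal_def)
  then have "independent ?B"
    using orthonormal_eigenvectors_inner by (intro orthonormal_imp_independent) (auto simp: norm_eq_1)
  then have "dim ?B = CARD('n)" 
    using dim_eq_card_independent card_image[OF inj] by fastforce
  then have span: "span ?B = UNIV"
    by (metis dim_eq_full DIM_cart DIM_real mult_1_right)
  define y where "y = x - (\<Sum>i=1..CARD('n). (v i \<bullet> x) *\<^sub>R v i)"
  have "orthogonal y b" if "b \<in> ?B" for b
  proof -
    from that obtain j where j: "j \<in> {1..CARD('n)}" "b = v j" by blast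
    have "(\<Sum>i=1..CARD('n). (v i \<bullet> x) *\<^sub>R v i) \<bullet> v j = (\<Sum>i=1..CARD('n). if i = j then v i \<bullet> x else 0)"
      unfolding inner_sum_left using orthonormal_eigenvectors_inner j by (intro sum.cong) auto
    then show ?thesis
      using j inner_commute[of x "v j"] by (simp add: y_def orthogonal_def inner_diff_left)
  qed
  then have "orthogonal y y"
    using span by (metis UNIV_I orthogonal_to_span)
  then show ?thesis by (simp add: y_def orthogonal_self)
qed

lemma mat_1_eq_sum_outer: "mat 1 = (\<Sum>i=1..CARD('n). outer (v i))"
  unfolding matrix_eq
  using orthonormal_eigenvectors_expansion by (simp add: sum_matrix_vector_mult outer_vector_mult)

lemma eq_sum_outer: "L = (\<Sum>i=1..CARD('n). eigval L i *\<^sub>R outer (v i))"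
  unfolding matrix_eq
proof
  fix x
  have "L *v x = L *v (\<Sum>i=1..CARD('n). (v i \<bullet> x) *\<^sub>R v i)"
    using orthonormal_eigenvectors_expansion[of x] by simp
  also have "\<dots> = (\<Sum>i=1..CARD('n). (v i \<bullet> x) *\<^sub>R (L *v v i))"
    by (simp add: matrix_vector_mult_scaleR linear_sum[OF matrix_vector_mul_linear])
  also have "\<dots> = (\<Sum>i=1..CARD('n). (v i \<bullet> x) *\<^sub>R (eigval L i *\<^sub>R v i))"
    using v unfolding orthonormal_eigenvectors_def by (intro sum.cong) auto
  finally show "L *v x = (\<Sum>i=1..CARD('n). eigval L i *\<^sub>R outer (v i)) *v x"
    by (simp add: sum_matrix_vector_mult scaleR_matrix_vector_mult outer_vector_mult mult_ac)
qed

lemma sum_outer_quadratic: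
  "x \<bullet> ((\<Sum>i\<in>I. m i *\<^sub>R outer (v i)) *v x) = (\<Sum>i\<in>I. m i * (v i \<bullet> x)\<^sup>2)"
  by (simp add: sum_matrix_vector_mult scaleR_matrix_vector_mult outer_vector_mult inner_sum_right
      power2_eq_square inner_commute mult.assoc)

lemma sum_outer_sym: "(\<Sum>i\<in>I. m i *\<^sub>R outer (v i)) \<in> sym_matrices"
  by (simp add: sym_matrices_def transpose_def vec_eq_iff outer_def mult_ac)

lemma sum_outer_psd: "(\<And>i. i \<in> I \<Longrightarrow> 0 \<le> m i) \<Longrightarrow> psd (\<Sum>i\<in>I. m i *\<^sub>R outer (v i))"
  unfolding psd_def sum_outer_quadratic using sum_outer_sym by (auto intro!: sum_nonneg)

lemma outer_inner_sum_outer: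
  assumes "i \<in> {1..CARD('n)}"
  shows "v i \<bullet> ((\<Sum>j=1..CARD('n). m j *\<^sub>R outer (v j)) *v v i) = m i"
proof -
  have "(\<Sum>j=1..CARD('n). m j * (v j \<bullet> v i)\<^sup>2) = (\<Sum>j=1..CARD('n). if j = i then m j else 0)"
    using orthonormal_eigenvectors_inner assms by (intro sum.cong) auto
  then show ?thesis unfolding sum_outer_quadratic using assms by simp
qed

end

lemma orthonormal_eigenvectors_norm:
  fixes v :: "nat \<Rightarrow> real^'n"
  shows "orthonormal_eigenvectors L v \<Longrightarrow> i \<in> {1..CARD('n)} \<Longrightarrow> v i \<bullet> v i = 1"
  using orthonormal_eigenvectors_inner by fastforce

section \<open>Variational inequality for the spectral step\<close>

lemma Gam_quadratic_bounds:
  assumes "U \<in> Gam k" "x \<bullet> x = 1"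
  shows "0 \<le> x \<bullet> (U *v x)" "x \<bullet> (U *v x) \<le> 1"
  using assms(1) spec[of "\<lambda>x. x \<bullet> (U *v x) \<le> x \<bullet> x" x]
  by (auto simp: Gam_def psd_def matrix_vector_mult_diff_rdistrib inner_diff_right assms(2))

locale spectral_indices =
  fixes L :: "real^'n^'n" and k :: nat
  assumes sym: "L \<in> sym_matrices" and k: "1 \<le> k" "k \<le> CARD('n)"
begin

abbreviation "p \<equiv> lower_index k L"
abbreviation "q \<equiv> upper_index k L"

lemma eigval_mono: "1 \<le> i \<Longrightarrow> i \<le> j \<Longrightarrow> j \<le> CARD('n) \<Longrightarrow> eigval L i \<le> eigval L j"
proof -
  assume "1 \<le> i" "i \<le> j" "j \<le> CARD('n)"
  moreover have "sorted (eigval_list L)" by (simp add: eigval_list_def)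
  ultimately show ?thesis
    using orthonormal_eigenvectors_exist(1)[OF sym] unfolding eigval_def
    by (intro sorted_nth_mono) auto
qed

lemma lower_index_props: "p < k" "ext_eigval L p < ext_eigval L (p + 1)"
proof -
  let ?A = "{i. i < k \<and> ext_eigval L i < ext_eigval L (i + 1)}"
  have "0 \<in> ?A" using k by (auto simp: ext_eigval_def)
  then have "Max ?A \<in> ?A" by (intro Max_in) auto
  then show "p < k" "ext_eigval L p < ext_eigval L (p + 1)" by (simp_all add: lower_index_def)
qed

lemma upper_index_props: "k \<le> q" "q \<le> CARD('n)" "ext_eigval L q < ext_eigval L (q + 1)"
proof -
  have N: "k \<le> CARD('n) \<and> ext_eigval L CARD('n) < ext_eigval L (CARD('n) + 1)"
    using k by (auto simp: ext_eigval_def)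
  show "k \<le> q" "ext_eigval L q < ext_eigval L (q + 1)"
    using LeastI[of "\<lambda>i. k \<le> i \<and> ext_eigval L i < ext_eigval L (i + 1)", OF N]
    by (simp_all add: upper_index_def)
  show "q \<le> CARD('n)"
    unfolding upper_index_def by (rule Least_le) (rule N)
qed

text \<open>No jump can occur strictly between \<open>p\<close> and \<open>q\<close>: below
  \<open>k\<close> it would contradict the maximality of \<open>p\<close>, from \<open>k\<close> on
  the minimality of \<open>q\<close>.\<close>

lemma eigval_const:
  assumes "p < i" "i \<le> q"
  shows "eigval L i = eigval L k"
proof -
  have step: "eigval L (Suc j) = eigval L j" if "p < j" "j < q" for j
  proof -
    have "\<not> ext_eigval L j < ext_eigval L (j + 1)"
    proof (cases "j < k")
      case True
      have "j \<le> Max {i. i < k \<and> ext_eigval L i < ext_eigval L (i + 1)}"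
        if "ext_eigval L j < ext_eigval L (j + 1)"
        using True that by (intro Max_ge) auto
      then show ?thesis using \<open>p < j\<close> by (auto simp: lower_index_def)
    next
      case False
      then show ?thesis using \<open>j < q\<close> not_less_Least unfolding upper_index_def by fastforce
    qed
    then have "eigval L (Suc j) \<le> eigval L j"
      using that upper_index_props(2) by (auto simp: ext_eigval_def)
    then show ?thesis using eigval_mono[of j "Suc j"] that upper_index_props(2) by simp
  qed
  have "eigval L j = eigval L (Suc p)" if "Suc p \<le> j" "j \<le> q" for j
    using that
  proof (induction j rule: dec_induct)
    case (step n)
    then show ?case using \<open>\<And>j. p < j \<Longrightarrow> j < q \<Longrightarrow> eigval L (Suc j) = eigval L j\<close>[of n] by simp
  qed simp
  from this[of i] this[of k] show ?thesis using assms lower_index_props(1) upper_index_props(1) by simp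
qed

text \<open>Eigenvalues of the matrix in \<open>spectral_U\<close>: full weight below the block of
  eigenvalues equal to the \<open>k\<close>-th one, and an equal share of the remaining trace
  \<open>k - p\<close> inside it.\<close>

definition coef :: "nat \<Rightarrow> real" where
  "coef i = (if i \<le> p then 1 else if i \<le> q then (real k - real p) / (real q - real p) else 0)"

lemma coef_ratio: "0 \<le> (real k - real p) / (real q - real p)" "(real k - real p) / (real q - real p) \<le> 1"
  using lower_index_props(1) upper_index_props(1) by (simp_all add: divide_le_eq_1)

lemma coef_bounds: "0 \<le> coef i" "coef i \<le> 1"
  using coef_ratio by (simp_all add: coef_def)

lemma indices_split: "{1..CARD('n)} = {1..p} \<union> {p+1..q} \<union> {q+1..CARD('n)}"
  using lower_index_props(1) upper_index_props(1,2) by auto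

lemma sum_coef:
  fixes f :: "nat \<Rightarrow> 'b::real_vector"
  shows "(\<Sum>i=1..CARD('n). coef i *\<^sub>R f i) = (\<Sum>i=1..p. f i) +
    ((real k - real p) / (real q - real p)) *\<^sub>R (\<Sum>i=p+1..q. f i)"
proof -
  have "(\<Sum>i=1..CARD('n). coef i *\<^sub>R f i) = (\<Sum>i=1..p. coef i *\<^sub>R f i) + (\<Sum>i=p+1..q. coef i *\<^sub>R f i)
      + (\<Sum>i=q+1..CARD('n). coef i *\<^sub>R f i)"
    unfolding indices_split using lower_index_props(1) upper_index_props(1)
    by (subst sum.union_disjoint; auto simp: sum.union_disjoint)+
  also have "(\<Sum>i=1..p. coef i *\<^sub>R f i) = (\<Sum>i=1..p. f i)" by (simp add: coef_def)
  also have "(\<Sum>i=p+1..q. coef i *\<^sub>R f i) = (\<Sum>i=p+1..q. ((real k - real p) / (real q - real p)) *\<^sub>R f i)"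
    by (intro sum.cong) (auto simp: coef_def)
  also have "\<dots> = ((real k - real p) / (real q - real p)) *\<^sub>R (\<Sum>i=p+1..q. f i)"
    by (simp add: scaleR_sum_right)
  also have "(\<Sum>i=q+1..CARD('n). coef i *\<^sub>R f i) = 0"
    using lower_index_props(1) upper_index_props(1) by (intro sum.neutral) (auto simp: coef_def)
  finally show ?thesis by simp
qed

lemma sum_coef_eq: "(\<Sum>i=1..CARD('n). coef i) = real k"
proof -
  have "(\<Sum>i=1..CARD('n). coef i) = (\<Sum>i=1..CARD('n). coef i *\<^sub>R (1::real))" by simp
  also have "\<dots> = real p + (real k - real p) / (real q - real p) * (real q - real p)"
    unfolding sum_coef using lower_index_props(1) upper_index_props(1) by simp
  also have "\<dots> = real k" using lower_index_props(1) upper_index_props(1) by simp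
  finally show ?thesis .
qed

text \<open>The range of \<open>i\<close> forces \<open>p\<close> to be at least 1, so the infinite
  conventions do not enter and the gap is a difference of real eigenvalues.\<close>

lemma gap_lower:
  assumes "ereal \<beta> \<le> spectral_gap k L" "1 \<le> i" "i \<le> p"
  shows "eigval L i + \<beta> \<le> eigval L k"
proof -
  have "ereal \<beta> \<le> ext_eigval L (p + 1) - ext_eigval L p"
    using assms(1) by (simp add: spectral_gap_def Let_def)
  then have "\<beta> \<le> eigval L (p + 1) - eigval L p"
    using assms k lower_index_props(1) by (simp add: ext_eigval_def)
  moreover have "eigval L (p + 1) = eigval L k"
    using lower_index_props(1) upper_index_props(1) by (intro eigval_const) auto
  moreover have "eigval L i \<le> eigval L p"
    using assms k lower_index_props(1) by (intro eigval_mono) auto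
  ultimately show ?thesis by simp
qed

lemma gap_upper:
  assumes "ereal \<beta> \<le> spectral_gap k L" "q < i" "i \<le> CARD('n)"
  shows "eigval L k + \<beta> \<le> eigval L i"
proof -
  have "ereal \<beta> \<le> ext_eigval L (q + 1) - ext_eigval L q"
    using assms(1) by (simp add: spectral_gap_def Let_def)
  then have "\<beta> \<le> eigval L (q + 1) - eigval L q"
    using assms k upper_index_props(1) by (simp add: ext_eigval_def)
  moreover have "eigval L q = eigval L k"
    using lower_index_props(1) upper_index_props(1) by (intro eigval_const) auto
  moreover have "eigval L (q + 1) \<le> eigval L i"
    using assms by (intro eigval_mono) auto
  ultimately show ?thesis by simp
qed

context
  fixes v assumes v: "orthonormal_eigenvectors L v"
begin

definition "proj = (\<Sum>i=1..CARD('n). coef i *\<^sub>R outer (v i))"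

lemma proj_mem_Gam: "proj \<in> Gam k"
proof -
  have "mat 1 - proj = (\<Sum>i=1..CARD('n). (1 - coef i) *\<^sub>R outer (v i))"
    unfolding mat_1_eq_sum_outer[OF v] proj_def by (simp add: sum_subtractf scaleR_left_diff_distrib)
  then have "psd (mat 1 - proj)" using coef_bounds by (simp add: sum_outer_psd[OF v])
  moreover have "psd proj" unfolding proj_def using coef_bounds by (simp add: sum_outer_psd[OF v])
  moreover have "trace proj = real k"
  proof -
    have "trace proj = (\<Sum>i=1..CARD('n). outer (v i) \<bullet> proj)"
      unfolding mat_1_inner[symmetric] mat_1_eq_sum_outer[OF v] inner_sum_left ..
    also have "\<dots> = (\<Sum>i=1..CARD('n). coef i)"
      unfolding outer_inner proj_def by (intro sum.cong refl outer_inner_sum_outer[OF v])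
    finally show ?thesis using sum_coef_eq by simp
  qed
  ultimately show ?thesis by (simp add: Gam_def psd_def)
qed

text \<open>\<open>L\<close> and \<open>proj\<close> are diagonal in the same eigenbasis, so only
  the diagonal entries \<open>w i\<close> of \<open>U\<close> in that basis matter. After
  subtraction of a multiplier \<mu> for the trace every summand is nonnegative: both factors are
  nonpositive below the block, the first one vanishes inside it, and both are nonnegative above. The
  gap is what keeps the signs after adding a multiple of \<open>proj\<close>.\<close>

lemma proj_variational:
  assumes gap: "ereal \<beta> \<le> spectral_gap k L" and \<beta>: "0 \<le> \<beta>" and U: "U \<in> Gam k"
  shows "0 \<le> (L + \<beta> *\<^sub>R proj) \<bullet> (U - proj)"
proof -
  let ?c = "(real k - real p) / (real q - real p)"
  define w where "w i = v i \<bullet> (U *v v i)" for i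
  \<comment> \<open>The eigenvalue of \<open>L + \<beta> *\<^sub>R proj\<close> on the middle block.
    Because \<open>U\<close> and \<open>proj\<close> have equal trace, shifting all eigenvalues by
    it leaves the inner product unchanged.\<close>
  define \<mu> where "\<mu> = eigval L k + \<beta> * ?c"
  have w: "0 \<le> w i" "w i \<le> 1" if "i \<in> {1..CARD('n)}" for i
    unfolding w_def by (rule Gam_quadratic_bounds[OF U orthonormal_eigenvectors_norm[OF v that]])+
  have M: "L + \<beta> *\<^sub>R proj = (\<Sum>i=1..CARD('n). (eigval L i + \<beta> * coef i) *\<^sub>R outer (v i))"
    by (subst eq_sum_outer[OF v]) (simp add: proj_def scaleR_sum_right sum.distrib scaleR_left_distrib)
  have diff: "outer (v i) \<bullet> (U - proj) = w i - coef i" if "i \<in> {1..CARD('n)}" for i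
    unfolding inner_diff_right unfolding outer_inner w_def proj_def outer_inner_sum_outer[OF v that] ..
  have tr: "(\<Sum>i=1..CARD('n). w i - coef i) = 0"
  proof -
    have "(\<Sum>i=1..CARD('n). w i - coef i) = (\<Sum>i=1..CARD('n). outer (v i) \<bullet> (U - proj))"
      by (intro sum.cong refl diff[symmetric])
    also have "\<dots> = trace (U - proj)"
      unfolding mat_1_inner[symmetric] mat_1_eq_sum_outer[OF v] inner_sum_left ..
    also have "\<dots> = 0" using U proj_mem_Gam by (simp add: Gam_def trace_sub)
    finally show ?thesis .
  qed
  have "(L + \<beta> *\<^sub>R proj) \<bullet> (U - proj) = (\<Sum>i=1..CARD('n). (eigval L i + \<beta> * coef i) * (w i - coef i))"
    unfolding M inner_sum_left inner_scaleR_left by (intro sum.cong refl) (simp add: diff)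
  also have "\<dots> = (\<Sum>i=1..CARD('n). (eigval L i + \<beta> * coef i - \<mu>) * (w i - coef i))
      + \<mu> * (\<Sum>i=1..CARD('n). w i - coef i)"
    unfolding sum_distrib_left sum.distrib[symmetric] by (intro sum.cong refl) (simp add: algebra_simps)
  finally have eq: "(L + \<beta> *\<^sub>R proj) \<bullet> (U - proj) = (\<Sum>i=1..CARD('n). (eigval L i + \<beta> * coef i - \<mu>) * (w i - coef i))"
    using tr by simp
  have "0 \<le> (eigval L i + \<beta> * coef i - \<mu>) * (w i - coef i)" if i: "i \<in> {1..CARD('n)}" for i
  proof -
    consider "i \<le> p" | "p < i" "i \<le> q" | "q < i" by linarith
    then show ?thesis
    proof cases
      case 1
      then have "eigval L i + \<beta> \<le> eigval L k" using gap_lower[OF gap, of i] i by simp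
      moreover have "0 \<le> \<beta> * ?c" using coef_ratio \<beta> by (intro mult_nonneg_nonneg)
      ultimately show ?thesis using 1 w[OF i] by (intro mult_nonpos_nonpos) (auto simp: coef_def \<mu>_def)
    next
      case 2
      then show ?thesis using eigval_const[of i] by (simp add: coef_def \<mu>_def)
    next
      case 3
      then have "eigval L k + \<beta> \<le> eigval L i" using gap_upper[OF gap, of i] i by simp
      moreover have "\<beta> * ?c \<le> \<beta>" using coef_ratio(2) \<beta> by (rule mult_left_le)
      moreover have "\<not> i \<le> p" "\<not> i \<le> q" using 3 lower_index_props(1) upper_index_props(1) by auto
      ultimately show ?thesis using w[OF i] by (intro mult_nonneg_nonneg) (auto simp: coef_def \<mu>_def)
    qed
  qed
  then show ?thesis unfolding eq by (intro sum_nonneg)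
qed

end
end

text \<open>Adding the two inequalities gives strong monotonicity in \<open>U - V\<close>. With
  \<open>L = M\<close> it says that the variational inequality has only one solution.\<close>

lemma variational_lipschitz:
  fixes U V L M :: "'a::real_inner"
  assumes "0 \<le> (L + \<beta> *\<^sub>R U) \<bullet> (V - U)" "0 \<le> (M + \<beta> *\<^sub>R V) \<bullet> (U - V)"
  shows "\<beta> * norm (U - V) \<le> norm (L - M)"
proof (cases "U = V")
  case False
  have "\<beta> * (norm (U - V))\<^sup>2 \<le> (L - M) \<bullet> (V - U)"
    using assms unfolding power2_norm_eq_inner by (simp add: algebra_simps inner_commute)
  also have "\<dots> \<le> norm (L - M) * norm (U - V)"
    using norm_cauchy_schwarz[of "L - M" "V - U"] by (simp add: norm_minus_commute)
  finally show ?thesis using False by (simp add: power2_eq_square)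
qed simp

text \<open>Uniqueness for \<beta> > 0 shows that all choices of eigenvectors yield the same matrix,
  which resolves the \<open>THE\<close> in \<open>spectral_U\<close>. Any \<gamma> up to \<beta> is
  also below the gap, so the inequality holds for that \<gamma> with the same matrix.\<close>

lemma spectral_U_variational:
  fixes L :: "real^'n^'n"
  assumes L: "L \<in> sym_matrices" and k: "1 \<le> k" "k \<le> CARD('n)"
    and gap: "0 < \<beta>" "ereal \<beta> \<le> spectral_gap k L"
  shows "spectral_U k L \<in> Gam k"
    "0 \<le> \<gamma> \<Longrightarrow> \<gamma> \<le> \<beta> \<Longrightarrow> V \<in> Gam k \<Longrightarrow> 0 \<le> (L + \<gamma> *\<^sub>R spectral_U k L) \<bullet> (V - spectral_U k L)"
proof -
  interpret spectral_indices L k using L k by unfold_locales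
  obtain v where v: "orthonormal_eigenvectors L v" using orthonormal_eigenvectors_exist(2)[OF L] by blast
  have eq: "proj v' = proj v" if v': "orthonormal_eigenvectors L v'" for v'
  proof -
    have "\<beta> * norm (proj v' - proj v) \<le> norm (L - L)"
      using gap v v' by (intro variational_lipschitz proj_variational proj_mem_Gam) auto
    then show ?thesis using gap(1) by (simp add: mult_le_0_iff)
  qed
  have "spectral_U k L = proj v"
    unfolding spectral_U_def Let_def sum_coef[symmetric]
  proof (rule the_equality)
    show "\<exists>v'. orthonormal_eigenvectors L v' \<and> proj v = (\<Sum>i=1..CARD('n). coef i *\<^sub>R outer (v' i))"
      using v proj_def[OF v] by blast
    show "U = proj v" if "\<exists>v'. orthonormal_eigenvectors L v' \<and> U = (\<Sum>i=1..CARD('n). coef i *\<^sub>R outer (v' i))" for U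
      using that eq proj_def by metis
  qed
  then show "spectral_U k L \<in> Gam k"
    "0 \<le> \<gamma> \<Longrightarrow> \<gamma> \<le> \<beta> \<Longrightarrow> V \<in> Gam k \<Longrightarrow> 0 \<le> (L + \<gamma> *\<^sub>R spectral_U k L) \<bullet> (V - spectral_U k L)"
    using proj_mem_Gam[OF v] proj_variational[OF v] gap order_trans[of "ereal \<gamma>" "ereal \<beta>"] by auto
qed

section \<open>The iteration\<close>

lemma sum_UNIV_Plus:
  fixes f :: "'a::finite + 'b::finite \<Rightarrow> 'c::comm_monoid_add"
  shows "(\<Sum>x\<in>UNIV. f x) = (\<Sum>a\<in>UNIV. f (Inl a)) + (\<Sum>b\<in>UNIV. f (Inr b))"
  by (simp add: UNIV_Plus_UNIV[symmetric] sum.Plus del: UNIV_Plus_UNIV)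

lemma adjacency_simps:
  "adjacency W $ Inl i $ Inl i' = 0" "adjacency W $ Inr j $ Inr j' = 0"
  "adjacency W $ Inl i $ Inr j = \<bar>W $ i $ j\<bar>" "adjacency W $ Inr j $ Inl i = \<bar>W $ i $ j\<bar>"
  by (simp_all add: adjacency_def)

lemma laplacian_simps:
  "laplacian W $ Inl i $ Inl i' = (if i = i' then \<Sum>j\<in>UNIV. \<bar>W $ i $ j\<bar> else 0)"
  "laplacian W $ Inr j $ Inr j' = (if j = j' then \<Sum>i\<in>UNIV. \<bar>W $ i $ j\<bar> else 0)"
  "laplacian W $ Inl i $ Inr j = - \<bar>W $ i $ j\<bar>" "laplacian W $ Inr j $ Inl i = - \<bar>W $ i $ j\<bar>"
  by (simp_all add: laplacian_def matrix_vector_mult_def sum_UNIV_Plus adjacency_simps)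

lemma sym_matrices_iff: "U \<in> sym_matrices \<longleftrightarrow> (\<forall>a b. U $ a $ b = U $ b $ a)"
  by (auto simp: sym_matrices_def transpose_def vec_eq_iff)

lemma laplacian_sym: "laplacian W \<in> sym_matrices"
  unfolding sym_matrices_iff split_sum_all by (simp add: laplacian_simps)

definition abs_matrix :: "real^'t^'d \<Rightarrow> real^'t^'d" where
  "abs_matrix W = (\<chi> i j. \<bar>W $ i $ j\<bar>)"

text \<open>Each edge enters once through either diagonal block and twice off the diagonal. The
  coupling thereby becomes a weighted l1 norm of \<open>W\<close> with weights
  \<open>pair_dist U\<close>, which separates over the entries.\<close>

lemma laplacian_inner:
  assumes "U \<in> sym_matrices"
  shows "laplacian W \<bullet> U = abs_matrix W \<bullet> pair_dist U"
proof -
  have sym: "U $ Inr j $ Inl i = U $ Inl i $ Inr j" for i j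
    using assms by (simp add: sym_matrices_iff)
  have "laplacian W \<bullet> U = (\<Sum>i\<in>UNIV. (\<Sum>j\<in>UNIV. \<bar>W $ i $ j\<bar>) * U $ Inl i $ Inl i)
      + (\<Sum>j\<in>UNIV. (\<Sum>i\<in>UNIV. \<bar>W $ i $ j\<bar>) * U $ Inr j $ Inr j)
      - (\<Sum>i\<in>UNIV. \<Sum>j\<in>UNIV. \<bar>W $ i $ j\<bar> * U $ Inl i $ Inr j)
      - (\<Sum>j\<in>UNIV. \<Sum>i\<in>UNIV. \<bar>W $ i $ j\<bar> * U $ Inl i $ Inr j)"
    by (simp add: inner_vec_def sum_UNIV_Plus laplacian_simps sym sum.distrib sum_negf
        if_distrib[of "\<lambda>x. x * _"] cong: if_cong)
  moreover have "(\<Sum>j\<in>UNIV. (\<Sum>i\<in>UNIV. \<bar>W $ i $ j\<bar>) * U $ Inr j $ Inr j)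
      = (\<Sum>i\<in>UNIV. \<Sum>j\<in>UNIV. \<bar>W $ i $ j\<bar> * U $ Inr j $ Inr j)"
    unfolding sum_distrib_right by (rule sum.swap)
  moreover have "(\<Sum>j\<in>UNIV. \<Sum>i\<in>UNIV. \<bar>W $ i $ j\<bar> * U $ Inl i $ Inr j)
      = (\<Sum>i\<in>UNIV. \<Sum>j\<in>UNIV. \<bar>W $ i $ j\<bar> * U $ Inl i $ Inr j)"
    by (rule sum.swap)
  moreover have "abs_matrix W \<bullet> pair_dist U = (\<Sum>i\<in>UNIV. \<Sum>j\<in>UNIV. \<bar>W $ i $ j\<bar> * U $ Inl i $ Inl i
      + \<bar>W $ i $ j\<bar> * U $ Inr j $ Inr j - \<bar>W $ i $ j\<bar> * U $ Inl i $ Inr j - \<bar>W $ i $ j\<bar> * U $ Inl i $ Inr j)"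
    unfolding inner_vec_def by (intro sum.cong refl) (simp add: abs_matrix_def pair_dist_def algebra_simps)
  ultimately show ?thesis by (simp add: sum_distrib_right sum_distrib_left sum.distrib sum_subtractf sum_negf)
qed

lemma linear_pair_dist: "linear (pair_dist :: real^('d::finite + 't::finite)^('d + 't) \<Rightarrow> real^'t^'d)"
  by (intro linearI) (simp_all add: pair_dist_def vec_eq_iff algebra_simps)

lemma norm_abs_matrix_diff: "norm (abs_matrix V - abs_matrix W) \<le> norm (V - W)"
proof -
  have "norm (abs_matrix V $ i - abs_matrix W $ i) \<le> norm (V $ i - W $ i)" for i
    by (intro norm_le_componentwise_cart) (simp add: abs_matrix_def)
  then show ?thesis by (intro norm_le_componentwise_cart) (simp add: abs_matrix_def)
qed

text \<open>Duality: by \<open>laplacian_inner\<close> the squared norm of the difference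
  \<open>D\<close> is the inner product of \<open>abs_matrix V - abs_matrix W\<close> with
  \<open>pair_dist D\<close>, and \<open>pair_dist\<close> is a bounded linear map.\<close>

lemma laplacian_lipschitz:
  obtains l where "0 \<le> l"
    "\<And>V W :: real^'t::finite^'d::finite. norm (laplacian V - laplacian W) \<le> l * norm (V - W)"
proof -
  obtain l where l: "l > 0" "\<And>U :: real^('d + 't)^('d + 't). norm (pair_dist U) \<le> l * norm U"
    using linear_bounded_pos[OF linear_pair_dist] by blast
  have "norm (laplacian V - laplacian W) \<le> l * norm (V - W)" for V W :: "real^'t^'d"
  proof (cases "laplacian V = laplacian W")
    case False
    let ?D = "laplacian V - laplacian W"
    have "?D \<in> sym_matrices" using laplacian_sym[of V] laplacian_sym[of W] by (simp add: sym_matrices_iff)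
    then have "(norm ?D)\<^sup>2 = (abs_matrix V - abs_matrix W) \<bullet> pair_dist ?D"
      unfolding power2_norm_eq_inner inner_diff_left[of "laplacian V"] by (simp add: laplacian_inner inner_diff_left)
    also have "\<dots> \<le> norm (abs_matrix V - abs_matrix W) * norm (pair_dist ?D)"
      by (rule norm_cauchy_schwarz)
    also have "\<dots> \<le> norm (V - W) * (l * norm ?D)"
      by (intro mult_mono norm_abs_matrix_diff l) auto
    finally show ?thesis using False by (simp add: power2_eq_square mult_ac)
  qed (use l in simp)
  then show thesis using that[of l] l by simp
qed

text \<open>Every condition is linear in \<open>U\<close>, with quantifiers over indices and
  vectors; in this form both closedness and definability of the constraint set can be read
  off.\<close>

lemma Gam_iff:
  "U \<in> Gam k \<longleftrightarrow> (\<forall>a b. U $ a $ b = U $ b $ a) \<and> (\<forall>x. 0 \<le> outer x \<bullet> U) \<and>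
    (\<forall>x. outer x \<bullet> U \<le> outer x \<bullet> mat 1) \<and> mat 1 \<bullet> U = real k"
  unfolding outer_inner mat_1_inner
  by (auto simp: Gam_def psd_def sym_matrices_iff matrix_vector_mult_diff_rdistrib inner_diff_right mat_def)

lemma closed_Gam: "closed (Gam k)"
proof -
  have *: "Gam k = {U. (\<forall>a b. U $ a $ b = U $ b $ a) \<and> (\<forall>x. 0 \<le> outer x \<bullet> U) \<and>
      (\<forall>x. outer x \<bullet> U \<le> outer x \<bullet> mat 1) \<and> mat 1 \<bullet> U = real k}"
    using Gam_iff by blast
  show ?thesis
    unfolding * by (intro closed_Collect_conj closed_Collect_all closed_Collect_eq closed_Collect_le
        continuous_intros)
qed

text \<open>The entry is the quadratic form of \<open>U\<close> at the difference of two unit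
  vectors. Nonnegative weights make the l1 term convex in \<open>W\<close>.\<close>

lemma pair_dist_nonneg:
  assumes "U \<in> Gam k"
  shows "0 \<le> pair_dist U $ i $ j"
proof -
  let ?x = "axis (Inl i) 1 - axis (Inr j) 1 :: real^('a + 'b)"
  have "?x \<bullet> (U *v ?x) = pair_dist U $ i $ j"
    using assms
    by (simp add: matrix_vector_mult_diff_distrib matrix_vector_mult_basis inner_diff_left
        inner_diff_right inner_axis' column_def pair_dist_def Gam_iff)
  then show ?thesis using assms by (simp add: Gam_def psd_def) metis
qed

section \<open>Soft thresholding and quadratic bounds for the smooth part\<close>

lemma soft_threshold_prox:
  fixes v A C \<alpha>2 :: real
  assumes "0 \<le> A" "0 < C" "0 \<le> \<alpha>2"
  defines "w \<equiv> sgn v * max (\<bar>v\<bar> / (1 + \<alpha>2 / C) - A / (C + \<alpha>2)) 0"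
  shows "A * \<bar>w\<bar> + \<alpha>2 / 2 * w\<^sup>2 + C * (v - w) * (w' - w) \<le> A * \<bar>w'\<bar> + \<alpha>2 / 2 * w'\<^sup>2"
proof -
  \<comment> \<open>Stationarity of \<open>w\<close> for the sum of
    \<open>A * \<bar>w\<bar>\<close>, \<open>\<alpha>2 / 2 * w\<^sup>2\<close> and
    \<open>C / 2 * (w - v)\<^sup>2\<close> requires this residual to be a subgradient of the first
    term, that is \<open>\<bar>\<xi>\<bar> \<le> A\<close> and
    \<open>\<xi> * w = A * \<bar>w\<bar>\<close>. The claim is then the subgradient inequality of
    the first two terms at \<open>w\<close>.\<close>
  define \<xi> where "\<xi> = C * v - (C + \<alpha>2) * w"
  have w: "w = sgn v * max ((C * \<bar>v\<bar> - A) / (C + \<alpha>2)) 0"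
  proof -
    have "1 + \<alpha>2 / C = (C + \<alpha>2) / C" using assms by (simp add: field_simps)
    then show ?thesis unfolding w_def by (simp add: diff_divide_distrib mult.commute)
  qed
  have pos: "C + \<alpha>2 > 0" using assms by simp
  have \<xi>: "\<bar>\<xi>\<bar> \<le> A \<and> \<xi> * w = A * \<bar>w\<bar>"
  proof (cases "C * \<bar>v\<bar> \<le> A")
    case True
    then have "w = 0" unfolding w using pos by (simp add: max_def divide_le_0_iff)
    then show ?thesis using True assms(2) by (simp add: \<xi>_def abs_mult)
  next
    case False
    then have "0 \<le> (C * \<bar>v\<bar> - A) / (C + \<alpha>2)" using pos by simp
    then have w': "w = sgn v * ((C * \<bar>v\<bar> - A) / (C + \<alpha>2))"
      unfolding w by (simp only: max_absorb1)
    then have "(C + \<alpha>2) * w = sgn v * (C * \<bar>v\<bar> - A)" using pos by simp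
    then have "\<xi> = sgn v * A"
      unfolding \<xi>_def by (simp add: right_diff_distrib sgn_mult_abs mult.left_commute[of _ C])
    moreover have "v \<noteq> 0" using False assms by auto
    moreover have "\<bar>w\<bar> = (C * \<bar>v\<bar> - A) / (C + \<alpha>2)"
      unfolding w' using False pos \<open>v \<noteq> 0\<close> by (simp add: abs_mult abs_sgn_eq)
    moreover have "\<bar>C * \<bar>v\<bar> - A\<bar> = C * \<bar>v\<bar> - A" using False by simp
    moreover have "\<bar>C + \<alpha>2\<bar> = C + \<alpha>2" using pos by simp
    ultimately show ?thesis using assms(1) w' by (simp add: abs_mult abs_sgn_eq mult_ac)
  qed
  have "\<bar>\<xi>\<bar> * \<bar>w'\<bar> \<le> A * \<bar>w'\<bar>" using \<xi> by (intro mult_right_mono) auto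
  then have "\<xi> * w' \<le> A * \<bar>w'\<bar>"
    using abs_ge_self[of "\<xi> * w'"] unfolding abs_mult by linarith
  moreover have "0 \<le> \<alpha>2 * (w' - w)\<^sup>2" using assms by simp
  moreover have "C * (v - w) * (w' - w) = \<xi> * w' - \<xi> * w + \<alpha>2 * w * (w' - w)"
    by (simp add: \<xi>_def algebra_simps)
  ultimately show ?thesis using \<xi> by (simp add: power2_eq_square algebra_simps)
qed

lemma inner_matrix: "A \<bullet> B = (\<Sum>i\<in>UNIV. \<Sum>j\<in>UNIV. A $ i $ j * B $ i $ j)" for A B :: "real^'m^'n"
  by (simp add: inner_vec_def)

lemma power2_norm_matrix: "(norm A)\<^sup>2 = (\<Sum>i\<in>UNIV. \<Sum>j\<in>UNIV. (A $ i $ j)\<^sup>2)" for A :: "real^'m^'n"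
  unfolding power2_norm_eq_inner inner_matrix by (simp add: power2_eq_square)

lemma threshold_prox:
  fixes D V W' :: "real^'t::finite^'d::finite"
  assumes "\<And>i j. 0 \<le> D $ i $ j" "0 < C" "0 \<le> \<alpha>1" "0 \<le> \<alpha>2"
  defines "W \<equiv> threshold \<alpha>1 \<alpha>2 C D V"
  shows "\<alpha>1 * (abs_matrix W \<bullet> D) + \<alpha>2 / 2 * (norm W)\<^sup>2 + C * ((V - W) \<bullet> (W' - W))
    \<le> \<alpha>1 * (abs_matrix W' \<bullet> D) + \<alpha>2 / 2 * (norm W')\<^sup>2"
proof -
  have "\<alpha>1 * D $ i $ j * \<bar>W $ i $ j\<bar> + \<alpha>2 / 2 * (W $ i $ j)\<^sup>2 + C * (V $ i $ j - W $ i $ j) * (W' $ i $ j - W $ i $ j)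
      \<le> \<alpha>1 * D $ i $ j * \<bar>W' $ i $ j\<bar> + \<alpha>2 / 2 * (W' $ i $ j)\<^sup>2" for i j
    using soft_threshold_prox[of "\<alpha>1 * D $ i $ j" C \<alpha>2 "V $ i $ j" "W' $ i $ j"] assms
    by (simp add: threshold_def)
  then have "(\<Sum>i\<in>UNIV. \<Sum>j\<in>UNIV. \<alpha>1 * D $ i $ j * \<bar>W $ i $ j\<bar> + \<alpha>2 / 2 * (W $ i $ j)\<^sup>2
        + C * (V $ i $ j - W $ i $ j) * (W' $ i $ j - W $ i $ j))
      \<le> (\<Sum>i\<in>UNIV. \<Sum>j\<in>UNIV. \<alpha>1 * D $ i $ j * \<bar>W' $ i $ j\<bar> + \<alpha>2 / 2 * (W' $ i $ j)\<^sup>2)"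
    by (intro sum_mono)
  then show ?thesis
    by (simp add: power2_norm_matrix inner_matrix abs_matrix_def sum_distrib_left sum.distrib mult_ac)
qed

text \<open>Both signs are wanted: the upper bound gives descent, the lower bound serves as a
  substitute for convexity of \<open>J\<close> in the subgradient inequality.\<close>

lemma smooth_quadratic_bounds:
  fixes J :: "'a::real_inner \<Rightarrow> real"
  assumes J: "\<And>x. GDERIV J x :> g x" and lip: "\<rho>-lipschitz_on UNIV g"
  shows "\<bar>J y - J x - g x \<bullet> (y - x)\<bar> \<le> \<rho> / 2 * (norm (y - x))\<^sup>2"
proof -
  define d where "d = y - x"
  \<comment> \<open>The sign \<open>s\<close> treats both bounds at once; the Lipschitz bound on the
    gradient makes \<open>\<phi> s\<close> nonincreasing on the unit interval, and comparing its
    values at 1 and 0 is the claim.\<close>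
  define \<phi> where "\<phi> s t = s * (J (x + t *\<^sub>R d) - t * (g x \<bullet> d)) - \<rho> / 2 * t\<^sup>2 * (norm d)\<^sup>2" for s t :: real
  have "\<phi> s 1 \<le> \<phi> s 0" if s: "\<bar>s\<bar> = 1" for s
  proof (rule DERIV_nonpos_imp_nonincreasing[of 0 1 "\<phi> s"])
    fix t :: real assume t: "0 \<le> t" "t \<le> 1"
    have "((\<lambda>t. J (x + t *\<^sub>R d)) has_derivative (\<lambda>h. (h *\<^sub>R d) \<bullet> g (x + t *\<^sub>R d))) (at t)"
      by (rule has_derivative_compose[OF _ J[unfolded gderiv_def]]) (auto intro!: derivative_eq_intros)
    then have "((\<lambda>t. J (x + t *\<^sub>R d)) has_real_derivative (d \<bullet> g (x + t *\<^sub>R d))) (at t)"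
      unfolding has_field_derivative_def by (simp add: mult_commute_abs)
    then have "(\<phi> s has_real_derivative (s * (d \<bullet> g (x + t *\<^sub>R d) - g x \<bullet> d) - \<rho> * t * (norm d)\<^sup>2)) (at t)"
      unfolding \<phi>_def by (auto intro!: derivative_eq_intros)
    moreover have "s * (d \<bullet> g (x + t *\<^sub>R d) - g x \<bullet> d) \<le> \<rho> * t * (norm d)\<^sup>2"
    proof -
      have "s * (d \<bullet> g (x + t *\<^sub>R d) - g x \<bullet> d) = (s *\<^sub>R d) \<bullet> (g (x + t *\<^sub>R d) - g x)"
        by (simp add: inner_diff_right right_diff_distrib inner_commute)
      also have "\<dots> \<le> norm (s *\<^sub>R d) * norm (g (x + t *\<^sub>R d) - g x)" by (rule norm_cauchy_schwarz)
      also have "\<dots> \<le> norm d * (\<rho> * norm (t *\<^sub>R d))"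
        using lipschitz_onD[OF lip, of "x + t *\<^sub>R d" x] s by (simp add: dist_norm mult_left_mono)
      finally show ?thesis using t by (simp add: power2_eq_square mult_ac)
    qed
    ultimately show "\<exists>y. (\<phi> s has_real_derivative y) (at t) \<and> y \<le> 0" by (intro exI conjI) auto
  qed simp
  from this[of 1] this[of "-1"] show ?thesis unfolding abs_le_iff by (simp add: \<phi>_def d_def)
qed

text \<open>
  For \<open>\<gamma> = 0\<close> this is the objective on \<open>\<Gamma>\<close>. The term in \<open>\<gamma>\<close> makes the subproblem for \<open>U\<close>
  strongly convex without changing the iteration, as long as \<open>\<gamma>\<close> is at most the spectral gap.
\<close>

definition regularized_objective ::
    "(real^'t^'d \<Rightarrow> real) \<Rightarrow> real \<Rightarrow> real \<Rightarrow> real \<Rightarrow> (real^'t^'d) \<times> (real^('d::finite + 't::finite)^('d + 't)) \<Rightarrow> real" where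
  "regularized_objective J \<alpha>1 \<alpha>2 \<gamma> z = J (fst z) + \<alpha>1 * (abs_matrix (fst z) \<bullet> pair_dist (snd z))
     + \<alpha>2 / 2 * (norm (fst z))\<^sup>2 + \<alpha>1 * (\<gamma> / 2 * (norm (snd z))\<^sup>2)"

lemma objective_eq_regularized_objective:
  "snd z \<in> Gam k \<Longrightarrow> objective J \<alpha>1 \<alpha>2 k z = ereal (regularized_objective J \<alpha>1 \<alpha>2 0 z)"
  by (cases z) (simp add: objective_def regularized_objective_def indicator_infty_def laplacian_inner Gam_def)

lemma objective_infinite: "snd z \<notin> Gam k \<Longrightarrow> objective J \<alpha>1 \<alpha>2 k z = \<infinity>"
  by (cases z) (simp add: objective_def indicator_infty_def)

section \<open>One step of the algorithm: subgradient and descent\<close>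

lemma quadratic_expansion:
  fixes x y :: "'a::real_inner"
  shows "(norm y)\<^sup>2 = (norm x)\<^sup>2 + 2 * (x \<bullet> (y - x)) + (norm (y - x))\<^sup>2"
  by (simp add: power2_norm_eq_inner algebra_simps inner_commute)

locale tfcl_step =
  fixes J :: "real^'t^'d \<Rightarrow> real" and gradJ :: "real^'t^'d \<Rightarrow> real^'t^'d"
    and \<alpha>1 \<alpha>2 C \<rho> \<gamma> l :: real and k :: nat
    and W W' :: "real^'t::finite^'d::finite" and U :: "real^('d + 't)^('d + 't)"
  assumes J_grad: "\<And>V. GDERIV J V :> gradJ V" and lip: "\<rho>-lipschitz_on UNIV gradJ"
    and params: "0 < \<alpha>1" "0 < \<alpha>2" "\<rho> < C" "0 \<le> \<gamma>"
    and l: "0 \<le> l" "\<And>V W :: real^'t^'d. norm (laplacian V - laplacian W) \<le> l * norm (V - W)"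
    and U: "U \<in> Gam k"
    and U_var: "\<And>V. V \<in> Gam k \<Longrightarrow> 0 \<le> (laplacian W + \<gamma> *\<^sub>R U) \<bullet> (V - U)"
    and W': "W' = threshold \<alpha>1 \<alpha>2 C (pair_dist U) (grad_step gradJ C W)"
begin

lemma \<rho>_nonneg: "0 \<le> \<rho>"
  using lip by (simp add: lipschitz_on_def)

lemma C_pos: "0 < C"
  using \<rho>_nonneg params by simp

lemma prox:
  "\<alpha>1 * (abs_matrix W' \<bullet> pair_dist U) + \<alpha>2 / 2 * (norm W')\<^sup>2 + (C *\<^sub>R (W - W') - gradJ W) \<bullet> (V - W')
    \<le> \<alpha>1 * (abs_matrix V \<bullet> pair_dist U) + \<alpha>2 / 2 * (norm V)\<^sup>2"
proof -
  have "(C *\<^sub>R (W - W') - gradJ W) = C *\<^sub>R (grad_step gradJ C W - W')"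
    using C_pos by (simp add: grad_step_def scaleR_diff_right)
  then show ?thesis
    using threshold_prox[of "pair_dist U" C \<alpha>1 \<alpha>2 "grad_step gradJ C W" V] pair_dist_nonneg[OF U]
      C_pos params unfolding W' by simp
qed

text \<open>What is left of the optimality conditions at the new point. \<open>U\<close> was optimal
  for the old Laplacian and \<open>W'\<close> for the gradient at the old \<open>W\<close>, so the
  components are differences between new and old data, plus the proximal term. \<gamma> does not
  appear in it.\<close>

definition subgrad :: "(real^'t^'d) \<times> (real^('d + 't)^('d + 't))" where
  "subgrad = (gradJ W' - gradJ W - C *\<^sub>R (W' - W), \<alpha>1 *\<^sub>R (laplacian W' - laplacian W))"

lemma norm_subgrad: "norm subgrad \<le> (\<rho> + C + \<alpha>1 * l) * norm (W' - W)"
proof -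
  have "norm subgrad \<le> norm (gradJ W' - gradJ W - C *\<^sub>R (W' - W)) + norm (\<alpha>1 *\<^sub>R (laplacian W' - laplacian W))"
    unfolding subgrad_def by (rule norm_Pair_le)
  also have "norm (gradJ W' - gradJ W - C *\<^sub>R (W' - W)) \<le> norm (gradJ W' - gradJ W) + norm (C *\<^sub>R (W' - W))"
    by (rule norm_triangle_ineq4)
  also have "norm (gradJ W' - gradJ W) \<le> \<rho> * norm (W' - W)"
    using lipschitz_onD[OF lip, of W' W] by (simp add: dist_norm)
  also have "norm (\<alpha>1 *\<^sub>R (laplacian W' - laplacian W)) \<le> \<alpha>1 * (l * norm (W' - W))"
    using params l(2)[of W' W] by simp
  also have "norm (C *\<^sub>R (W' - W)) = C * norm (W' - W)" using C_pos by simp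
  finally show ?thesis by (simp add: distrib_right mult.assoc)
qed

lemma subgrad_sym: "snd subgrad \<in> sym_matrices"
  using laplacian_sym[of W'] laplacian_sym[of W] by (simp add: subgrad_def sym_matrices_iff)

text \<open>The proximal inequality handles \<open>W\<close> and \<open>U_var\<close> handles
  \<open>U\<close>. Two sources of nonconvexity remain and produce the quadratic error:
  \<open>J\<close> contributes \<open>\<rho> / 2\<close>, the coupling of the blocks
  \<open>\<alpha>1 * l / 2\<close>.\<close>

lemma subgrad_inequality:
  assumes z: "snd z \<in> Gam k"
  shows "regularized_objective J \<alpha>1 \<alpha>2 \<gamma> (W', U) + subgrad \<bullet> (z - (W', U))
    - (\<rho> / 2 + \<alpha>1 * l / 2) * (norm (z - (W', U)))\<^sup>2 \<le> regularized_objective J \<alpha>1 \<alpha>2 \<gamma> z"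
proof -
  obtain V X where VX: "z = (V, X)" by (cases z)
  have X: "X \<in> Gam k" using z VX by simp
  have sym: "U \<in> sym_matrices" "X \<in> sym_matrices" using U X by (auto simp: Gam_def)
  let ?n = "(norm (z - (W', U)))\<^sup>2"
  have n: "?n = (norm (V - W'))\<^sup>2 + (norm (X - U))\<^sup>2" by (simp add: VX norm_Pair)
  have J: "J W' + gradJ W' \<bullet> (V - W') - \<rho> / 2 * (norm (V - W'))\<^sup>2 \<le> J V"
    using smooth_quadratic_bounds[OF J_grad lip, of V W'] unfolding abs_le_iff by linarith
  \<comment> \<open>The mixed term left when both blocks change. The Lipschitz bound and the
    arithmetic-geometric mean inequality turn it into a multiple of the squared distance.\<close>
  have "(laplacian V - laplacian W') \<bullet> (X - U) \<ge> - (l * norm (V - W') * norm (X - U))"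
    using Cauchy_Schwarz_ineq2[of "laplacian V - laplacian W'" "X - U"]
      mult_right_mono[OF l(2)[of V W'], of "norm (X - U)"] by simp
  moreover have "norm (V - W') * norm (X - U) \<le> ?n / 2"
    unfolding n using sum_squares_bound[of "norm (V - W')" "norm (X - U)"] by simp
  then have "l * norm (V - W') * norm (X - U) \<le> l * (?n / 2)"
    using mult_left_mono[OF _ l(1)] by (simp only: mult.assoc)
  ultimately have cross: "(laplacian V - laplacian W') \<bullet> (X - U) \<ge> - (l * (?n / 2))" by simp
  have "0 \<le> \<gamma> / 2 * (norm (X - U))\<^sup>2" using params by simp
  then have quad: "\<gamma> * (U \<bullet> (X - U)) \<le> \<gamma> / 2 * (norm X)\<^sup>2 - \<gamma> / 2 * (norm U)\<^sup>2"
    unfolding quadratic_expansion[of X U] by (simp add: algebra_simps)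
  have "0 \<le> (laplacian W + \<gamma> *\<^sub>R U) \<bullet> (X - U)" by (rule U_var[OF X])
  then have var: "(laplacian W' - laplacian W) \<bullet> (X - U) \<le> laplacian W' \<bullet> (X - U) + \<gamma> * (U \<bullet> (X - U))"
    by (simp add: inner_diff_left inner_add_left)
  have lap: "laplacian V \<bullet> X = laplacian V \<bullet> U + laplacian W' \<bullet> (X - U) + (laplacian V - laplacian W') \<bullet> (X - U)"
    by (simp add: inner_diff_left inner_diff_right)
  have "(laplacian W' - laplacian W) \<bullet> (X - U) - l * (?n / 2) + (laplacian V \<bullet> U + \<gamma> / 2 * (norm U)\<^sup>2)
      \<le> laplacian V \<bullet> X + \<gamma> / 2 * (norm X)\<^sup>2"
    using cross quad var lap by linarith
  from mult_left_mono[OF this, of \<alpha>1]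
  have U_part: "\<alpha>1 * ((laplacian W' - laplacian W) \<bullet> (X - U)) - \<alpha>1 * l / 2 * ?n
      + \<alpha>1 * (abs_matrix V \<bullet> pair_dist U) + \<alpha>1 * (\<gamma> / 2 * (norm U)\<^sup>2)
      \<le> \<alpha>1 * (abs_matrix V \<bullet> pair_dist X) + \<alpha>1 * (\<gamma> / 2 * (norm X)\<^sup>2)"
    unfolding laplacian_inner[OF sym(1), symmetric] laplacian_inner[OF sym(2), symmetric]
    using params(1) by (simp add: algebra_simps)
  have "\<rho> / 2 * (norm (V - W'))\<^sup>2 \<le> \<rho> / 2 * ?n" unfolding n using \<rho>_nonneg by (intro mult_left_mono) auto
  moreover have "subgrad \<bullet> (z - (W', U)) = gradJ W' \<bullet> (V - W') + (C *\<^sub>R (W - W') - gradJ W) \<bullet> (V - W')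
      + \<alpha>1 * ((laplacian W' - laplacian W) \<bullet> (X - U))"
    by (simp add: VX subgrad_def inner_prod_def inner_diff_left inner_diff_right algebra_simps)
  ultimately show ?thesis
    using J prox[of V] U_part by (simp add: regularized_objective_def VX distrib_right)
qed

text \<open>\<open>U\<close> is updated first: \<gamma>-strong convexity yields the gain
  \<open>\<alpha>1 * \<gamma> / 2\<close> times the squared step in \<open>U\<close>. The proximal
  gradient step in \<open>W\<close> with \<open>U\<close> fixed then yields the rest. For \<gamma> =
  0 the common factor is 0 and the step in \<open>U\<close> is not controlled.\<close>

lemma descent:
  assumes U0: "U0 \<in> Gam k"
  shows "regularized_objective J \<alpha>1 \<alpha>2 \<gamma> (W', U) \<le> regularized_objective J \<alpha>1 \<alpha>2 \<gamma> (W, U0)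
    - min (C - \<rho>) (\<alpha>1 * \<gamma> / 2) * (norm ((W', U) - (W, U0)))\<^sup>2"
proof -
  let ?m = "min (C - \<rho>) (\<alpha>1 * \<gamma> / 2)"
  have sym: "U \<in> sym_matrices" "U0 \<in> sym_matrices" using U U0 by (auto simp: Gam_def)
  have J: "J W' \<le> J W + gradJ W \<bullet> (W' - W) + \<rho> / 2 * (norm (W' - W))\<^sup>2"
    using smooth_quadratic_bounds[OF J_grad lip, of W' W] unfolding abs_le_iff by linarith
  have "(C *\<^sub>R (W - W') - gradJ W) \<bullet> (W - W') = C * (norm (W' - W))\<^sup>2 + gradJ W \<bullet> (W' - W)"
    by (simp add: power2_norm_eq_inner inner_diff_left inner_diff_right algebra_simps inner_commute)
  with J prox[of W] have "regularized_objective J \<alpha>1 \<alpha>2 \<gamma> (W', U) \<le> regularized_objective J \<alpha>1 \<alpha>2 \<gamma> (W, U)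
      - C * (norm (W' - W))\<^sup>2 + \<rho> / 2 * (norm (W' - W))\<^sup>2"
    by (simp add: regularized_objective_def)
  moreover have "\<rho> / 2 * (norm (W' - W))\<^sup>2 \<le> \<rho> * (norm (W' - W))\<^sup>2"
    \<comment> \<open>The gain of the \<open>W\<close> step is \<open>C - \<rho> / 2\<close>; it is
      weakened here to \<open>C - \<rho>\<close>, still positive by assumption.\<close>
    using \<rho>_nonneg by (intro mult_right_mono) auto
  moreover have "?m * (norm (W' - W))\<^sup>2 \<le> (C - \<rho>) * (norm (W' - W))\<^sup>2"
    by (intro mult_right_mono) auto
  ultimately have 1: "regularized_objective J \<alpha>1 \<alpha>2 \<gamma> (W', U) \<le> regularized_objective J \<alpha>1 \<alpha>2 \<gamma> (W, U) - ?m * (norm (W' - W))\<^sup>2"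
    by (simp add: left_diff_distrib)
  have "laplacian W \<bullet> U + \<gamma> / 2 * (norm U)\<^sup>2 + \<gamma> / 2 * (norm (U - U0))\<^sup>2 \<le> laplacian W \<bullet> U0 + \<gamma> / 2 * (norm U0)\<^sup>2"
    using U_var[OF U0] unfolding quadratic_expansion[of U0 U] norm_minus_commute[of U U0]
    by (simp add: inner_add_left inner_diff_right algebra_simps)
  then have "\<alpha>1 * (laplacian W \<bullet> U + \<gamma> / 2 * (norm U)\<^sup>2 + \<gamma> / 2 * (norm (U - U0))\<^sup>2)
      \<le> \<alpha>1 * (laplacian W \<bullet> U0 + \<gamma> / 2 * (norm U0)\<^sup>2)"
    using params by (intro mult_left_mono) auto
  then have "regularized_objective J \<alpha>1 \<alpha>2 \<gamma> (W, U) \<le> regularized_objective J \<alpha>1 \<alpha>2 \<gamma> (W, U0) - \<alpha>1 * \<gamma> / 2 * (norm (U - U0))\<^sup>2"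
    unfolding laplacian_inner[OF sym(1)] laplacian_inner[OF sym(2)]
    by (simp add: regularized_objective_def algebra_simps)
  moreover have "?m * (norm (U - U0))\<^sup>2 \<le> \<alpha>1 * \<gamma> / 2 * (norm (U - U0))\<^sup>2"
    by (intro mult_right_mono min.cobounded2) simp
  moreover have "(norm ((W', U) - (W, U0)))\<^sup>2 = (norm (W' - W))\<^sup>2 + (norm (U - U0))\<^sup>2"
    by (simp add: norm_Pair)
  ultimately show ?thesis using 1 by (simp add: distrib_left)
qed

end

section \<open>Definability and continuity of the regularised objective\<close>

context o_minimal_structure begin

lemma definable_map_nth: "definable_map (\<lambda>x::real^'n. x $ i)"
  using definable_map_Basis[of "axis i (1::real)"] by (simp add: inner_axis axis_in_Basis_iff)

lemma definable_map_nth_nth: "definable_map (\<lambda>A::real^'m^'n. A $ i $ j)"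
  using definable_map_Basis[of "axis i (axis j (1::real))"] by (simp add: inner_axis axis_in_Basis_iff)

lemma definable_Gam: "definable {z :: 'z::euclidean_space \<times> (real^'n^'n). snd z \<in> Gam k}"
proof -
  have entry: "definable_map (\<lambda>p :: (real^'n^'n) \<times> (real^'n). fst p $ a $ b)"
    "definable_map (\<lambda>p :: (real^'n^'n) \<times> (real^'n). snd p $ c)" for a b c
    by (rule definable_map_fst[OF definable_map_nth_nth], rule definable_map_snd[OF definable_map_nth])
  have out: "definable_map (\<lambda>p :: (real^'n^'n) \<times> (real^'n). outer (snd p) \<bullet> fst p)"
    unfolding inner_matrix outer_def
    by (simp, intro definable_map_sum definable_map_mult entry)
  have out1: "definable_map (\<lambda>p :: (real^'n^'n) \<times> (real^'n). outer (snd p) \<bullet> mat 1)"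
    unfolding inner_matrix outer_def
    by (simp, intro definable_map_sum definable_map_mult entry definable_map_const)
  have tr: "definable_map (\<lambda>U :: real^'n^'n. mat 1 \<bullet> U)"
    unfolding inner_matrix
    by (intro definable_map_sum definable_map_mult definable_map_nth_nth definable_map_const)
  have sym: "definable {U :: real^'n^'n. \<forall>a\<in>UNIV. \<forall>b\<in>UNIV. U $ a $ b = U $ b $ a}"
    by (intro definable_finite_ball definable_equal definable_map_nth_nth) auto
  have "definable {U :: real^'n^'n. (\<forall>a\<in>UNIV. \<forall>b\<in>UNIV. U $ a $ b = U $ b $ a) \<and> (\<forall>x. 0 \<le> outer x \<bullet> U) \<and>
      (\<forall>x. outer x \<bullet> U \<le> outer x \<bullet> mat 1) \<and> mat 1 \<bullet> U = real k}"
    by (intro definable_conj definable_all definable_le definable_equal definable_map_const sym out out1 tr)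
  moreover have "{U :: real^'n^'n. (\<forall>a\<in>UNIV. \<forall>b\<in>UNIV. U $ a $ b = U $ b $ a) \<and> (\<forall>x. 0 \<le> outer x \<bullet> U) \<and>
      (\<forall>x. outer x \<bullet> U \<le> outer x \<bullet> mat 1) \<and> mat 1 \<bullet> U = real k} = Gam k"
    using Gam_iff by blast
  ultimately show ?thesis
    by (intro definable_vimage definable_map_snd[OF definable_map_Basis]) simp_all
qed

lemma definable_regularized_objective:
  fixes J :: "real^'t::finite^'d::finite \<Rightarrow> real"
  assumes "definable_map J"
  shows "definable_map (regularized_objective J \<alpha>1 \<alpha>2 \<gamma>)"
proof -
  have fst_map: "definable_map (\<lambda>z :: (real^'t^'d) \<times> (real^('d + 't)^('d + 't)). norm (fst z))"
    and snd_map: "definable_map (\<lambda>z :: (real^'t^'d) \<times> (real^('d + 't)^('d + 't)). norm (snd z))"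
    by (rule definable_map_norm, rule definable_map_fst[OF definable_map_Basis] definable_map_snd[OF definable_map_Basis], assumption)+
  have "definable_map (\<lambda>z :: (real^'t^'d) \<times> (real^('d + 't)^('d + 't)). abs_matrix (fst z) \<bullet> pair_dist (snd z))"
    unfolding inner_matrix abs_matrix_def pair_dist_def
    by (simp, intro definable_map_sum definable_map_mult definable_map_add definable_map_diff definable_map_abs
        definable_map_const definable_map_fst[OF definable_map_nth_nth] definable_map_snd[OF definable_map_nth_nth])
  then show ?thesis
    unfolding regularized_objective_def[abs_def] power2_eq_square
    by (intro definable_map_add definable_map_mult definable_map_const definable_map_fst[OF assms] fst_map snd_map)
qed

end

lemma continuous_on_regularized_objective:
  fixes J :: "real^'t::finite^'d::finite \<Rightarrow> real"
  assumes "\<And>V. GDERIV J V :> gradJ V"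
  shows "continuous_on A (regularized_objective J \<alpha>1 \<alpha>2 \<gamma>)"
proof -
  have "continuous_on UNIV J"
    using assms unfolding gderiv_def
    by (intro has_derivative_continuous_on[of _ _ "\<lambda>V h. h \<bullet> gradJ V"]) auto
  then have J: "continuous_on A (\<lambda>z. J (fst z))"
    by (rule continuous_on_compose2) (auto intro!: continuous_intros)
  show ?thesis
    unfolding regularized_objective_def[abs_def] inner_matrix abs_matrix_def pair_dist_def
    by (simp, intro continuous_intros J) simp_all
qed

section \<open>From quadratic subgradient inequalities to the convergence theorem\<close>

lemma regular_subgradient_quadratic:
  assumes z: "z \<in> X" "v \<in> X" and F: "f z = ereal r"
    and c: "\<And>y. y \<in> X \<Longrightarrow> f z + ereal (v \<bullet> (y - z) - c * (norm (y - z))\<^sup>2) \<le> f y"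
  shows "regular_subgradient X f z v"
  unfolding regular_subgradient_def
proof (intro conjI allI impI)
  fix \<epsilon> :: real assume \<epsilon>: "\<epsilon> > 0"
  show "\<forall>\<^sub>F y in at z within X. f z + ereal (v \<bullet> (y - z) - \<epsilon> * norm (y - z)) \<le> f y"
    unfolding eventually_at
  proof (intro exI conjI ballI impI)
    \<comment> \<open>Within this radius the quadratic error is below \<epsilon> times the distance;
      the summand 1 keeps the radius defined for \<open>c = 0\<close>.\<close>
    show "\<epsilon> / (\<bar>c\<bar> + 1) > 0" using \<epsilon> by simp
    fix y assume y: "y \<in> X" "y \<noteq> z \<and> dist y z < \<epsilon> / (\<bar>c\<bar> + 1)"
    then have "(\<bar>c\<bar> + 1) * norm (y - z) \<le> \<epsilon>" by (simp add: dist_norm field_simps)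
    then have "\<bar>c\<bar> * norm (y - z) \<le> \<epsilon>" using norm_ge_zero[of "y - z"] unfolding distrib_right by linarith
    then have "c * norm (y - z) \<le> \<epsilon>" using mult_right_mono[OF abs_ge_self[of c] norm_ge_zero[of "y - z"]] by linarith
    then have "c * (norm (y - z))\<^sup>2 \<le> \<epsilon> * norm (y - z)"
      using mult_right_mono[of "c * norm (y - z)" \<epsilon> "norm (y - z)"] by (simp add: power2_eq_square mult.assoc)
    then have "f z + ereal (v \<bullet> (y - z) - \<epsilon> * norm (y - z)) \<le> f z + ereal (v \<bullet> (y - z) - c * (norm (y - z))\<^sup>2)"
      by (intro add_left_mono) simp
    also have "\<dots> \<le> f y" by (rule c[OF y(1)])
    finally show "f z + ereal (v \<bullet> (y - z) - \<epsilon> * norm (y - z)) \<le> f y" .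
  qed
qed (use z F in auto)

lemma regular_subgradient_imp_limiting:
  "regular_subgradient X f z v \<Longrightarrow> v \<in> limiting_subdiff X f z"
  unfolding limiting_subdiff_def
  by (intro CollectI conjI exI[of _ "\<lambda>_. z"] exI[of _ "\<lambda>_. v"] allI)
     (auto simp: regular_subgradient_def)

lemma summable_increments_imp_convergent:
  fixes z :: "nat \<Rightarrow> 'a::banach"
  assumes "summable (\<lambda>t. norm (z (Suc t) - z t))"
  obtains zstar where "z \<longlonglongrightarrow> zstar"
proof -
  have "(\<lambda>n. \<Sum>t<n. z (Suc t) - z t) \<longlonglongrightarrow> (\<Sum>t. z (Suc t) - z t)"
    by (rule summable_LIMSEQ[OF summable_norm_cancel[OF assms]])
  then have "(\<lambda>n. z n - z 0) \<longlonglongrightarrow> (\<Sum>t. z (Suc t) - z t)"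
    by (simp add: sum_lessThan_telescope)
  from tendsto_add[OF this tendsto_const[of "z 0"]] show thesis by (intro that) simp
qed

theorem theorem5:
  fixes J :: "real^'t^'d \<Rightarrow> real"
    and gradJ :: "real^'t^'d \<Rightarrow> real^'t^'d"
    and S :: "nat \<Rightarrow> real list set set"
    and \<alpha>1 \<alpha>2 \<alpha>3 C \<rho> :: real
    and k :: nat
    and W :: "nat \<Rightarrow> real^'t^'d"
    and U :: "nat \<Rightarrow> real^('d + 't)^('d + 't)"
  defines "F \<equiv> objective J \<alpha>1 \<alpha>2 k"
    and "X \<equiv> (UNIV :: (real^'t^'d) set) \<times> (sym_matrices :: (real^('d + 't)^('d + 't)) set)"
  assumes k: "1 \<le> k" "k \<le> CARD('d + 't)"
    and omin: "o_minimal S" and J_def: "definable_fun S J"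
    and J_bound: "0 < (INF V. ereal (J V))"
    and J_grad: "\<And>V. GDERIV J V :> gradJ V"
    and gradJ_lip: "\<rho>-lipschitz_on UNIV gradJ"
    and params: "0 < \<alpha>1" "0 < \<alpha>2" "\<rho> < C"
    and seq: "tfcl_sequence k gradJ \<alpha>1 \<alpha>2 C W U"
    and gap: "0 < \<alpha>3" "ereal \<alpha>3 < ereal (2 * C) * (INF t. spectral_gap k (laplacian (W t)))"
  shows "(\<exists>Wstar Ustar.
            (\<lambda>t. (W t, U t)) \<longlonglongrightarrow> (Wstar, Ustar) \<and>
            critical_point X F (Wstar, Ustar) \<and>
            (\<lambda>t. F (W t, U t)) \<longlonglongrightarrow> F (Wstar, Ustar)) \<and>
         (\<exists>g. (\<forall>t\<ge>1. g t \<in> limiting_subdiff X F (W t, U t)) \<and>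
            (\<lambda>M. (1 / real M) * (\<Sum>t=1..M. (norm (g t))\<^sup>2)) \<longlonglongrightarrow> 0 \<and>
            (\<lambda>M. (1 / real M) * (\<Sum>t=1..M. (norm (g t))\<^sup>2)) \<in> O(\<lambda>M. 1 / real M))"
proof -
  interpret o_minimal_structure S using omin by unfold_locales
  define \<beta> where "\<beta> = \<alpha>3 / (2 * C)"
  have \<rho>: "0 \<le> \<rho>" using gradJ_lip by (simp add: lipschitz_on_def)
  then have C: "0 < C" using params by simp
  then have \<beta>: "0 < \<beta>" using gap(1) by (simp add: \<beta>_def)
  have gap_t: "ereal \<beta> \<le> spectral_gap k (laplacian (W t))" for t
  proof -
    have "ereal (2 * C) * (INF t. spectral_gap k (laplacian (W t))) \<le> ereal (2 * C) * spectral_gap k (laplacian (W t))"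
      using C by (intro ereal_mult_left_mono INF_lower) auto
    with gap(2) have *: "ereal \<alpha>3 < ereal (2 * C) * spectral_gap k (laplacian (W t))" by (rule order.strict_trans2)
    show ?thesis
    \<comment> \<open>The gap is infinite when all eigenvalues coincide, as for
      \<open>W t = 0\<close>, so extended values have to be treated.\<close>
    proof (cases "spectral_gap k (laplacian (W t))")
      case (real r)
      then have "\<alpha>3 < 2 * C * r" using * by simp
      then show ?thesis using real C by (simp add: \<beta>_def divide_le_eq mult.commute)
    next
      case MInf
      then show ?thesis using * C by simp
    qed simp
  qed
  have J_nonneg: "0 \<le> J V" for V
  proof -
    have "(INF V. ereal (J V)) \<le> ereal (J V)" by (rule INF_lower) simp
    with J_bound have "0 < ereal (J V)" by (rule order.strict_trans2)
    then show ?thesis by simp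
  qed
  have step: "U (Suc t) = spectral_U k (laplacian (W t))"
    "W (Suc t) = threshold \<alpha>1 \<alpha>2 C (pair_dist (U (Suc t))) (grad_step gradJ C (W t))" for t
    using seq unfolding tfcl_sequence_def by (auto dest: spec[of _ "Suc t"])
  note variational = spectral_U_variational[OF laplacian_sym k \<beta> gap_t, folded step(1)]
  have U: "U t \<in> Gam k" for t
    using seq variational(1) by (cases t) (simp_all add: tfcl_sequence_def)
  obtain l where l: "0 \<le> l" "\<And>V W :: real^'t^'d. norm (laplacian V - laplacian W) \<le> l * norm (V - W)"
    using laplacian_lipschitz by blast
  have tfcl_step: "tfcl_step J gradJ \<alpha>1 \<alpha>2 C \<rho> \<gamma> l k (W t) (W (Suc t)) (U (Suc t))"
    if "0 \<le> \<gamma>" "\<gamma> \<le> \<beta>" for \<gamma> t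
    using that params J_grad gradJ_lip l U variational(2) step(2) by unfold_locales auto
  note step_\<beta> = tfcl_step[of \<beta>, OF less_imp_le[OF \<beta>] order_refl]
  note step_0 = tfcl_step[of 0, OF order_refl less_imp_le[OF \<beta>]]
  define z where "z t = (W t, U t)" for t
  define f where "f = regularized_objective J \<alpha>1 \<alpha>2 \<beta>"
  define a where "a = min (C - \<rho>) (\<alpha>1 * \<beta> / 2)"
  define b where "b = \<rho> + C + \<alpha>1 * l"
  define c where "c = \<rho> / 2 + \<alpha>1 * l / 2"
  define G where "G t = tfcl_step.subgrad gradJ \<alpha>1 C (W t) (W (Suc t))" for t
  have a: "0 < a" using params \<beta> by (simp add: a_def)
  have b: "0 \<le> b" and c: "0 \<le> c" using \<rho> C params l by (simp_all add: b_def c_def)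
  have descent: "f (z (Suc t)) \<le> f (z t) - a * (norm (z (Suc t) - z t))\<^sup>2" for t
    using tfcl_step.descent[OF step_\<beta> U] unfolding z_def f_def a_def .
  have G_norm: "norm (G t) \<le> b * norm (z (Suc t) - z t)" for t
  proof -
    have "norm (G t) \<le> b * norm (W (Suc t) - W t)"
      using tfcl_step.norm_subgrad[OF step_\<beta>] unfolding G_def b_def .
    also have "\<dots> \<le> b * norm (z (Suc t) - z t)"
      using norm_fst_le[of "W (Suc t) - W t" "U (Suc t) - U t"] b
      by (intro mult_left_mono) (simp_all add: z_def)
    finally show ?thesis .
  qed
  have G_\<beta>: "f (z (Suc t)) + G t \<bullet> (y - z (Suc t)) - c * (norm (y - z (Suc t)))\<^sup>2 \<le> f y"
    if "snd y \<in> Gam k" for t y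
    using tfcl_step.subgrad_inequality[OF step_\<beta> that] unfolding z_def f_def c_def G_def .
  \<comment> \<open>The same vectors \<open>G t\<close> as in the inequality for \<open>f\<close>,
    now with \<gamma> = 0: this instance speaks about the original objective.\<close>
  have G_0: "regularized_objective J \<alpha>1 \<alpha>2 0 (z (Suc t)) + G t \<bullet> (y - z (Suc t)) - c * (norm (y - z (Suc t)))\<^sup>2
      \<le> regularized_objective J \<alpha>1 \<alpha>2 0 y" if "snd y \<in> Gam k" for t y
    using tfcl_step.subgrad_inequality[OF step_0 that] unfolding z_def c_def G_def .
  have zX: "z t \<in> X" for t using U by (simp add: z_def X_def Gam_def)
  have F_z: "F y = ereal (regularized_objective J \<alpha>1 \<alpha>2 0 y)" if "snd y \<in> Gam k" for y
    unfolding F_def by (rule objective_eq_regularized_objective[OF that])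
  have reg: "regular_subgradient X F (z (Suc t)) (G t)" for t
  proof (rule regular_subgradient_quadratic[OF zX])
    show "G t \<in> X"
      using tfcl_step.subgrad_sym[OF step_0] by (auto simp: X_def G_def mem_Times_iff)
    show "F (z (Suc t)) = ereal (regularized_objective J \<alpha>1 \<alpha>2 0 (z (Suc t)))"
      using U by (intro F_z) (simp add: z_def)
    fix y assume "y \<in> X"
    show "F (z (Suc t)) + ereal (G t \<bullet> (y - z (Suc t)) - c * (norm (y - z (Suc t)))\<^sup>2) \<le> F y"
    proof (cases "snd y \<in> Gam k")
      case True
      have "snd (z (Suc t)) \<in> Gam k" using U by (simp add: z_def)
      then show ?thesis using G_0[OF True, of t] True by (simp add: F_z)
    next
      case False
      then show ?thesis by (simp add: F_def objective_infinite)
    qed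
  qed
  \<comment> \<open>Sublevel sets are bounded: the ridge term controls \<open>W\<close>, the added
    \<beta>-term controls \<open>U\<close>, and the loss and the coupling are nonnegative.\<close>
  have coercive: "min (\<alpha>2 / 2) (\<alpha>1 * \<beta> / 2) * (norm y)\<^sup>2 \<le> f y" if "snd y \<in> Gam k" for y
  proof -
    let ?m = "min (\<alpha>2 / 2) (\<alpha>1 * \<beta> / 2)"
    have "(norm y)\<^sup>2 = (norm (fst y))\<^sup>2 + (norm (snd y))\<^sup>2" by (cases y) (simp add: norm_Pair)
    moreover have "?m * (norm (fst y))\<^sup>2 \<le> \<alpha>2 / 2 * (norm (fst y))\<^sup>2" by (intro mult_right_mono min.cobounded1) simp
    moreover have "?m * (norm (snd y))\<^sup>2 \<le> \<alpha>1 * \<beta> / 2 * (norm (snd y))\<^sup>2" by (intro mult_right_mono min.cobounded2) simp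
    moreover have "0 \<le> \<alpha>1 * (abs_matrix (fst y) \<bullet> pair_dist (snd y))"
      using params pair_dist_nonneg[OF that] unfolding inner_matrix abs_matrix_def
      by (intro mult_nonneg_nonneg sum_nonneg) auto
    ultimately show ?thesis using J_nonneg[of "fst y"] by (simp add: f_def regularized_objective_def distrib_left)
  qed
  have m: "0 < min (\<alpha>2 / 2) (\<alpha>1 * \<beta> / 2)" using params \<beta> by simp
  have zG: "snd (z t) \<in> Gam k" for t using U by (simp add: z_def)
  have f_nonneg: "0 \<le> f (z t)" for t
    using coercive[OF zG[of t]] m by (meson less_imp_le mult_nonneg_nonneg order_trans zero_le_power2)
  have f_le: "f (z t) + a * (\<Sum>s<t. (norm (z (Suc s) - z s))\<^sup>2) \<le> f (z 0)" for t
  proof (induction t)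
    case (Suc t)
    then show ?case using descent[of t] by (simp add: distrib_left)
  qed simp
  \<comment> \<open>\<open>f\<close> decreases along the iterates, so coercivity keeps them all in
    the ball of this radius. Intersecting with the constraint set gives a compact definable
    set.\<close>
  define R where "R = sqrt (f (z 0) / min (\<alpha>2 / 2) (\<alpha>1 * \<beta> / 2))"
  define K where "K = cball 0 R \<inter> {y :: (real^'t^'d) \<times> (real^('d + 't)^('d + 't)). snd y \<in> Gam k}"
  have "z t \<in> K" for t
  proof -
    have "0 \<le> a * (\<Sum>s<t. (norm (z (Suc s) - z s))\<^sup>2)" using a by (intro mult_nonneg_nonneg sum_nonneg) auto
    then have "min (\<alpha>2 / 2) (\<alpha>1 * \<beta> / 2) * (norm (z t))\<^sup>2 \<le> f (z 0)"
      using coercive[OF zG[of t]] f_le[of t] by linarith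
    then have "(norm (z t))\<^sup>2 \<le> f (z 0) / min (\<alpha>2 / 2) (\<alpha>1 * \<beta> / 2)"
      using m by (simp add: pos_le_divide_eq mult.commute)
    then have "norm (z t) \<le> R" unfolding R_def by (rule real_le_rsqrt)
    then show ?thesis using zG by (simp add: K_def)
  qed
  note zK = this
  have "closed {y :: (real^'t^'d) \<times> (real^('d + 't)^('d + 't)). snd y \<in> Gam k}"
    using closed_vimage[OF closed_Gam continuous_on_snd[OF continuous_on_id]] by (simp add: vimage_def)
  then have K_compact: "compact K"
    unfolding K_def by (intro compact_Int_closed compact_cball)
  have K_definable: "definable K"
  proof -
    have "definable {y :: (real^'t^'d) \<times> (real^('d + 't)^('d + 't)). norm y \<le> R \<and> snd y \<in> Gam k}"
      by (intro definable_conj definable_le definable_map_const definable_Gam definable_map_norm definable_map_Basis)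
    moreover have "{y :: (real^'t^'d) \<times> (real^('d + 't)^('d + 't)). norm y \<le> R \<and> snd y \<in> Gam k} = K"
      by (auto simp: K_def)
    ultimately show ?thesis by simp
  qed
  have summable: "summable (\<lambda>t. norm (z (Suc t) - z t))"
  proof (rule definable_descent_finite_length[where f=f and z=z, OF K_compact K_definable _ _ zK a b c descent])
    show "continuous_on K f" unfolding f_def by (rule continuous_on_regularized_objective[OF J_grad])
    show "definable_map f"
      unfolding f_def by (intro definable_regularized_objective definable_fun_imp_definable_map J_def)
    fix t y assume "y \<in> K"
    then have "f (z (Suc t)) + G t \<bullet> (y - z (Suc t)) - c * (norm (y - z (Suc t)))\<^sup>2 \<le> f y"
      by (intro G_\<beta>) (simp add: K_def)
    moreover have "- (b * norm (z (Suc t) - z t) * norm (y - z (Suc t))) \<le> G t \<bullet> (y - z (Suc t))"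
      using Cauchy_Schwarz_ineq2[of "G t" "y - z (Suc t)"]
        mult_right_mono[OF G_norm[of t] norm_ge_zero[of "y - z (Suc t)"]] by linarith
    ultimately show "f (z (Suc t)) - b * norm (z (Suc t) - z t) * norm (y - z (Suc t))
        - c * (norm (y - z (Suc t)))\<^sup>2 \<le> f y" by linarith
  qed
  obtain zs where zs: "z \<longlonglongrightarrow> zs"
    using summable_increments_imp_convergent[OF summable] .
  have "zs \<in> K"
    using closed_sequentially[OF compact_imp_closed[OF K_compact] zK zs] .
  then have zsG: "snd zs \<in> Gam k" by (simp add: K_def)
  have F_lim: "(\<lambda>t. F (z t)) \<longlonglongrightarrow> F zs"
  proof -
    have "(\<lambda>t. regularized_objective J \<alpha>1 \<alpha>2 0 (z t)) \<longlonglongrightarrow> regularized_objective J \<alpha>1 \<alpha>2 0 zs"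
      by (rule continuous_on_tendsto_compose[OF continuous_on_regularized_objective[OF J_grad, of UNIV] zs]) auto
    then show ?thesis unfolding F_z[OF zG] F_z[OF zsG] by (rule tendsto_ereal)
  qed
  have G_lim: "G \<longlonglongrightarrow> 0"
  proof (rule Lim_null_comparison)
    show "\<forall>\<^sub>F t in sequentially. norm (G t) \<le> b * norm (z (Suc t) - z t)" using G_norm by simp
    show "(\<lambda>t. b * norm (z (Suc t) - z t)) \<longlonglongrightarrow> 0"
      using tendsto_mult_right_zero[OF summable_LIMSEQ_zero[OF summable]] by simp
  qed
  have "zs \<in> X" using zsG by (auto simp: X_def Gam_def mem_Times_iff)
  \<comment> \<open>The definition of the limiting subdifferential is met directly: the regular
    subgradients \<open>G t\<close> at \<open>z (Suc t)\<close> tend to 0, and points and values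
    converge.\<close>
  then have crit: "critical_point X F zs"
    unfolding critical_point_def limiting_subdiff_def
    using F_z[OF zsG] reg G_lim LIMSEQ_Suc[OF zs] LIMSEQ_Suc[OF F_lim]
    by (intro CollectI conjI exI[of _ "\<lambda>t. z (Suc t)"] exI[of _ G]) auto
  \<comment> \<open>\<open>G t\<close> is a subgradient at the point with index
    \<open>Suc t\<close>, hence the shift.\<close>
  define g where "g t = G (t - 1)" for t
  have g_mem: "g t \<in> limiting_subdiff X F (W t, U t)" if "t \<ge> 1" for t
    using regular_subgradient_imp_limiting[OF reg[of "t - 1"]] that by (simp add: g_def z_def)
  \<comment> \<open>The telescoped descent bounds the sum of squared steps by
    \<open>f (z 0) / a\<close>, as \<open>f\<close> is nonnegative along the iterates; the factor
    \<open>b\<^sup>2\<close> passes from steps to subgradients.\<close>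
  define B where "B = b\<^sup>2 * (f (z 0) / a)"
  have g_sum: "(\<Sum>t=1..M. (norm (g t))\<^sup>2) \<le> B" for M
  proof -
    have "(\<Sum>t=1..M. (norm (g t))\<^sup>2) = (\<Sum>t<M. (norm (G t))\<^sup>2)"
      by (simp add: g_def sum.atLeast1_atMost_eq)
    also have "\<dots> \<le> (\<Sum>t<M. b\<^sup>2 * (norm (z (Suc t) - z t))\<^sup>2)"
      using G_norm by (intro sum_mono) (metis norm_ge_zero power_mono power_mult_distrib)
    also have "\<dots> = b\<^sup>2 * (\<Sum>t<M. (norm (z (Suc t) - z t))\<^sup>2)" by (simp add: sum_distrib_left)
    also have "\<dots> \<le> B"
      unfolding B_def using f_le[of M] f_nonneg[of M] a
      by (intro mult_left_mono) (simp_all add: pos_le_divide_eq mult.commute)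
    finally show ?thesis .
  qed
  \<comment> \<open>For \<open>M = 0\<close> both sides are 0, because
    \<open>1 / real 0 = 0\<close>, so the bound holds for every \<open>M\<close>. It yields the
    limit and the rate together.\<close>
  have avg: "norm ((1 / real M) * (\<Sum>t=1..M. (norm (g t))\<^sup>2)) \<le> B * norm (1 / real M)" for M
  proof -
    have "0 \<le> (\<Sum>t=1..M. (norm (g t))\<^sup>2)" by (intro sum_nonneg) simp
    then show ?thesis using mult_left_mono[OF g_sum[of M], of "1 / real M"] by (simp add: abs_mult mult.commute)
  qed
  have "(\<lambda>M. (1 / real M) * (\<Sum>t=1..M. (norm (g t))\<^sup>2)) \<longlonglongrightarrow> 0"
  proof (rule Lim_null_comparison)
    show "\<forall>\<^sub>F M in sequentially. norm ((1 / real M) * (\<Sum>t=1..M. (norm (g t))\<^sup>2)) \<le> B * norm (1 / real M)"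
      using avg by simp
    show "(\<lambda>M. B * norm (1 / real M)) \<longlonglongrightarrow> 0"
      by (rule tendsto_mult_right_zero[OF tendsto_norm_zero[OF lim_1_over_n]])
  qed
  moreover have "(\<lambda>M. (1 / real M) * (\<Sum>t=1..M. (norm (g t))\<^sup>2)) \<in> O(\<lambda>M. 1 / real M)"
    by (rule bigoI[of _ B]) (use avg in simp)
  moreover have "(\<lambda>t. (W t, U t)) \<longlonglongrightarrow> (fst zs, snd zs)" "critical_point X F (fst zs, snd zs)"
    "(\<lambda>t. F (W t, U t)) \<longlonglongrightarrow> F (fst zs, snd zs)"
    using zs crit F_lim unfolding z_def[abs_def] prod.collapse .
  ultimately show ?thesis using g_mem by blast
qed

end
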